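(* Let $n \geq 2$ be an integer. Then $$\left| NC^{(B)}(n-1,1) \right| = \binom{2n}{n},$$ and for every $0 \leq k \leq n$ we have $$\left| \{ \pi \in NC^{(B)}(n-1,1) \mid \mathrm{rank}(\pi) = k \} \right| = \binom{n}{k}^2 .$$
   Context: Let $p,q$ be positive integers and $N = p+q$ (in the claim, $p=n-1$, $q=1$, $N=n$). The hyperoctahedral group $B_N$ is the group of permutations $\tau$ of $\{\pm 1,\ldots,\pm N\}$ with $\tau(-i) = -\tau(i)$ for $1\le i\le N$. It is generated by the set consisting of the elements $(i,j)(-i,-j)$ and $(i,-j)(-i,j)$ for $1\le i,j\le N$, $i\neq j$, and the elements $(i,-i)$ for $1\le i\le N$. For $\tau\in B_N$, let $\ell_B(\tau)$ be the smallest $k\ge 0$ such that $\tau$ is a product of $k$ of these generators (the empty product being the identity). The partial order on $B_N$ is: $\tau\le\sigma$ if and only if $\ell_B(\sigma)=\ell_B(\tau)+\ell_B(\tau^{-1}\sigma)$. Let $\gamma_{p,q}\in B_N$ be the permutation with two cycles $$\gamma_{p,q} = (1,\ldots,p,-1,\ldots,-p)\,(p+1,\ldots,p+q,-(p+1),\ldots,-(p+q)),$$ and let $\mathcal{S}^{(B)}_{nc}(p,q) = \{\tau\in B_N \mid \tau\le\gamma_{p,q}\}$. For $\tau\in B_N$, let $\Omega(\tau)$ be the partition of $\{\pm1,\ldots,\pm N\}$ into orbits of $\tau$, and let $\widetilde{\Omega}(\tau)$ be the partition obtained from $\Omega(\tau)$ by merging all inversion-invariant blocks (blocks $A$ with $A=-A$),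 if any exist, into one single block. Define $NC^{(B)}(p,q) = \{\widetilde{\Omega}(\tau)\mid \tau\in \mathcal{S}^{(B)}_{nc}(p,q)\}$, partially ordered by $\pi\le\rho$ if and only if every block of $\pi$ is contained in a block of $\rho$. This is a ranked poset with rank function $$\mathrm{rank}(\pi) = (p+q) - \tfrac12\cdot\#\{\text{blocks } A \text{ of } \pi \text{ with } A\ne -A\}.$$ *)

theory Defs
  imports Complex_Main "HOL-Combinatorics.Cycles" "HOL-Combinatorics.Orbits"
begin

definition signed_points :: "nat \<Rightarrow> int set" where
  "signed_points N = {1..int N} \<union> uminus ` {1..int N}"

text \<open>Permutations of \<open>signed_points N\<close> are functions on all of \<open>int\<close> that are the
  identity elsewhere, so that the group operation is composition and the unit is \<open>id\<close>.\<close>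

definition hyperoctahedral :: "nat \<Rightarrow> (int \<Rightarrow> int) set" where
  "hyperoctahedral N =
     {\<tau>. \<tau> permutes signed_points N \<and> (\<forall>i\<in>{1..int N}. \<tau> (- i) = - \<tau> i)}"

definition B_generators :: "nat \<Rightarrow> (int \<Rightarrow> int) set" where
  "B_generators N =
     {transpose i j \<circ> transpose (- i) (- j) | i j. i \<in> {1..int N} \<and> j \<in> {1..int N} \<and> i \<noteq> j}
   \<union> {transpose i (- j) \<circ> transpose (- i) j | i j. i \<in> {1..int N} \<and> j \<in> {1..int N} \<and> i \<noteq> j}
   \<union> {transpose i (- i) | i. i \<in> {1..int N}}"

definition B_length :: "nat \<Rightarrow> (int \<Rightarrow> int) \<Rightarrow> nat" where
  "B_length N \<tau> =
     (LEAST k. \<exists>gs. length gs = k \<and> set gs \<subseteq> B_generators N \<and> \<tau> = foldr (\<circ>) gs id)"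

definition B_le :: "nat \<Rightarrow> (int \<Rightarrow> int) \<Rightarrow> (int \<Rightarrow> int) \<Rightarrow> bool" where
  "B_le N \<tau> \<sigma> \<longleftrightarrow> B_length N \<sigma> = B_length N \<tau> + B_length N (inv \<tau> \<circ> \<sigma>)"

definition B_gamma :: "nat \<Rightarrow> nat \<Rightarrow> int \<Rightarrow> int" where
  "B_gamma p q =
     cycle_of_list ([1..int p] @ map uminus [1..int p])
     \<circ> cycle_of_list ([int p + 1..int (p + q)] @ map uminus [int p + 1..int (p + q)])"

definition S_nc_B :: "nat \<Rightarrow> nat \<Rightarrow> (int \<Rightarrow> int) set" where
  "S_nc_B p q = {\<tau> \<in> hyperoctahedral (p + q). B_le (p + q) \<tau> (B_gamma p q)}"

definition orbit_partition :: "nat \<Rightarrow> (int \<Rightarrow> int) \<Rightarrow> int set set" where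
  "orbit_partition N \<tau> = orbit \<tau> ` signed_points N"

definition inversion_invariant :: "int set \<Rightarrow> bool" where
  "inversion_invariant A \<longleftrightarrow> A = uminus ` A"

definition merged_orbit_partition :: "nat \<Rightarrow> (int \<Rightarrow> int) \<Rightarrow> int set set" where
  "merged_orbit_partition N \<tau> =
     (let Z = {A \<in> orbit_partition N \<tau>. inversion_invariant A}
      in (orbit_partition N \<tau> - Z) \<union> (if Z = {} then {} else {\<Union>Z}))"

definition NC_B :: "nat \<Rightarrow> nat \<Rightarrow> int set set set" where
  "NC_B p q = merged_orbit_partition (p + q) ` S_nc_B p q"

definition NC_B_rank :: "nat \<Rightarrow> nat \<Rightarrow> int set set \<Rightarrow> real" where
  "NC_B_rank p q \<pi> = real (p + q) - 1 / 2 * real (card {A \<in> \<pi>. \<not> inversion_invariant A})"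

end

theory Submission
  imports Defs "HOL-Library.Numeral_Type"
begin

text \<open>
The elements below \<open>\<gamma>\<close> are built one point of the outer circle at a time, the resulting tree is counted
in closed form, and the passage to merged partitions is shown to lose nothing.

\<^bold>\<open>Length.\<close> For an odd permutation \<open>\<tau>\<close> let \<open>fix_dim\<close> be half the number of its orbits \<open>A\<close> with \<open>A \<noteq> - A\<close>.
This is the dimension of the space \<open>Fix \<tau>\<close> of \<open>\<tau>\<close>-invariant odd functions on the signed points. A reflection
changes that dimension by at most one, and every \<open>\<tau> \<noteq> id\<close> admits a reflection that raises it, so
\<open>B_length = N - fix_dim\<close> (\<open>B_length_eq\<close>); in particular the rank of the merged partition is the reflection
length. Functions take values in the field with three elements: dimensions become cardinalities
\<open>3 ^ fix_dim\<close>, so linear algebra reduces to counting, while 2 stays invertible, which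
makes odd functions vanish on orbits \<open>A = - A\<close>.

\<^bold>\<open>Insertion tree.\<close> Let \<open>\<gamma>\<^sub>m\<close> be the permutation with outer circle \<open>1, \<dots>, m\<close> and inner
circle \<open>n\<close>. Every \<open>\<tau>\<close> below \<open>\<gamma>\<^sub>m\<^sub>+\<^sub>1\<close> is uniquely \<open>\<tau>' r\<close> with \<open>\<tau>'\<close> below \<open>\<gamma>\<^sub>m\<close> and \<open>r\<close>
either the identity or a reflection that moves \<open>m + 1\<close> and lowers \<open>\<sigma> = \<tau>'\<^sup>-\<^sup>1 \<gamma>\<^sub>m\<^sub>+\<^sub>1\<close>
(\<open>partial_interval_step\<close>). Which reflections lower \<open>\<sigma>\<close>, and how they change the orbit of \<open>m + 1\<close> in the
complement, depends only on that orbit, and on the inner circle if the orbit is invariant: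
\<^item> a paired orbit of size \<open>s + 1\<close> has children with paired orbits of sizes \<open>1, \<dots>, s\<close>;
\<^item> an invariant orbit of size \<open>2 (s + 1)\<close> has children with paired orbits of sizes \<open>1, \<dots>, s + 1\<close> and with
  invariant orbits of sizes \<open>2, 4, \<dots>, 2 s\<close>;
\<^item> if moreover the inner circle is still a separate invariant orbit, there are two further children, in which
  the two invariant orbits have merged into a paired orbit of size \<open>s + 2\<close>.

In addition there is always the child \<open>r = id\<close>, the only one of the same rank. The recurrences for the number
of descendants are solved by combinations of products of two binomial coefficients (\<open>paired_count\<close>,
\<open>zero_count\<close>, \<open>merge_count\<close>), and at the root they add up to the square of \<open>n choose k\<close>
(\<open>card_partial_interval_rank\<close>).

\<^bold>\<open>Injectivity.\<close> The merged partition of \<open>\<tau>\<close> determines \<open>Fix \<tau>\<close>. For \<open>\<tau>\<close> below \<open>\<gamma>\<close> the space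
\<open>Fix \<tau>\<close> determines \<open>\<tau>\<close>: it determines \<open>Fix \<tau>'\<close> for the parent \<open>\<tau>'\<close>, and two different children of
\<open>\<tau>'\<close> have different spaces because every odd function is a difference of a function in \<open>Fix \<tau>'\<close>
and one in \<open>Fix \<sigma>\<close> (\<open>inj_on_fixed_functions\<close>).
\<close>

section \<open>The field with three elements\<close>

lemma Z3_double_eq_0:
  fixes c :: 3 assumes "c + c = 0" shows "c = 0"
proof -
  have "(1 + 1 + 1 :: 3) = 0" by simp
  moreover have "(1 + 1 + 1) * c = c + c + c" by (simp only: distrib_right mult_1)
  ultimately show ?thesis using assms by (metis add_0_left mult_zero_left)
qed

section \<open>Odd permutations of the signed points\<close>

lemma finite_signed_points [simp]: "finite (signed_points N)"
  by (simp add: signed_points_def)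

lemma mem_signed_points: "y \<in> signed_points N \<longleftrightarrow> y \<noteq> 0 \<and> \<bar>y\<bar> \<le> int N"
proof
  assume "y \<noteq> 0 \<and> \<bar>y\<bar> \<le> int N"
  then show "y \<in> signed_points N"
    unfolding signed_points_def by (cases "y > 0") (auto intro: image_eqI[of _ _ "-y"])
qed (auto simp: signed_points_def)

lemma uminus_mem_signed_points [simp]: "- y \<in> signed_points N \<longleftrightarrow> y \<in> signed_points N"
  by (simp add: mem_signed_points)

lemma card_signed_points: "card (signed_points N) = 2 * N"
proof -
  have "card (signed_points N) = card {1..int N} + card (uminus ` {1..int N})"
    unfolding signed_points_def by (rule card_Un_disjoint) auto
  then show ?thesis by (simp add: card_image)
qed

lemma hyperoctahedral_iff:
  "\<tau> \<in> hyperoctahedral N \<longleftrightarrow> \<tau> permutes signed_points N \<and> (\<forall>y. \<tau> (- y) = - \<tau> y)"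
proof
  assume a: "\<tau> \<in> hyperoctahedral N"
  then have p: "\<tau> permutes signed_points N" and o: "\<And>i. i \<in> {1..int N} \<Longrightarrow> \<tau> (- i) = - \<tau> i"
    by (auto simp: hyperoctahedral_def)
  have "\<tau> (- y) = - \<tau> y" for y
  proof (cases "y \<in> signed_points N")
    case True
    then consider "y \<in> {1..int N}" | "- y \<in> {1..int N}" by (force simp: mem_signed_points)
    then show ?thesis using o[of y] o[of "-y"] by cases auto
  next
    case False
    then show ?thesis using p by (simp add: permutes_def)
  qed
  with p show "\<tau> permutes signed_points N \<and> (\<forall>y. \<tau> (- y) = - \<tau> y)" by blast
qed (auto simp: hyperoctahedral_def)

lemma hyp_permutes: "\<tau> \<in> hyperoctahedral N \<Longrightarrow> \<tau> permutes signed_points N"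
  and hyp_odd: "\<tau> \<in> hyperoctahedral N \<Longrightarrow> \<tau> (- y) = - \<tau> y"
  by (auto simp: hyperoctahedral_iff)

lemma hyp_permutation: "\<tau> \<in> hyperoctahedral N \<Longrightarrow> permutation \<tau>"
  using hyp_permutes finite_signed_points permutation_permutes by blast

lemma hyp_bij: "\<tau> \<in> hyperoctahedral N \<Longrightarrow> bij \<tau>"
  using hyp_permutes permutes_bij by blast

lemma hyp_inj: "\<tau> \<in> hyperoctahedral N \<Longrightarrow> \<tau> a = \<tau> b \<longleftrightarrow> a = b"
  using hyp_bij bij_is_inj inj_eq by metis

lemma hyp_outside: "\<tau> \<in> hyperoctahedral N \<Longrightarrow> y \<notin> signed_points N \<Longrightarrow> \<tau> y = y"
  using hyp_permutes permutes_not_in by metis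

lemma hyp_mem_iff: "\<tau> \<in> hyperoctahedral N \<Longrightarrow> \<tau> y \<in> signed_points N \<longleftrightarrow> y \<in> signed_points N"
  using hyp_permutes permutes_in_image by metis

lemma hyp_id: "id \<in> hyperoctahedral N"
  by (simp add: hyperoctahedral_iff permutes_id)

lemma hyp_comp: "\<sigma> \<in> hyperoctahedral N \<Longrightarrow> \<tau> \<in> hyperoctahedral N \<Longrightarrow> \<sigma> \<circ> \<tau> \<in> hyperoctahedral N"
  by (simp add: hyperoctahedral_iff permutes_compose)

lemma hyp_inv: "\<tau> \<in> hyperoctahedral N \<Longrightarrow> inv \<tau> \<in> hyperoctahedral N"
proof -
  assume t: "\<tau> \<in> hyperoctahedral N"
  have "inv \<tau> (- y) = - inv \<tau> y" for y
    using t by (metis hyp_bij hyp_odd bij_inv_eq_iff)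
  then show ?thesis using t by (simp add: hyperoctahedral_iff permutes_inv)
qed

lemma hyp_inv_comp [simp]:
  "\<tau> \<in> hyperoctahedral N \<Longrightarrow> inv \<tau> (\<tau> y) = y" "\<tau> \<in> hyperoctahedral N \<Longrightarrow> \<tau> (inv \<tau> y) = y"
  using hyp_permutes permutes_inverses by metis+

lemma hyp_pow: "\<tau> \<in> hyperoctahedral N \<Longrightarrow> \<tau> ^^ k \<in> hyperoctahedral N"
  by (induction k) (auto intro: hyp_id hyp_comp)

section \<open>Reflections\<close>

text \<open>One formula for all generators: \<open>j = - x\<close> gives the sign change \<open>(x, - x)\<close>, and \<open>j = x\<close> gives the
identity, so that the case "no reflection" needs no separate treatment.\<close>

definition refl_swap :: "int \<Rightarrow> int \<Rightarrow> int \<Rightarrow> int" where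
  "refl_swap x j y = (if y = x then j else if y = - x then - j
                      else if y = j then x else if y = - j then - x else y)"

lemma refl_swap_self [simp]: "refl_swap x x = id"
  by (auto simp: refl_swap_def)

lemma refl_swap_left [simp]: "refl_swap x j x = j"
  by (auto simp: refl_swap_def)

lemma refl_swap_odd: "x \<noteq> 0 \<Longrightarrow> j \<noteq> 0 \<Longrightarrow> refl_swap x j (- y) = - refl_swap x j y"
  by (auto simp: refl_swap_def)

lemma refl_swap_right: "x \<noteq> 0 \<Longrightarrow> j \<noteq> 0 \<Longrightarrow> refl_swap x j j = x"
  by (auto simp: refl_swap_def)

lemma refl_swap_invol: "x \<noteq> 0 \<Longrightarrow> j \<noteq> 0 \<Longrightarrow> refl_swap x j (refl_swap x j y) = y"
  by (auto simp: refl_swap_def)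

lemma refl_swap_other: "y \<notin> {x, - x, j, - j} \<Longrightarrow> refl_swap x j y = y"
  by (auto simp: refl_swap_def)

lemma refl_swap_hyp:
  assumes "x \<in> signed_points N" "j \<in> signed_points N"
  shows "refl_swap x j \<in> hyperoctahedral N"
proof -
  have nz: "x \<noteq> 0" "j \<noteq> 0" using assms by (auto simp: mem_signed_points)
  have "refl_swap x j permutes signed_points N"
    by (rule bij_imp_permutes[OF bij_betw_byWitness[where f'="refl_swap x j"]])
       (use nz assms in \<open>auto simp: refl_swap_invol\<close>, auto simp: refl_swap_def split: if_splits)
  then show ?thesis using nz by (auto simp: hyperoctahedral_iff refl_swap_odd)
qed

lemma refl_swap_inv: "x \<noteq> 0 \<Longrightarrow> j \<noteq> 0 \<Longrightarrow> inv (refl_swap x j) = refl_swap x j"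
  by (rule inv_unique_comp) (auto simp: refl_swap_invol)

lemma B_generators_eq:
  "B_generators N = {refl_swap x j | x j. x \<in> signed_points N \<and> j \<in> signed_points N \<and> x \<noteq> j}"
proof (intro set_eqI iffI)
  fix g assume "g \<in> B_generators N"
  then consider (1) i j where "g = transpose i j \<circ> transpose (- i) (- j)"
      "i \<in> {1..int N}" "j \<in> {1..int N}" "i \<noteq> j"
    | (2) i j where "g = transpose i (- j) \<circ> transpose (- i) j"
      "i \<in> {1..int N}" "j \<in> {1..int N}" "i \<noteq> j"
    | (3) i where "g = transpose i (- i)" "i \<in> {1..int N}"
    unfolding B_generators_def by blast
  then show "g \<in> {refl_swap x j | x j. x \<in> signed_points N \<and> j \<in> signed_points N \<and> x \<noteq> j}"
  proof cases
    case 1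
    then have "g = refl_swap i j" by (auto simp: refl_swap_def transpose_def fun_eq_iff)
    moreover have "i \<in> signed_points N" "j \<in> signed_points N"
      using 1 by (auto simp: mem_signed_points)
    ultimately show ?thesis using 1 by blast
  next
    case 2
    then have "g = refl_swap i (- j)" by (auto simp: refl_swap_def transpose_def fun_eq_iff)
    moreover have "i \<in> signed_points N" "- j \<in> signed_points N" "i \<noteq> - j"
      using 2 by (auto simp: mem_signed_points)
    ultimately show ?thesis by blast
  next
    case 3
    then have "g = refl_swap i (- i)" by (auto simp: refl_swap_def transpose_def fun_eq_iff)
    moreover have "i \<in> signed_points N" "- i \<in> signed_points N" "i \<noteq> - i"
      using 3 by (auto simp: mem_signed_points)
    ultimately show ?thesis by blast
  qed
next
  fix g assume "g \<in> {refl_swap x j | x j. x \<in> signed_points N \<and> j \<in> signed_points N \<and> x \<noteq> j}"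
  then obtain x j where g: "g = refl_swap x j" and x: "x \<in> signed_points N"
    and j: "j \<in> signed_points N" and ne: "x \<noteq> j" by blast
  have refl_neg: "refl_swap (- x) (- j) = refl_swap x j"
    using x j by (auto simp: refl_swap_def fun_eq_iff mem_signed_points)
  have *: "refl_swap x j \<in> B_generators N" if xj: "x > 0" "x \<in> signed_points N" "j \<in> signed_points N" "x \<noteq> j" for x j
  proof -
    have xi: "x \<in> {1..int N}" using xj by (auto simp: mem_signed_points)
    consider "j = - x" | "j > 0" "j \<noteq> x" | "j < 0" "- j \<noteq> x"
      using xj by (force simp: mem_signed_points)
    then show ?thesis
    proof cases
      case 1
      then have "refl_swap x j = transpose x (- x)" using xj(1)
        by (auto simp: refl_swap_def transpose_def fun_eq_iff)
      then show ?thesis using xi unfolding B_generators_def by blast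
    next
      case 2
      then have "j \<in> {1..int N}" using xj by (auto simp: mem_signed_points)
      moreover have "refl_swap x j = transpose x j \<circ> transpose (- x) (- j)" using xj 2
        by (auto simp: refl_swap_def transpose_def fun_eq_iff)
      ultimately show ?thesis using xi 2 unfolding B_generators_def by blast
    next
      case 3
      then have "- j \<in> {1..int N}" using xj by (auto simp: mem_signed_points)
      moreover have "refl_swap x j = transpose x (- (- j)) \<circ> transpose (- x) (- j)" using xj 3
        by (auto simp: refl_swap_def transpose_def fun_eq_iff)
      ultimately show ?thesis using xi 3 unfolding B_generators_def by blast
    qed
  qed
  show "g \<in> B_generators N"
  proof (cases "x > 0")
    case True
    then show ?thesis using * g x j ne by blast
  next
    case False
    then show ?thesis using *[of "- x" "- j"] g x j ne refl_neg by (auto simp: mem_signed_points)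
  qed
qed

section \<open>Odd functions invariant under an odd permutation\<close>

text \<open>An antisymmetric function is free on one point of each two-element orbit of the involution.\<close>

lemma card_antisymmetric_functions:
  fixes h :: "'a \<Rightarrow> 'a"
  assumes "finite A" "\<And>a. a \<in> A \<Longrightarrow> h a \<in> A \<and> h (h a) = a \<and> h a \<noteq> a"
  shows "even (card A) \<and> card {g :: 'a \<Rightarrow> 3. (\<forall>a\<in>A. g (h a) = - g a) \<and> (\<forall>a. a \<notin> A \<longrightarrow> g a = 0)} = 3 ^ (card A div 2)"
  using assms
proof (induction "card A" arbitrary: A rule: less_induct)
  case less
  let ?G = "\<lambda>A. {g :: 'a \<Rightarrow> 3. (\<forall>a\<in>A. g (h a) = - g a) \<and> (\<forall>a. a \<notin> A \<longrightarrow> g a = 0)}"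
  show ?case
  proof (cases "A = {}")
    case True
    have "?G {} = {\<lambda>_. 0}" by auto
    with True show ?thesis by simp
  next
    case False
    then obtain a where a: "a \<in> A" by blast
    define B where "B = A - {a, h a}"
    have ha: "h a \<in> A" "h (h a) = a" "h a \<noteq> a" using less.prems a by auto
    have fB: "finite B" using less.prems by (simp add: B_def)
    have AB: "A = insert a (insert (h a) B)" "a \<notin> B" "h a \<notin> B" using a ha by (auto simp: B_def)
    have cA: "card A = card B + 2" using AB ha fB by simp
    have hB: "h b \<in> B \<and> h (h b) = b \<and> h b \<noteq> b" if "b \<in> B" for b
    proof -
      have b: "b \<in> A" "b \<noteq> a" "b \<noteq> h a" using that by (auto simp: B_def)
      then have "h b \<in> A" "h (h b) = b" "h b \<noteq> b" using less.prems(2) by blast+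
      moreover have "h b \<noteq> a" "h b \<noteq> h a" using b ha \<open>h (h b) = b\<close> by metis+
      ultimately show ?thesis by (simp add: B_def)
    qed
    have IH: "even (card B)" "card (?G B) = 3 ^ (card B div 2)"
      using less.hyps[of B, OF _ fB hB] cA by simp_all
    let ?F = "\<lambda>(c :: 3, g). g(a := c, h a := - c)"
    have "bij_betw ?F (UNIV \<times> ?G B) (?G A)"
    proof (rule bij_betw_byWitness[where f' = "\<lambda>g. (g a, g(a := 0, h a := 0))"])
      show "\<forall>x\<in>UNIV \<times> ?G B. (\<lambda>g. (g a, g(a := 0, h a := 0))) (?F x) = x"
        using AB ha by (auto simp: fun_eq_iff)
      show "\<forall>g\<in>?G A. ?F (g a, g(a := 0, h a := 0)) = g"
      proof
        fix g assume "g \<in> ?G A"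
        then have "g (h a) = - g a" using a by blast
        then show "?F (g a, g(a := 0, h a := 0)) = g" by (simp add: fun_eq_iff)
      qed
      show "?F ` (UNIV \<times> ?G B) \<subseteq> ?G A"
      proof (clarify, intro conjI ballI allI impI)
        fix c :: 3 and g :: "'a \<Rightarrow> 3" and b
        assume g: "\<forall>a\<in>B. g (h a) = - g a" "\<forall>a. a \<notin> B \<longrightarrow> g a = 0"
        show "(g(a := c, h a := - c)) (h b) = - (g(a := c, h a := - c)) b" if "b \<in> A"
        proof -
          consider "b = a" | "b = h a" | "b \<in> B" using \<open>b \<in> A\<close> AB(1) by blast
          then show ?thesis
          proof cases
            case 3
            then have "h b \<in> B" "g (h b) = - g b" using hB g by blast+
            moreover have "h b \<noteq> a" "h b \<noteq> h a" "b \<noteq> a" "b \<noteq> h a"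
              using AB(2,3) 3 \<open>h b \<in> B\<close> by auto
            ultimately show ?thesis by simp
          qed (use ha in simp_all)
        qed
        show "(g(a := c, h a := - c)) b = 0" if "b \<notin> A"
          using that AB(1) g(2) by simp
      qed
      show "(\<lambda>g. (g a, g(a := 0, h a := 0))) ` ?G A \<subseteq> UNIV \<times> ?G B"
      proof (rule image_subsetI)
        fix g assume "g \<in> ?G A"
        then have g: "\<And>a. a \<in> A \<Longrightarrow> g (h a) = - g a" "\<And>a. a \<notin> A \<Longrightarrow> g a = 0" by blast+
        have "(g(a := 0, h a := 0)) (h b) = - (g(a := 0, h a := 0)) b" if "b \<in> B" for b
        proof -
          have "g (h b) = - g b" "h b \<in> B" using g(1) hB[OF that] that AB(1) by blast+
          moreover have "h b \<noteq> a" "h b \<noteq> h a" "b \<noteq> a" "b \<noteq> h a"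
            using AB(2,3) that \<open>h b \<in> B\<close> by auto
          ultimately show ?thesis by simp
        qed
        moreover have "(g(a := 0, h a := 0)) b = 0" if "b \<notin> B" for b
          using that AB(1) g(2) by simp
        ultimately show "(g a, g(a := 0, h a := 0)) \<in> UNIV \<times> ?G B" by blast
      qed
    qed
    then have "card (?G A) = card (UNIV \<times> ?G B :: (3 \<times> _) set)" by (simp add: bij_betw_same_card)
    then have "card (?G A) = 3 * card (?G B)" by (simp add: card_cartesian_product)
    then show ?thesis using IH cA by simp
  qed
qed

definition odd_functions :: "nat \<Rightarrow> (int \<Rightarrow> 3) set" where
  "odd_functions N = {f. (\<forall>y. f (- y) = - f y) \<and> (\<forall>y. y \<notin> signed_points N \<longrightarrow> f y = 0)}"

definition fixed_functions :: "nat \<Rightarrow> (int \<Rightarrow> int) \<Rightarrow> (int \<Rightarrow> 3) set" where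
  "fixed_functions N \<tau> = {f \<in> odd_functions N. \<forall>y. f (\<tau> y) = f y}"

lemma card_odd_functions: "card (odd_functions N) = 3 ^ N"
proof -
  have eq: "odd_functions N = {f. (\<forall>y\<in>signed_points N. f (- y) = - f y) \<and> (\<forall>y. y \<notin> signed_points N \<longrightarrow> f y = 0)}"
    unfolding odd_functions_def
  proof (intro Collect_cong iffI)
    fix f :: "int \<Rightarrow> 3"
    assume f: "(\<forall>y\<in>signed_points N. f (- y) = - f y) \<and> (\<forall>y. y \<notin> signed_points N \<longrightarrow> f y = 0)"
    have "f (- y) = - f y" for y
      using f by (cases "y \<in> signed_points N") auto
    then show "(\<forall>y. f (- y) = - f y) \<and> (\<forall>y. y \<notin> signed_points N \<longrightarrow> f y = 0)" using f by blast
  qed blast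
  have "card (odd_functions N) = 3 ^ (card (signed_points N) div 2)"
    unfolding eq by (intro conjunct2[OF card_antisymmetric_functions]) (auto simp: mem_signed_points)
  then show ?thesis by (simp add: card_signed_points)
qed

lemma finite_odd_functions [simp]: "finite (odd_functions N)"
  using card_odd_functions[of N] by (intro card_ge_0_finite) simp

lemma fixed_functions_subset: "fixed_functions N \<tau> \<subseteq> odd_functions N"
  by (auto simp: fixed_functions_def)

lemma finite_fixed_functions [simp]: "finite (fixed_functions N \<tau>)"
  using finite_subset[OF fixed_functions_subset] by simp

lemma odd_functions_diff: "f \<in> odd_functions N \<Longrightarrow> g \<in> odd_functions N \<Longrightarrow> f - g \<in> odd_functions N"
  by (auto simp: odd_functions_def)

lemma fixed_functions_diff:
  "f \<in> fixed_functions N \<tau> \<Longrightarrow> g \<in> fixed_functions N \<tau> \<Longrightarrow> f - g \<in> fixed_functions N \<tau>"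
  by (auto simp: fixed_functions_def odd_functions_diff)

lemma fixed_functions_id: "fixed_functions N id = odd_functions N"
  by (auto simp: fixed_functions_def)

lemma fixed_functions_comp: "fixed_functions N \<sigma> \<inter> fixed_functions N \<tau> \<subseteq> fixed_functions N (\<sigma> \<circ> \<tau>)"
  by (auto simp: fixed_functions_def)

section \<open>Orbits\<close>

lemma orbit_eq_if_mem:
  assumes "\<tau> \<in> hyperoctahedral N" "z \<in> orbit \<tau> y" shows "orbit \<tau> z = orbit \<tau> y"
  using orbit_cyclic_eq3[OF cyclic_on_orbit'[OF hyp_permutation[OF assms(1)]] assms(2)] .

lemma self_mem_orbit: "\<tau> \<in> hyperoctahedral N \<Longrightarrow> y \<in> orbit \<tau> y"
  by (rule permutation_self_in_orbit[OF hyp_permutation])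

lemma orbit_eq_iff:
  assumes "\<tau> \<in> hyperoctahedral N" shows "orbit \<tau> z = orbit \<tau> y \<longleftrightarrow> z \<in> orbit \<tau> y"
  using orbit_eq_if_mem[OF assms] self_mem_orbit[OF assms] by blast

lemma orbit_powers:
  assumes "\<tau> \<in> hyperoctahedral N" shows "orbit \<tau> y = range (\<lambda>k. (\<tau> ^^ k) y)"
  using orbit_altdef_permutation[OF hyp_permutation[OF assms]] by auto

lemma orbit_uminus:
  assumes "\<tau> \<in> hyperoctahedral N" shows "orbit \<tau> (- y) = uminus ` orbit \<tau> y"
proof -
  have "(\<tau> ^^ k) (- y) = - (\<tau> ^^ k) y" for k
    using hyp_odd[OF hyp_pow[OF assms]] .
  then show ?thesis by (simp add: orbit_powers[OF assms] image_image)
qed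

lemma inversion_invariant_orbit_iff:
  assumes "\<tau> \<in> hyperoctahedral N"
  shows "inversion_invariant (orbit \<tau> y) \<longleftrightarrow> - y \<in> orbit \<tau> y"
proof -
  have "inversion_invariant (orbit \<tau> y) \<longleftrightarrow> orbit \<tau> (- y) = orbit \<tau> y"
    unfolding inversion_invariant_def orbit_uminus[OF assms] by (rule eq_commute)
  then show ?thesis by (simp only: orbit_eq_iff[OF assms])
qed

lemma orbit_subset_signed_points:
  "\<tau> \<in> hyperoctahedral N \<Longrightarrow> y \<in> signed_points N \<Longrightarrow> orbit \<tau> y \<subseteq> signed_points N"
  by (rule permutes_orbit_subset[OF hyp_permutes])

lemma fixed_function_orbit:
  assumes "f \<in> fixed_functions N \<tau>" "z \<in> orbit \<tau> y" shows "f z = f y"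
  using assms(2,1) by induction (auto simp: fixed_functions_def)

lemma fixed_function_invariant_orbit:
  assumes "f \<in> fixed_functions N \<tau>" "- y \<in> orbit \<tau> y" shows "f y = 0"
proof -
  have "- f y = f y"
    using fixed_function_orbit[OF assms] assms(1) by (simp add: fixed_functions_def odd_functions_def)
  then have "f y + f y = 0" by (metis add.right_inverse)
  then show ?thesis by (rule Z3_double_eq_0)
qed

definition paired_orbits :: "nat \<Rightarrow> (int \<Rightarrow> int) \<Rightarrow> int set set" where
  "paired_orbits N \<tau> = {A \<in> orbit_partition N \<tau>. \<not> inversion_invariant A}"

definition fix_dim :: "nat \<Rightarrow> (int \<Rightarrow> int) \<Rightarrow> nat" where
  "fix_dim N \<tau> = card (paired_orbits N \<tau>) div 2"

text \<open>An invariant odd function is constant on orbits and vanishes on invariant orbits, so it is the same as an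
antisymmetric function on the set of the remaining orbits, on which \<open>A \<mapsto> - A\<close> has no fixed point.\<close>

lemma card_fixed_functions_even:
  assumes t: "\<tau> \<in> hyperoctahedral N"
  shows "even (card (paired_orbits N \<tau>)) \<and> card (fixed_functions N \<tau>) = 3 ^ fix_dim N \<tau>"
proof -
  let ?P = "paired_orbits N \<tau>"
  let ?G = "{g :: int set \<Rightarrow> 3. (\<forall>a\<in>?P. g (uminus ` a) = - g a) \<and> (\<forall>a. a \<notin> ?P \<longrightarrow> g a = 0)}"
  have P: "orbit \<tau> y \<in> ?P \<longleftrightarrow> - y \<notin> orbit \<tau> y" if "y \<in> signed_points N" for y
    using that inversion_invariant_orbit_iff[OF t] by (auto simp: paired_orbits_def orbit_partition_def)
  have *: "even (card ?P) \<and> card ?G = 3 ^ (card ?P div 2)"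
  proof (rule card_antisymmetric_functions)
    show "finite ?P" by (simp add: paired_orbits_def orbit_partition_def)
    fix A assume "A \<in> ?P"
    then obtain y where y: "y \<in> signed_points N" "A = orbit \<tau> y" "\<not> inversion_invariant A"
      by (auto simp: paired_orbits_def orbit_partition_def)
    have A': "uminus ` A = orbit \<tau> (- y)" using y orbit_uminus[OF t] by simp
    have inv: "uminus ` uminus ` A = A" by (simp add: image_image)
    show "uminus ` A \<in> ?P \<and> uminus ` uminus ` A = A \<and> uminus ` A \<noteq> A"
      using y A' inv by (auto simp: paired_orbits_def orbit_partition_def inversion_invariant_def)
  qed
  have "\<forall>A\<in>?P. \<exists>y. y \<in> signed_points N \<and> orbit \<tau> y = A"
    by (auto simp: paired_orbits_def orbit_partition_def)
  then obtain r where r: "\<And>A. A \<in> ?P \<Longrightarrow> r A \<in> signed_points N" "\<And>A. A \<in> ?P \<Longrightarrow> orbit \<tau> (r A) = A"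
    by metis
  \<comment> \<open>\<open>?F\<close> composes with the orbit map, \<open>?H\<close> evaluates at the representatives \<open>r\<close>.\<close>
  let ?F = "\<lambda>g y. if y \<in> signed_points N then g (orbit \<tau> y) else (0 :: 3)"
  let ?H = "\<lambda>f A. if A \<in> ?P then f (r A) else (0 :: 3)"
  have step: "orbit \<tau> (\<tau> y) = orbit \<tau> y" for y
    using permutation_orbit_step[OF hyp_permutation[OF t]] .
  have HF: "?H f (orbit \<tau> y) = f y" if "f \<in> fixed_functions N \<tau>" "y \<in> signed_points N" for f y
  proof (cases "orbit \<tau> y \<in> ?P")
    case True
    then have "r (orbit \<tau> y) \<in> orbit \<tau> y" using r(2) orbit_eq_iff[OF t] by blast
    then show ?thesis using True fixed_function_orbit[OF that(1)] by simp
  next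
    case False
    then show ?thesis using fixed_function_invariant_orbit[OF that(1)] P[OF that(2)] by simp
  qed
  have "bij_betw ?F ?G (fixed_functions N \<tau>)"
  proof (rule bij_betw_byWitness[where f' = ?H])
    show "\<forall>g\<in>?G. ?H (?F g) = g"
    proof (intro ballI ext)
      fix g A assume "g \<in> ?G"
      then show "?H (?F g) A = g A" using r[of A] by (cases "A \<in> ?P") simp_all
    qed
    show "\<forall>f\<in>fixed_functions N \<tau>. ?F (?H f) = f"
    proof
      fix f assume f: "f \<in> fixed_functions N \<tau>"
      then have f0: "f y = 0" if "y \<notin> signed_points N" for y
        using that by (simp add: fixed_functions_def odd_functions_def)
      show "?F (?H f) = f"
      proof (intro ext)
        fix y show "?F (?H f) y = f y"
          using f0[of y] HF[OF f, of y] by (cases "y \<in> signed_points N") (simp_all only: if_True if_False not_False_eq_True simp_thms)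
      qed
    qed
    show "?F ` ?G \<subseteq> fixed_functions N \<tau>"
    proof (clarify)
      fix g :: "int set \<Rightarrow> 3"
      assume g: "\<forall>a\<in>?P. g (uminus ` a) = - g a" "\<forall>a. a \<notin> ?P \<longrightarrow> g a = 0"
      have "g (orbit \<tau> (- y)) = - g (orbit \<tau> y)" if "y \<in> signed_points N" for y
      proof (cases "orbit \<tau> y \<in> ?P")
        case True
        then show ?thesis using g orbit_uminus[OF t] by simp
      next
        case False
        then have "orbit \<tau> (- y) = orbit \<tau> y" using P[OF that] orbit_eq_iff[OF t] by simp
        then show ?thesis using False g by simp
      qed
      then show "?F g \<in> fixed_functions N \<tau>"
        by (auto simp: fixed_functions_def odd_functions_def step hyp_mem_iff[OF t])
    qed
    show "?H ` fixed_functions N \<tau> \<subseteq> ?G"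
    proof (clarify)
      fix f :: "int \<Rightarrow> 3"
      assume f: "f \<in> fixed_functions N \<tau>"
      have odd: "f (- y) = - f y" for y using f by (simp add: fixed_functions_def odd_functions_def)
      have "?H f (uminus ` A) = - ?H f A" if "A \<in> ?P" for A
      proof -
        obtain y where y: "y \<in> signed_points N" "A = orbit \<tau> y"
          using \<open>A \<in> ?P\<close> by (auto simp: paired_orbits_def orbit_partition_def)
        then have "uminus ` A = orbit \<tau> (- y)" using orbit_uminus[OF t] by simp
        moreover have "?H f (orbit \<tau> y) = f y" "?H f (orbit \<tau> (- y)) = f (- y)"
          using HF[OF f] y(1) by (simp_all only: uminus_mem_signed_points)
        ultimately show ?thesis by (simp only: y(2) odd)
      qed
      then show "(\<forall>a\<in>?P. ?H f (uminus ` a) = - ?H f a) \<and> (\<forall>a. a \<notin> ?P \<longrightarrow> ?H f a = 0)"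
        by (intro conjI ballI allI impI) (blast, simp only: if_False)
    qed
  qed
  then have "card (fixed_functions N \<tau>) = card ?G" by (rule bij_betw_same_card[symmetric])
  then show ?thesis using * by (simp only: fix_dim_def)
qed

lemma card_fixed_functions: "\<tau> \<in> hyperoctahedral N \<Longrightarrow> card (fixed_functions N \<tau>) = 3 ^ fix_dim N \<tau>"
  using card_fixed_functions_even by blast

lemma card_paired_orbits: "\<tau> \<in> hyperoctahedral N \<Longrightarrow> card (paired_orbits N \<tau>) = 2 * fix_dim N \<tau>"
  using conjunct1[OF card_fixed_functions_even] unfolding fix_dim_def by simp

lemma power3_le_iff: "(3::nat) ^ a \<le> 3 ^ b \<longleftrightarrow> a \<le> b"
  by (simp add: power_increasing_iff)

lemma fix_dim_le: "\<tau> \<in> hyperoctahedral N \<Longrightarrow> fix_dim N \<tau> \<le> N"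
  using card_mono[OF finite_odd_functions fixed_functions_subset, of N \<tau>]
  by (simp add: card_odd_functions card_fixed_functions power3_le_iff)

lemma fix_dim_id: "fix_dim N id = N"
  using card_fixed_functions[OF hyp_id, of N] by (simp add: fixed_functions_id card_odd_functions)

text \<open>Meaningful for \<open>A\<close> disjoint from \<open>- A\<close>. For a paired orbit it is an invariant function, which is how
the orbit structure is recovered from the space of invariant functions.\<close>

definition odd_indicator :: "int set \<Rightarrow> int \<Rightarrow> 3" where
  "odd_indicator A y = (if y \<in> A then 1 else if - y \<in> A then - 1 else 0)"

lemma odd_indicator_orbit:
  assumes t: "\<tau> \<in> hyperoctahedral N" and y: "y \<in> signed_points N" and n: "- y \<notin> orbit \<tau> y"
  shows "odd_indicator (orbit \<tau> y) \<in> fixed_functions N \<tau>"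
proof -
  have dis: "\<not> (z \<in> orbit \<tau> y \<and> - z \<in> orbit \<tau> y)" for z
  proof
    assume z: "z \<in> orbit \<tau> y \<and> - z \<in> orbit \<tau> y"
    then have "orbit \<tau> z = orbit \<tau> y" using orbit_eq_iff[OF t] by simp
    then show False
      using z n inversion_invariant_orbit_iff[OF t, of z] inversion_invariant_orbit_iff[OF t, of y] by simp
  qed
  have st: "\<tau> z \<in> orbit \<tau> y \<longleftrightarrow> z \<in> orbit \<tau> y" for z
    unfolding orbit_eq_iff[OF t, symmetric] permutation_orbit_step[OF hyp_permutation[OF t]] ..
  have st': "- \<tau> z \<in> orbit \<tau> y \<longleftrightarrow> - z \<in> orbit \<tau> y" for z
    using st[of "- z"] hyp_odd[OF t] by simp
  have sub: "z \<in> signed_points N" if "z \<in> orbit \<tau> y \<or> - z \<in> orbit \<tau> y" for z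
    using orbit_subset_signed_points[OF t y] that uminus_mem_signed_points by blast
  show ?thesis
    unfolding fixed_functions_def odd_functions_def odd_indicator_def mem_Collect_eq
  proof (intro conjI allI impI)
    fix z
    show "(if - z \<in> orbit \<tau> y then 1 else if - (- z) \<in> orbit \<tau> y then - 1 else 0) =
         - (if z \<in> orbit \<tau> y then 1 else if - z \<in> orbit \<tau> y then - 1 else (0::3))"
      using dis[of z] by simp
    show "(if z \<in> orbit \<tau> y then 1 else if - z \<in> orbit \<tau> y then - 1 else 0) = (0::3)"
      if "z \<notin> signed_points N" using sub that by (simp, blast)
    show "(if \<tau> z \<in> orbit \<tau> y then 1 else if - \<tau> z \<in> orbit \<tau> y then - 1 else 0) =
         (if z \<in> orbit \<tau> y then 1 else if - z \<in> orbit \<tau> y then - 1 else (0::3))"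
      by (simp only: st st')
  qed
qed

section \<open>Reflections change the fixed dimension by at most one\<close>

lemma hyp_nonzero: "x \<in> signed_points N \<Longrightarrow> x \<noteq> 0"
  by (simp add: mem_signed_points)

lemma fixed_refl_iff:
  assumes "x \<in> signed_points N" "j \<in> signed_points N" "f \<in> odd_functions N"
  shows "f \<in> fixed_functions N (refl_swap x j) \<longleftrightarrow> f x = f j"
proof
  assume "f \<in> fixed_functions N (refl_swap x j)"
  then have "f (refl_swap x j x) = f x" by (simp only: fixed_functions_def mem_Collect_eq)
  then show "f x = f j" by simp
next
  assume eq: "f x = f j"
  have odd: "f (- y) = - f y" for y using assms(3) by (simp add: odd_functions_def)
  have "f (refl_swap x j y) = f y" for y
    unfolding refl_swap_def using eq odd by auto
  then show "f \<in> fixed_functions N (refl_swap x j)" using assms(3) by (simp add: fixed_functions_def)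
qed

text \<open>Being fixed by a reflection is one linear condition, \<open>f x = f j\<close>: each of the three fibres of
\<open>f \<mapsto> f x - f j\<close> is a translate of a part of the kernel.\<close>

lemma card_le_times_card_fixed_refl:
  assumes x: "x \<in> signed_points N" and j: "j \<in> signed_points N" and A: "A \<subseteq> odd_functions N"
    and diff: "\<And>f g. f \<in> A \<Longrightarrow> g \<in> A \<Longrightarrow> f - g \<in> A"
  shows "card A \<le> 3 * card (A \<inter> fixed_functions N (refl_swap x j))"
proof -
  let ?K = "A \<inter> fixed_functions N (refl_swap x j)"
  let ?L = "\<lambda>c. {f \<in> A. f x - f j = c}"
  have finA: "finite A" using finite_subset[OF A] by simp
  have "card (?L c) \<le> card ?K" for c
  proof (cases "?L c = {}")
    case False
    then obtain f0 where f0: "f0 \<in> ?L c" by blast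
    have "f - f0 \<in> ?K" if "f \<in> ?L c" for f
    proof -
      have "f - f0 \<in> A" using that f0 diff by blast
      moreover have "(f - f0) x = (f - f0) j" using that f0 by (simp add: algebra_simps)
      ultimately show ?thesis using fixed_refl_iff[OF x j] A by blast
    qed
    then show ?thesis
      by (intro card_inj_on_le[of "\<lambda>f. f - f0"]) (auto simp: inj_on_def finA fun_eq_iff)
  qed (simp only: card.empty)
  then have "(\<Sum>c\<in>UNIV. card (?L c)) \<le> (\<Sum>c\<in>(UNIV :: 3 set). card ?K)" by (rule sum_mono)
  moreover have "card (\<Union>c\<in>UNIV. ?L c) \<le> (\<Sum>c\<in>UNIV. card (?L c))" by (rule card_UN_le) simp
  moreover have "(\<Union>c\<in>UNIV. ?L c) = A" by blast
  ultimately have "card A \<le> (\<Sum>c\<in>(UNIV :: 3 set). card ?K)" by simp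
  then show ?thesis by simp
qed

lemma fix_dim_mono:
  assumes "\<sigma> \<in> hyperoctahedral N" "\<tau> \<in> hyperoctahedral N"
    and "fixed_functions N \<sigma> \<subseteq> fixed_functions N \<tau>"
  shows "fix_dim N \<sigma> \<le> fix_dim N \<tau>"
  using card_mono[OF finite_fixed_functions assms(3)] assms(1,2)
  by (simp add: card_fixed_functions power3_le_iff)

lemma fix_dim_strict_mono:
  assumes "\<sigma> \<in> hyperoctahedral N" "\<tau> \<in> hyperoctahedral N"
    and "fixed_functions N \<sigma> \<subset> fixed_functions N \<tau>"
  shows "fix_dim N \<sigma> < fix_dim N \<tau>"
  using psubset_card_mono[OF finite_fixed_functions assms(3)] assms(1,2)
  by (simp add: card_fixed_functions)

lemma fixed_functions_refl_comp:
  assumes x: "x \<in> signed_points N" and j: "j \<in> signed_points N"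
  shows "fixed_functions N (refl_swap x j \<circ> \<sigma>) \<inter> fixed_functions N (refl_swap x j)
       = fixed_functions N \<sigma> \<inter> fixed_functions N (refl_swap x j)"
  by (auto simp: fixed_functions_def)

lemma card_fixed_inter_refl:
  assumes "x \<in> signed_points N" "j \<in> signed_points N"
  shows "card (fixed_functions N \<sigma>) \<le> 3 * card (fixed_functions N \<sigma> \<inter> fixed_functions N (refl_swap x j))"
  using assms by (intro card_le_times_card_fixed_refl fixed_functions_subset fixed_functions_diff) auto

lemma fix_dim_refl_comp_ge:
  assumes s: "\<sigma> \<in> hyperoctahedral N" and x: "x \<in> signed_points N" and j: "j \<in> signed_points N"
  shows "fix_dim N \<sigma> \<le> fix_dim N (refl_swap x j \<circ> \<sigma>) + 1"
proof -
  have rs: "refl_swap x j \<circ> \<sigma> \<in> hyperoctahedral N" using hyp_comp refl_swap_hyp s x j by blast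
  have "card (fixed_functions N \<sigma>) \<le> 3 * card (fixed_functions N \<sigma> \<inter> fixed_functions N (refl_swap x j))"
    by (rule card_fixed_inter_refl[OF x j])
  also have "card (fixed_functions N \<sigma> \<inter> fixed_functions N (refl_swap x j)) \<le> card (fixed_functions N (refl_swap x j \<circ> \<sigma>))"
    using fixed_functions_refl_comp[OF x j, of \<sigma>] by (intro card_mono) auto
  finally have "(3::nat) ^ fix_dim N \<sigma> \<le> 3 ^ (fix_dim N (refl_swap x j \<circ> \<sigma>) + 1)"
    by (simp add: card_fixed_functions s rs)
  then show ?thesis by (simp only: power3_le_iff)
qed

lemma refl_refl_comp:
  assumes "x \<in> signed_points N" "j \<in> signed_points N"
  shows "refl_swap x j \<circ> (refl_swap x j \<circ> \<sigma>) = \<sigma>"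
  using assms by (auto simp: fun_eq_iff refl_swap_invol hyp_nonzero)

lemma fix_dim_refl_comp_le:
  assumes s: "\<sigma> \<in> hyperoctahedral N" and x: "x \<in> signed_points N" and j: "j \<in> signed_points N"
  shows "fix_dim N (refl_swap x j \<circ> \<sigma>) \<le> fix_dim N \<sigma> + 1"
  using fix_dim_refl_comp_ge[OF hyp_comp[OF refl_swap_hyp[OF x j] s] x j]
  by (simp only: refl_refl_comp[OF x j])

text \<open>A reflection is below \<open>\<sigma>\<close> only if it fixes every \<open>\<sigma>\<close>-invariant function. Both spaces have the same
intersection with the hyperplane of the reflection, and the larger one loses at most a factor 3 there.\<close>

lemma fixed_subset_if_fix_dim_increases:
  assumes s: "\<sigma> \<in> hyperoctahedral N" and x: "x \<in> signed_points N" and j: "j \<in> signed_points N"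
    and inc: "fix_dim N (refl_swap x j \<circ> \<sigma>) = fix_dim N \<sigma> + 1"
  shows "fixed_functions N \<sigma> \<subseteq> fixed_functions N (refl_swap x j)"
proof -
  have rs: "refl_swap x j \<circ> \<sigma> \<in> hyperoctahedral N" using hyp_comp refl_swap_hyp s x j by blast
  let ?I = "fixed_functions N \<sigma> \<inter> fixed_functions N (refl_swap x j)"
  have "3 * card (fixed_functions N \<sigma>) = card (fixed_functions N (refl_swap x j \<circ> \<sigma>))"
    by (simp add: card_fixed_functions s rs inc)
  also have "\<dots> \<le> 3 * card (fixed_functions N (refl_swap x j \<circ> \<sigma>) \<inter> fixed_functions N (refl_swap x j))"
    by (rule card_fixed_inter_refl[OF x j])
  finally have "card (fixed_functions N \<sigma>) \<le> card ?I" by (simp add: fixed_functions_refl_comp[OF x j])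
  then have "?I = fixed_functions N \<sigma>" by (intro card_seteq) auto
  then show ?thesis by blast
qed

text \<open>A partial converse, in which \<open>g\<close> witnesses that the new space is strictly larger.\<close>

lemma fix_dim_increasesI:
  assumes s: "\<sigma> \<in> hyperoctahedral N" and x: "x \<in> signed_points N" and j: "j \<in> signed_points N"
    and sub: "fixed_functions N \<sigma> \<subseteq> fixed_functions N (refl_swap x j)"
    and g: "g \<in> fixed_functions N (refl_swap x j \<circ> \<sigma>)" "g x \<noteq> g j"
  shows "fix_dim N (refl_swap x j \<circ> \<sigma>) = fix_dim N \<sigma> + 1"
proof -
  have rs: "refl_swap x j \<circ> \<sigma> \<in> hyperoctahedral N" using hyp_comp refl_swap_hyp s x j by blast
  have "fixed_functions N \<sigma> \<subseteq> fixed_functions N (refl_swap x j \<circ> \<sigma>)"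
    using sub fixed_functions_refl_comp[OF x j, of \<sigma>] by blast
  moreover have "g \<notin> fixed_functions N \<sigma>"
    using g sub fixed_refl_iff[OF x j] fixed_functions_subset by blast
  ultimately have "fixed_functions N \<sigma> \<subset> fixed_functions N (refl_swap x j \<circ> \<sigma>)" using g by blast
  then show ?thesis using fix_dim_strict_mono[OF s rs] fix_dim_refl_comp_le[OF s x j] by simp
qed

lemma odd_indicator_fixed_point:
  assumes "\<tau> \<in> hyperoctahedral N" "x \<in> signed_points N" "\<tau> x = x"
  shows "odd_indicator {x} \<in> fixed_functions N \<tau>"
proof -
  have "orbit \<tau> x = {x}" using assms(3) by (simp add: orbit_eq_singleton_iff)
  then show ?thesis using odd_indicator_orbit[OF assms(1,2)] hyp_nonzero[OF assms(2)] by simp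
qed

lemma odd_indicator_mem: "x \<in> signed_points N \<Longrightarrow> odd_indicator {x} \<in> odd_functions N"
  using odd_indicator_fixed_point[OF hyp_id] fixed_functions_id by fastforce

lemma odd_indicator_singleton:
  "odd_indicator {x} y = (if y = x then 1 else if y = - x then - 1 else 0)"
  by (auto simp: odd_indicator_def)

text \<open>For a permutation that fixes \<open>x\<close>, a reflection moving \<open>x\<close> always merges orbits: invariance at \<open>j\<close> gives
\<open>f x = f j\<close>.\<close>

lemma fixed_functions_comp_refl:
  assumes t: "\<tau> \<in> hyperoctahedral N" and x: "x \<in> signed_points N" and j: "j \<in> signed_points N"
    and fx: "\<tau> x = x"
  shows "fixed_functions N (\<tau> \<circ> refl_swap x j) = fixed_functions N \<tau> \<inter> fixed_functions N (refl_swap x j)"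
proof
  have nz: "x \<noteq> 0" "j \<noteq> 0" using x j by (auto simp: mem_signed_points)
  show "fixed_functions N (\<tau> \<circ> refl_swap x j) \<subseteq> fixed_functions N \<tau> \<inter> fixed_functions N (refl_swap x j)"
  proof
    fix f assume f: "f \<in> fixed_functions N (\<tau> \<circ> refl_swap x j)"
    then have V: "f \<in> odd_functions N" and inv: "f (\<tau> (refl_swap x j y)) = f y" for y
      by (auto simp: fixed_functions_def)
    have "f x = f j" using inv[of j] fx nz by (simp add: refl_swap_right)
    then have r: "f \<in> fixed_functions N (refl_swap x j)" using fixed_refl_iff[OF x j V] by simp
    have "f (\<tau> y) = f y" for y
      using inv[of "refl_swap x j y"] r nz by (simp add: refl_swap_invol fixed_functions_def)
    then show "f \<in> fixed_functions N \<tau> \<inter> fixed_functions N (refl_swap x j)"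
      using r V by (simp add: fixed_functions_def)
  qed
qed (rule fixed_functions_comp)

lemma fix_dim_comp_refl:
  assumes t: "\<tau> \<in> hyperoctahedral N" and x: "x \<in> signed_points N" and j: "j \<in> signed_points N"
    and fx: "\<tau> x = x" and ne: "x \<noteq> j"
  shows "fix_dim N \<tau> = fix_dim N (\<tau> \<circ> refl_swap x j) + 1"
proof -
  have tr: "\<tau> \<circ> refl_swap x j \<in> hyperoctahedral N" using hyp_comp refl_swap_hyp t x j by blast
  note eq = fixed_functions_comp_refl[OF t x j fx]
  have "(odd_indicator {x} :: int \<Rightarrow> 3) x \<noteq> odd_indicator {x} j"
    using ne by (simp add: odd_indicator_singleton)
  then have "odd_indicator {x} \<notin> fixed_functions N (refl_swap x j)"
    using fixed_refl_iff[OF x j] odd_indicator_mem[OF x] by blast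
  then have "fixed_functions N (\<tau> \<circ> refl_swap x j) \<subset> fixed_functions N \<tau>"
    using odd_indicator_fixed_point[OF t x fx] eq by blast
  then have "fix_dim N (\<tau> \<circ> refl_swap x j) < fix_dim N \<tau>" by (rule fix_dim_strict_mono[OF tr t])
  moreover have "card (fixed_functions N \<tau>) \<le> 3 * card (fixed_functions N (\<tau> \<circ> refl_swap x j))"
    unfolding eq by (rule card_fixed_inter_refl[OF x j])
  then have "(3::nat) ^ fix_dim N \<tau> \<le> 3 ^ (fix_dim N (\<tau> \<circ> refl_swap x j) + 1)"
    by (simp add: card_fixed_functions t tr)
  then have "fix_dim N \<tau> \<le> fix_dim N (\<tau> \<circ> refl_swap x j) + 1" by (simp only: power3_le_iff)
  ultimately show ?thesis by simp
qed

section \<open>Reflection length\<close>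

lemma hyp_eq_id_if_fix_dim:
  assumes t: "\<tau> \<in> hyperoctahedral N" and "fix_dim N \<tau> = N"
  shows "\<tau> = id"
proof
  fix y
  have V: "fixed_functions N \<tau> = odd_functions N"
    using assms by (intro card_subset_eq fixed_functions_subset) (simp_all add: card_fixed_functions card_odd_functions)
  show "\<tau> y = id y"
  proof (cases "y \<in> signed_points N")
    case True
    then have "odd_indicator {y} \<in> fixed_functions N \<tau>" using odd_indicator_mem V by simp
    then have "(odd_indicator {y} :: int \<Rightarrow> 3) (\<tau> y) = odd_indicator {y} y" by (simp add: fixed_functions_def)
    then show ?thesis by (simp add: odd_indicator_singleton split: if_splits)
  next
    case False
    then show ?thesis using hyp_outside[OF t] by simp
  qed
qed

text \<open>The reflection that undoes the move \<open>x \<mapsto> \<tau> x\<close> creates the new fixed point \<open>x\<close>.\<close>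

lemma fix_dim_refl_first_moved:
  assumes t: "\<tau> \<in> hyperoctahedral N" and x: "x \<in> signed_points N" and ne: "\<tau> x \<noteq> x"
  shows "fix_dim N (refl_swap (\<tau> x) x \<circ> \<tau>) = fix_dim N \<tau> + 1"
proof -
  have tx: "\<tau> x \<in> signed_points N" using hyp_mem_iff[OF t] x by simp
  have rt: "refl_swap (\<tau> x) x \<circ> \<tau> \<in> hyperoctahedral N" using hyp_comp refl_swap_hyp t x tx by blast
  show ?thesis
  proof (rule fix_dim_increasesI[OF t tx x, where g = "odd_indicator {x}"])
    show "fixed_functions N \<tau> \<subseteq> fixed_functions N (refl_swap (\<tau> x) x)"
    proof
      fix f assume f: "f \<in> fixed_functions N \<tau>"
      then have "f (\<tau> x) = f x" by (simp add: fixed_functions_def)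
      then show "f \<in> fixed_functions N (refl_swap (\<tau> x) x)"
        using fixed_refl_iff[OF tx x] f fixed_functions_subset by blast
    qed
    show "odd_indicator {x} \<in> fixed_functions N (refl_swap (\<tau> x) x \<circ> \<tau>)"
      by (rule odd_indicator_fixed_point[OF rt x]) simp
    show "(odd_indicator {x} :: int \<Rightarrow> 3) (\<tau> x) \<noteq> odd_indicator {x} x"
      using ne by (simp add: odd_indicator_singleton)
  qed
qed

lemma generators_product_exists:
  assumes "\<tau> \<in> hyperoctahedral N"
  shows "\<exists>gs. length gs = N - fix_dim N \<tau> \<and> set gs \<subseteq> B_generators N \<and> \<tau> = foldr (\<circ>) gs id"
  using assms
proof (induction "N - fix_dim N \<tau>" arbitrary: \<tau>)
  case 0
  then have "\<tau> = id" using hyp_eq_id_if_fix_dim fix_dim_le[OF 0(2)] by simp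
  with 0 show ?case by simp
next
  case (Suc k)
  note t = Suc.prems
  have "\<tau> \<noteq> id" using Suc.hyps(2) by (auto simp: fix_dim_id)
  then obtain x where ne: "\<tau> x \<noteq> x" by (auto simp: fun_eq_iff)
  then have x: "x \<in> signed_points N" using hyp_outside[OF t] by blast
  have tx: "\<tau> x \<in> signed_points N" using hyp_mem_iff[OF t] x by simp
  let ?r = "refl_swap (\<tau> x) x"
  have rt: "?r \<circ> \<tau> \<in> hyperoctahedral N" using hyp_comp refl_swap_hyp t x tx by blast
  have "k = N - fix_dim N (?r \<circ> \<tau>)"
    using Suc.hyps(2) fix_dim_refl_first_moved[OF t x ne] by simp
  then obtain gs where gs: "length gs = k" "set gs \<subseteq> B_generators N" "?r \<circ> \<tau> = foldr (\<circ>) gs id"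
    using Suc.hyps(1)[OF _ rt] by metis
  have "?r \<in> B_generators N" using x tx ne unfolding B_generators_eq by blast
  moreover have "\<tau> = foldr (\<circ>) (?r # gs) id"
    using refl_refl_comp[OF tx x, of \<tau>] gs(3) by simp
  ultimately show ?case using gs Suc.hyps(2) by (intro exI[of _ "?r # gs"]) simp
qed

lemma fix_dim_product_ge:
  assumes "set gs \<subseteq> B_generators N"
  shows "foldr (\<circ>) gs id \<in> hyperoctahedral N \<and> N \<le> fix_dim N (foldr (\<circ>) gs id) + length gs"
  using assms
proof (induction gs)
  case Nil
  show ?case using hyp_id[of N] fix_dim_id[of N] by (simp add: id_def)
next
  case (Cons g gs)
  let ?t = "foldr (\<circ>) gs id"
  obtain x j where g: "g = refl_swap x j" "x \<in> signed_points N" "j \<in> signed_points N"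
    using Cons.prems by (auto simp: B_generators_eq)
  have IH: "?t \<in> hyperoctahedral N" "N \<le> fix_dim N ?t + length gs"
    using Cons.IH Cons.prems by (metis list.set_intros(2) subset_iff)+
  have eq: "foldr (\<circ>) (g # gs) id = refl_swap x j \<circ> ?t" using g(1) by simp
  have "refl_swap x j \<circ> ?t \<in> hyperoctahedral N"
    by (rule hyp_comp[OF refl_swap_hyp[OF g(2,3)] IH(1)])
  moreover have "N \<le> fix_dim N (refl_swap x j \<circ> ?t) + length (g # gs)"
    using IH(2) fix_dim_refl_comp_ge[OF IH(1) g(2,3)] unfolding list.size by linarith
  ultimately show ?case unfolding eq by blast
qed

text \<open>The analogue of Carter's lemma for odd permutations.\<close>

theorem B_length_eq:
  assumes "\<tau> \<in> hyperoctahedral N"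
  shows "B_length N \<tau> + fix_dim N \<tau> = N"
proof -
  have "B_length N \<tau> = N - fix_dim N \<tau>"
    unfolding B_length_def
  proof (rule Least_equality)
    fix k assume "\<exists>gs. length gs = k \<and> set gs \<subseteq> B_generators N \<and> \<tau> = foldr (\<circ>) gs id"
    then show "N - fix_dim N \<tau> \<le> k" using fix_dim_product_ge by fastforce
  qed (rule generators_product_exists[OF assms])
  then show ?thesis using fix_dim_le[OF assms] by simp
qed

section \<open>Subadditivity\<close>

text \<open>The dimension formula for a sum of two subspaces, as an inequality of cardinalities; the sum is written
with differences.\<close>

lemma card_sum_subgroups:
  fixes A B :: "('a \<Rightarrow> 3) set"
  assumes fin: "finite A" "finite B"
    and A: "\<And>f g. f \<in> A \<Longrightarrow> g \<in> A \<Longrightarrow> f - g \<in> A" and B: "\<And>f g. f \<in> B \<Longrightarrow> g \<in> B \<Longrightarrow> f - g \<in> B"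
  shows "card A * card B \<le> card ((\<lambda>(a, b). a - b) ` (A \<times> B)) * card (A \<inter> B)"
proof -
  let ?p = "\<lambda>(a :: 'a \<Rightarrow> 3, b). a - b"
  let ?S = "?p ` (A \<times> B)"
  let ?L = "\<lambda>s. {u \<in> A \<times> B. ?p u = s}"
  have "card (?L s) \<le> card (A \<inter> B)" for s
  proof (cases "?L s = {}")
    case False
    then obtain a0 b0 where 0: "a0 \<in> A" "b0 \<in> B" "a0 - b0 = s" by auto
    have *: "a - a0 = b - b0" if "a - b = s" for a b
      using that 0(3) by (auto simp: fun_eq_iff algebra_simps)
    show ?thesis
    proof (rule card_inj_on_le[of "\<lambda>u. fst u - a0"])
      show "inj_on (\<lambda>u. fst u - a0) (?L s)" by (force simp: inj_on_def fun_eq_iff algebra_simps)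
      show "(\<lambda>u. fst u - a0) ` ?L s \<subseteq> A \<inter> B" using A B 0 * by fastforce
    qed (use fin in auto)
  qed (simp only: card.empty)
  then have "(\<Sum>s\<in>?S. card (?L s)) \<le> (\<Sum>s\<in>?S. card (A \<inter> B))" by (rule sum_mono)
  moreover have "card (\<Union>s\<in>?S. ?L s) \<le> (\<Sum>s\<in>?S. card (?L s))" using fin by (intro card_UN_le) simp
  moreover have "(\<Union>s\<in>?S. ?L s) = A \<times> B" by blast
  ultimately have "card (A \<times> B) \<le> (\<Sum>s\<in>?S. card (A \<inter> B))" by simp
  then show ?thesis by (simp add: card_cartesian_product)
qed

lemma fixed_sum_card:
  assumes s: "\<sigma> \<in> hyperoctahedral N" and t: "\<tau> \<in> hyperoctahedral N"
  defines "S \<equiv> (\<lambda>(a, b). a - b) ` (fixed_functions N \<sigma> \<times> fixed_functions N \<tau>)"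
  shows "S \<subseteq> odd_functions N"
    and "3 ^ (fix_dim N \<sigma> + fix_dim N \<tau>) \<le> card S * 3 ^ fix_dim N (\<sigma> \<circ> \<tau>)"
proof -
  show "S \<subseteq> odd_functions N"
    unfolding S_def by (auto simp: fixed_functions_def odd_functions_def)
  have "3 ^ (fix_dim N \<sigma> + fix_dim N \<tau>) = card (fixed_functions N \<sigma>) * card (fixed_functions N \<tau>)"
    by (simp add: card_fixed_functions s t power_add)
  also have "\<dots> \<le> card S * card (fixed_functions N \<sigma> \<inter> fixed_functions N \<tau>)"
    unfolding S_def by (intro card_sum_subgroups fixed_functions_diff) auto
  also have "\<dots> \<le> card S * card (fixed_functions N (\<sigma> \<circ> \<tau>))"
    by (intro mult_left_mono card_mono fixed_functions_comp) auto
  finally show "3 ^ (fix_dim N \<sigma> + fix_dim N \<tau>) \<le> card S * 3 ^ fix_dim N (\<sigma> \<circ> \<tau>)"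
    by (simp add: card_fixed_functions hyp_comp s t)
qed

lemma fix_dim_comp:
  assumes s: "\<sigma> \<in> hyperoctahedral N" and t: "\<tau> \<in> hyperoctahedral N"
  shows "fix_dim N \<sigma> + fix_dim N \<tau> \<le> N + fix_dim N (\<sigma> \<circ> \<tau>)"
proof -
  let ?S = "(\<lambda>(a, b). a - b) ` (fixed_functions N \<sigma> \<times> fixed_functions N \<tau>)"
  have "card ?S \<le> 3 ^ N"
    using card_mono[OF finite_odd_functions fixed_sum_card(1)[OF s t]] by (simp add: card_odd_functions)
  then have "card ?S * 3 ^ fix_dim N (\<sigma> \<circ> \<tau>) \<le> 3 ^ N * 3 ^ fix_dim N (\<sigma> \<circ> \<tau>)" by simp
  then have "(3::nat) ^ (fix_dim N \<sigma> + fix_dim N \<tau>) \<le> 3 ^ (N + fix_dim N (\<sigma> \<circ> \<tau>))"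
    using order_trans[OF fixed_sum_card(2)[OF s t]] by (simp only: power_add)
  then show ?thesis by (simp only: power3_le_iff)
qed

text \<open>Equality in \<open>fix_dim_comp\<close>, that is, a geodesic factorization, forces the two spaces to span
everything.\<close>

lemma odd_functions_eq_fixed_sum:
  assumes s: "\<sigma> \<in> hyperoctahedral N" and t: "\<tau> \<in> hyperoctahedral N"
    and eq: "fix_dim N \<sigma> + fix_dim N \<tau> = N + fix_dim N (\<sigma> \<circ> \<tau>)" and f: "f \<in> odd_functions N"
  shows "\<exists>a\<in>fixed_functions N \<sigma>. \<exists>b\<in>fixed_functions N \<tau>. f = a - b"
proof -
  let ?S = "(\<lambda>(a, b). a - b) ` (fixed_functions N \<sigma> \<times> fixed_functions N \<tau>)"
  have "3 ^ N * 3 ^ fix_dim N (\<sigma> \<circ> \<tau>) \<le> card ?S * 3 ^ fix_dim N (\<sigma> \<circ> \<tau>)"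
    using fixed_sum_card(2)[OF s t] eq by (simp add: power_add)
  then have "card (odd_functions N) \<le> card ?S" by (simp add: card_odd_functions)
  then have "?S = odd_functions N" by (intro card_seteq fixed_sum_card(1)[OF s t]) auto
  then show ?thesis using f by force
qed

section \<open>Closed forms for the number of descendants\<close>

text \<open>Integer lower index, so that Pascal's rule holds without side conditions.\<close>

definition ibinom :: "nat \<Rightarrow> int \<Rightarrow> int" where
  "ibinom n k = (if k < 0 then 0 else int (n choose nat k))"

lemma ibinom_0: "ibinom 0 k = (if k = 0 then 1 else 0)"
  by (auto simp: ibinom_def binomial_eq_0)

lemma ibinom_Suc: "ibinom (Suc n) k = ibinom n k + ibinom n (k - 1)"
proof (cases "k \<ge> 1")
  case True
  then have "nat k = Suc (nat (k - 1))" by simp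
  with True show ?thesis by (simp add: ibinom_def)
next
  case False
  then show ?thesis by (cases "k = 0") (auto simp: ibinom_def)
qed

lemma ibinom_absorb: "k * ibinom n k = (int n - k + 1) * ibinom n (k - 1)"
proof (induction n arbitrary: k)
  case 0
  then show ?case by (auto simp: ibinom_0)
next
  case (Suc n)
  have "k * ibinom (Suc n) k = k * ibinom n k + (k - 1) * ibinom n (k - 1) + ibinom n (k - 1)"
    by (simp add: ibinom_Suc algebra_simps)
  also have "\<dots> = (int (Suc n) - k + 1) * ibinom (Suc n) (k - 1)"
    using Suc.IH[of k] Suc.IH[of "k - 1"] by (simp add: ibinom_Suc algebra_simps)
  finally show ?case .
qed

text \<open>The number of descendants \<open>d\<close> levels further down whose rank is larger by \<open>k\<close>, for a node whose newest
point lies in a paired orbit of \<open>s\<close> points. By Pascal's rule in both factors, every product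
\<open>ibinom d (k + a) * ibinom (d + s + e) (k - c)\<close> satisfies the recurrence obtained by subtracting two
consecutive values of \<open>s\<close>; the difference of two such products below also has the right value at \<open>s = 0\<close>.\<close>

definition paired_count :: "nat \<Rightarrow> nat \<Rightarrow> int \<Rightarrow> int" where
  "paired_count s d k = ibinom d k * ibinom (d + s - 1) k - ibinom d (k + 1) * ibinom (d + s - 1) (k - 1)"

text \<open>The same number for a node whose newest point lies in an invariant orbit of \<open>2 s\<close> points and where no other
invariant orbit exists. The inhomogeneous term of its recurrence is a shift of \<open>paired_count (Suc s)\<close>,
which solves the homogeneous recurrence; multiplying such a solution by \<open>k\<close> produces it.\<close>

definition zero_count :: "nat \<Rightarrow> nat \<Rightarrow> int \<Rightarrow> int" where
  "zero_count s d k = (k + 1) * paired_count (Suc s) d k - ibinom d k * ibinom (d + s) (k - 1)"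

text \<open>Half of the additional descendants of such a node when the inner circle is a second invariant orbit:
those that descend from one of the two children in which the invariant orbits have merged, here or further down.\<close>

definition merge_count :: "nat \<Rightarrow> nat \<Rightarrow> int \<Rightarrow> int" where
  "merge_count s d k = k * (ibinom d k * ibinom (d + s) (k - 1) - ibinom d (k + 1) * ibinom (d + s) (k - 2))
     - 2 * ibinom d k * ibinom (d + s) (k - 2) - ibinom d (k + 1) * ibinom (d + s) (k - 2)"

lemma paired_count_0: "paired_count s 0 k = (if k = 0 then 1 else 0)"
  by (auto simp: paired_count_def ibinom_def binomial_eq_0)

lemma zero_count_0: "zero_count s 0 k = (if k = 0 then 1 else 0)"
  by (auto simp: zero_count_def paired_count_0) (auto simp: ibinom_def binomial_eq_0)

lemma merge_count_0: "merge_count s 0 k = 0"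
  by (auto simp: merge_count_def ibinom_def binomial_eq_0)

lemma paired_count_Suc:
  "paired_count s (Suc d) k = paired_count (Suc s) d k + (\<Sum>i=1..s. paired_count i d (k - 1))"
proof (induction s)
  case 0
  show ?case by (simp add: paired_count_def ibinom_Suc algebra_simps)
next
  case (Suc s)
  have "paired_count (Suc s) (Suc d) k - paired_count s (Suc d) k
      = paired_count (Suc (Suc s)) d k - paired_count (Suc s) d k + paired_count (Suc s) d (k - 1)"
    by (simp add: paired_count_def ibinom_Suc algebra_simps)
  then show ?case using Suc.IH by simp
qed

lemma zero_count_Suc:
  "zero_count s (Suc d) k = zero_count (Suc s) d k
     + (\<Sum>i=1..s. zero_count i d (k - 1) + paired_count i d (k - 1)) + paired_count (Suc s) d (k - 1)"
proof (induction s)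
  case 0
  have a: "k * ibinom d k = (int d - k + 1) * ibinom d (k - 1)" by (rule ibinom_absorb)
  have b: "(k - 1) * ibinom d (k - 1) = (int d - k + 2) * ibinom d (k - 2)"
    using ibinom_absorb[of "k - 1" d] by simp
  have ab: "k * ibinom d k * ibinom d (k - 2) = (int d - k + 1) * ibinom d (k - 1) * ibinom d (k - 2)"
    by (simp only: a)
  have bb: "(k - 1) * ibinom d (k - 1) * ibinom d (k - 1) = (int d - k + 2) * ibinom d (k - 2) * ibinom d (k - 1)"
    by (simp only: b)
  show ?case using ab bb by (simp add: zero_count_def paired_count_def ibinom_Suc algebra_simps)
next
  case (Suc s)
  have "zero_count (Suc s) (Suc d) k - zero_count s (Suc d) k
      = zero_count (Suc (Suc s)) d k - zero_count (Suc s) d k + zero_count (Suc s) d (k - 1)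
        + paired_count (Suc (Suc s)) d (k - 1)"
    by (simp add: zero_count_def paired_count_def ibinom_Suc algebra_simps)
  then show ?case using Suc.IH by simp
qed

lemma merge_count_Suc:
  "merge_count s (Suc d) k = merge_count (Suc s) d k
     + (\<Sum>i=1..s. merge_count i d (k - 1)) + paired_count (Suc (Suc s)) d (k - 1)"
proof (induction s)
  case 0
  have a: "k * ibinom d k = (int d - k + 1) * ibinom d (k - 1)" by (rule ibinom_absorb)
  have b: "(k - 1) * ibinom d (k - 1) = (int d - k + 2) * ibinom d (k - 2)"
    using ibinom_absorb[of "k - 1" d] by simp
  have ab: "k * ibinom d k * ibinom d (k - 2) = (int d - k + 1) * ibinom d (k - 1) * ibinom d (k - 2)"
    by (simp only: a)
  have bb: "(k - 1) * ibinom d (k - 1) * ibinom d (k - 1) = (int d - k + 2) * ibinom d (k - 2) * ibinom d (k - 1)"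
    by (simp only: b)
  have c: "(k - 2) * ibinom d (k - 2) = (int d - k + 3) * ibinom d (k - 3)"
    using ibinom_absorb[of "k - 2" d] by simp
  have ac: "k * ibinom d k * ibinom d (k - 3) = (int d - k + 1) * ibinom d (k - 1) * ibinom d (k - 3)"
    by (simp only: a)
  have bc: "(k - 2) * ibinom d (k - 2) * ibinom d (k - 1) = (int d - k + 3) * ibinom d (k - 3) * ibinom d (k - 1)"
    by (simp only: c)
  show ?case using ab bb ac bc by (simp add: merge_count_def paired_count_def ibinom_Suc algebra_simps)
next
  case (Suc s)
  have "merge_count (Suc s) (Suc d) k - merge_count s (Suc d) k
      = merge_count (Suc (Suc s)) d k - merge_count (Suc s) d k + merge_count (Suc s) d (k - 1)
        + paired_count (Suc (Suc (Suc s))) d (k - 1) - paired_count (Suc (Suc s)) d (k - 1)"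
    by (simp add: merge_count_def paired_count_def ibinom_Suc algebra_simps)
  then show ?case using Suc.IH by simp
qed

lemma zero_count_root: "zero_count 0 m k = ibinom m k ^ 2"
proof -
  have "(k + 1) * ibinom m (k + 1) = (int m - k) * ibinom m k"
    using ibinom_absorb[of "k + 1" m] by simp
  then have "((k + 1) * ibinom m (k + 1)) * ibinom m (k - 1) = ibinom m k * ((int m - k) * ibinom m (k - 1))"
    by simp
  moreover have "(int m - k) * ibinom m (k - 1) = k * ibinom m k - ibinom m (k - 1)"
    using ibinom_absorb[of k m] by (simp add: algebra_simps)
  ultimately have "((k + 1) * ibinom m (k + 1)) * ibinom m (k - 1) = ibinom m k * (k * ibinom m k - ibinom m (k - 1))"
    by simp
  then show ?thesis
    by (simp add: zero_count_def paired_count_def algebra_simps power2_eq_square)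
qed

lemma merge_count_root: "merge_count 0 m k = ibinom m k * ibinom m (k - 1)"
proof -
  have a: "(k + 1) * ibinom m (k + 1) = (int m - k) * ibinom m k"
    using ibinom_absorb[of "k + 1" m] by simp
  have b: "(int m - k) * ibinom m (k - 2) = (k - 1) * ibinom m (k - 1) - 2 * ibinom m (k - 2)"
    using ibinom_absorb[of "k - 1" m] by (simp add: algebra_simps)
  have "((k + 1) * ibinom m (k + 1)) * ibinom m (k - 2) = ibinom m k * ((int m - k) * ibinom m (k - 2))"
    using a by simp
  then have "((k + 1) * ibinom m (k + 1)) * ibinom m (k - 2)
           = ibinom m k * ((k - 1) * ibinom m (k - 1) - 2 * ibinom m (k - 2))"
    using b by simp
  then show ?thesis
    by (simp add: merge_count_def algebra_simps)
qed

text \<open>The summands come from the two elements of the lowest level, the identity and the sign change of the inner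
circle; the latter has rank 1, hence the shift in the last summand.\<close>

lemma root_count:
  "zero_count 0 m k + 2 * merge_count 0 m k + zero_count 0 m (k - 1) = ibinom (Suc m) k ^ 2"
  by (simp add: zero_count_root merge_count_root ibinom_Suc power2_eq_square algebra_simps)

section \<open>Cutting and inserting points in orbits\<close>

lemma funpow_agree:
  assumes "\<And>b. b < i \<Longrightarrow> \<tau> ((\<sigma> ^^ b) x) = (\<sigma> ^^ Suc b) x" "a \<le> i"
  shows "(\<tau> ^^ a) x = (\<sigma> ^^ a) x"
  using assms(2) by (induction a) (use assms(1) in auto)

lemma funpow_uminus: "\<tau> \<in> hyperoctahedral N \<Longrightarrow> (\<tau> ^^ a) (- x) = - (\<tau> ^^ a) x"
  using hyp_odd[OF hyp_pow] .

lemma funpow_mem_orbit: "\<tau> \<in> hyperoctahedral N \<Longrightarrow> (\<tau> ^^ a) x \<in> orbit \<tau> x"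
  by (simp add: orbit_powers)

lemma hyp_funpow_diff:
  assumes t: "\<tau> \<in> hyperoctahedral N" and "a \<le> b" "(\<tau> ^^ a) x = (\<tau> ^^ b) y"
  shows "x = (\<tau> ^^ (b - a)) y"
proof -
  have "(\<tau> ^^ b) y = (\<tau> ^^ a) ((\<tau> ^^ (b - a)) y)"
    using assms(2) by (metis funpow_add le_add_diff_inverse o_apply)
  then show ?thesis using assms(3) hyp_inj[OF hyp_pow[OF t]] by simp
qed

definition first_return :: "(int \<Rightarrow> int) \<Rightarrow> int \<Rightarrow> nat \<Rightarrow> bool" where
  "first_return \<tau> x i \<longleftrightarrow> 0 < i \<and> (\<tau> ^^ i) x = x \<and> (\<forall>a. 0 < a \<longrightarrow> a < i \<longrightarrow> (\<tau> ^^ a) x \<noteq> x)"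

text \<open>The half-period of an invariant orbit.\<close>

definition half_turn :: "(int \<Rightarrow> int) \<Rightarrow> int \<Rightarrow> nat \<Rightarrow> bool" where
  "half_turn \<tau> x h \<longleftrightarrow> 0 < h \<and> (\<tau> ^^ h) x = - x \<and>
     (\<forall>a. 0 < a \<longrightarrow> a < h \<longrightarrow> (\<tau> ^^ a) x \<noteq> x \<and> (\<tau> ^^ a) x \<noteq> - x)"

lemma orbit_period:
  assumes t: "\<tau> \<in> hyperoctahedral N" and fr: "first_return \<tau> x i"
  shows "orbit \<tau> x = (\<lambda>a. (\<tau> ^^ a) x) ` {..<i}" "inj_on (\<lambda>a. (\<tau> ^^ a) x) {..<i}" "card (orbit \<tau> x) = i"
proof -
  have i: "0 < i" "(\<tau> ^^ i) x = x" and min: "\<And>a. 0 < a \<Longrightarrow> a < i \<Longrightarrow> (\<tau> ^^ a) x \<noteq> x"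
    using fr by (auto simp: first_return_def)
  show o: "orbit \<tau> x = (\<lambda>a. (\<tau> ^^ a) x) ` {..<i}"
    using orbit_altdef_bounded[OF i(2,1)] by auto
  have ne: "(\<tau> ^^ a) x \<noteq> (\<tau> ^^ b) x" if "a < b" "b < i" for a b
  proof
    assume "(\<tau> ^^ a) x = (\<tau> ^^ b) x"
    then have "(\<tau> ^^ (b - a)) x = x" using hyp_funpow_diff[OF t, of a b x x] that by simp
    moreover have "0 < b - a" "b - a < i" using that by simp_all
    ultimately show False using min by blast
  qed
  show inj: "inj_on (\<lambda>a. (\<tau> ^^ a) x) {..<i}"
    by (rule linorder_inj_onI) (use ne in auto)
  show "card (orbit \<tau> x) = i" unfolding o by (simp add: card_image[OF inj])
qed

lemma orbit_period_exists:
  assumes t: "\<tau> \<in> hyperoctahedral N"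
  obtains q where "first_return \<tau> x q"
proof -
  have "x \<in> orbit \<tau> x" by (rule self_mem_orbit[OF t])
  then have ex: "\<exists>q. 0 < q \<and> (\<tau> ^^ q) x = x" unfolding orbit_altdef by auto
  define q where "q = (LEAST q. 0 < q \<and> (\<tau> ^^ q) x = x)"
  have "0 < q \<and> (\<tau> ^^ q) x = x" unfolding q_def by (rule LeastI_ex[OF ex])
  moreover have "(\<tau> ^^ a) x \<noteq> x" if "0 < a" "a < q" for a
    using not_less_Least[of a "\<lambda>q. 0 < q \<and> (\<tau> ^^ q) x = x"] that unfolding q_def by blast
  ultimately show thesis using that unfolding first_return_def by blast
qed

lemma orbit_half_period:
  assumes t: "\<tau> \<in> hyperoctahedral N" and x: "x \<noteq> 0" and ht: "half_turn \<tau> x h"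
  shows "(\<tau> ^^ (h + a)) x = - (\<tau> ^^ a) x" and "first_return \<tau> x (2 * h)"
    and "- x \<in> orbit \<tau> x" and "card (orbit \<tau> x) = 2 * h"
proof -
  have h: "0 < h" "(\<tau> ^^ h) x = - x"
    and min: "\<And>a. 0 < a \<Longrightarrow> a < h \<Longrightarrow> (\<tau> ^^ a) x \<noteq> x \<and> (\<tau> ^^ a) x \<noteq> - x"
    using ht by (auto simp: half_turn_def)
  show shift: "(\<tau> ^^ (h + a)) x = - (\<tau> ^^ a) x" for a
    using h(2) funpow_uminus[OF t, of a x] by (simp add: funpow_add add.commute[of h])
  have per: "(\<tau> ^^ (2 * h)) x = x" using shift[of h] h(2) by (simp add: mult_2)
  have nr: "(\<tau> ^^ a) x \<noteq> x" if a: "0 < a" "a < 2 * h" for a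
  proof -
    consider "a < h" | "a = h" | b where "a = h + b" "0 < b" "b < h"
      using a by (metis add_diff_inverse_nat linorder_neqE_nat mult_2 nat_add_left_cancel_less zero_less_diff)
    then show ?thesis
    proof cases
      case 1 then show ?thesis using min a by blast
    next
      case 2 then show ?thesis using h x by simp
    next
      case 3 then show ?thesis using min[of b] shift[of b] by (simp add: minus_equation_iff[of _ x] eq_commute)
    qed
  qed
  show "- x \<in> orbit \<tau> x" using funpow_mem_orbit[OF t, of h x] h by simp
  show fr: "first_return \<tau> x (2 * h)" using h per nr by (simp add: first_return_def)
  show "card (orbit \<tau> x) = 2 * h" by (rule orbit_period(3)[OF t fr])
qed

lemma orbit_half_period_exists:
  assumes t: "\<tau> \<in> hyperoctahedral N" and x: "x \<noteq> 0" and inv: "- x \<in> orbit \<tau> x"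
  obtains h where "half_turn \<tau> x h"
proof -
  have ex: "\<exists>h. (\<tau> ^^ h) x = - x" using inv unfolding orbit_powers[OF t] by auto
  define h where "h = (LEAST h. (\<tau> ^^ h) x = - x)"
  have h: "(\<tau> ^^ h) x = - x" unfolding h_def by (rule LeastI_ex[OF ex])
  have less: "(\<tau> ^^ a) x \<noteq> - x" if "a < h" for a
    using not_less_Least[of a "\<lambda>h. (\<tau> ^^ h) x = - x"] that unfolding h_def by blast
  have "h \<noteq> 0" using h x by (cases h) auto
  moreover have "(\<tau> ^^ a) x \<noteq> x" if "0 < a" "a < h" for a
  proof
    assume eq: "(\<tau> ^^ a) x = x"
    have "(\<tau> ^^ (h - a)) ((\<tau> ^^ a) x) = (\<tau> ^^ h) x"
      using that by (metis funpow_add le_add_diff_inverse2 less_imp_le o_apply)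
    then show False using less[of "h - a"] that h eq by simp
  qed
  ultimately show thesis using that[of h] h less unfolding half_turn_def by blast
qed

text \<open>Composing with the reflection that exchanges \<open>x\<close> and \<open>j = \<sigma>\<^sup>i x\<close> closes the path from \<open>x\<close> to \<open>j\<close> into
an orbit, provided that the path avoids the other points moved by the reflection.\<close>

lemma cut_orbit:
  assumes s: "\<sigma> \<in> hyperoctahedral N" and x: "x \<in> signed_points N" and j: "j \<in> signed_points N"
    and i: "0 < i" "(\<sigma> ^^ i) x = j"
    and avoid': "\<forall>a. 0 < a \<longrightarrow> a < i \<longrightarrow> (\<sigma> ^^ a) x \<notin> {x, - x, j, - j}"
    and inj': "\<forall>a<i. (\<sigma> ^^ a) x \<noteq> - x"
  shows "orbit (refl_swap x j \<circ> \<sigma>) x = (\<lambda>a. (\<sigma> ^^ a) x) ` {..<i}" (is ?A)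
    and "card (orbit (refl_swap x j \<circ> \<sigma>) x) = i" (is ?B)
    and "- x \<notin> orbit (refl_swap x j \<circ> \<sigma>) x" (is ?C)
proof -
  let ?t = "refl_swap x j \<circ> \<sigma>"
  note avoid = avoid'[rule_format] and inj = inj'[rule_format]
  have t: "?t \<in> hyperoctahedral N" using hyp_comp refl_swap_hyp s x j by blast
  have nz: "x \<noteq> 0" "j \<noteq> 0" using x j by (auto simp: mem_signed_points)
  have agree: "(?t ^^ a) x = (\<sigma> ^^ a) x" if "a \<le> i - 1" for a
  proof (rule funpow_agree[OF _ that])
    fix b assume "b < i - 1"
    then show "?t ((\<sigma> ^^ b) x) = (\<sigma> ^^ Suc b) x"
      using refl_swap_other[OF avoid[of "Suc b"]] by simp
  qed
  have "(?t ^^ i) x = ?t ((?t ^^ (i - 1)) x)" using i(1) by (cases i) auto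
  also have "\<dots> = refl_swap x j ((\<sigma> ^^ i) x)" using i(1) agree[of "i - 1"] by (cases i) auto
  finally have per: "(?t ^^ i) x = x" using i nz by (simp add: refl_swap_right)
  have min: "(?t ^^ a) x \<noteq> x" if "0 < a" "a < i" for a
    using agree[of a] avoid[of a] that by auto
  have "first_return ?t x i" using i per min by (simp add: first_return_def)
  note op = orbit_period[OF t this]
  have "(\<lambda>a. (?t ^^ a) x) ` {..<i} = (\<lambda>a. (\<sigma> ^^ a) x) ` {..<i}"
    by (rule image_cong) (use agree in auto)
  then show A: ?A using op(1) by simp
  show ?B by (rule op(3))
  show ?C unfolding A using inj by (auto simp: eq_commute)
qed

text \<open>The indicator of the orbit that was cut off separates \<open>x\<close> from \<open>j\<close>.\<close>

lemma increases_if_cut: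
  assumes s: "\<sigma> \<in> hyperoctahedral N" and x: "x \<in> signed_points N" and j: "j \<in> signed_points N"
    and sub: "fixed_functions N \<sigma> \<subseteq> fixed_functions N (refl_swap x j)"
    and n: "- x \<notin> orbit (refl_swap x j \<circ> \<sigma>) x" and jn: "j \<notin> orbit (refl_swap x j \<circ> \<sigma>) x"
  shows "fix_dim N (refl_swap x j \<circ> \<sigma>) = fix_dim N \<sigma> + 1"
proof (rule fix_dim_increasesI[OF s x j sub])
  let ?t = "refl_swap x j \<circ> \<sigma>"
  have t: "?t \<in> hyperoctahedral N" using hyp_comp refl_swap_hyp s x j by blast
  show "odd_indicator (orbit ?t x) \<in> fixed_functions N ?t" by (rule odd_indicator_orbit[OF t x n])
  show "(odd_indicator (orbit ?t x) :: int \<Rightarrow> 3) x \<noteq> odd_indicator (orbit ?t x) j"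
    using self_mem_orbit[OF t, of x] jn by (simp add: odd_indicator_def)
qed

lemma fixed_subset_refl_if_orbit:
  assumes x: "x \<in> signed_points N" and j: "j \<in> signed_points N" and "j \<in> orbit \<sigma> x"
  shows "fixed_functions N \<sigma> \<subseteq> fixed_functions N (refl_swap x j)"
proof
  fix f assume f: "f \<in> fixed_functions N \<sigma>"
  then show "f \<in> fixed_functions N (refl_swap x j)"
    using fixed_refl_iff[OF x j] fixed_function_orbit[OF f assms(3)] fixed_functions_subset by fastforce
qed

lemma fixed_subset_refl_if_invariant:
  assumes x: "x \<in> signed_points N" and j: "j \<in> signed_points N" and "- x \<in> orbit \<sigma> x" "- j \<in> orbit \<sigma> j"
  shows "fixed_functions N \<sigma> \<subseteq> fixed_functions N (refl_swap x j)"
proof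
  fix f assume f: "f \<in> fixed_functions N \<sigma>"
  then show "f \<in> fixed_functions N (refl_swap x j)"
    using fixed_refl_iff[OF x j] fixed_function_invariant_orbit[OF f] assms(3,4) fixed_functions_subset by fastforce
qed

text \<open>The indicator of the orbit of \<open>x\<close>, or of \<open>j\<close>, violates \<open>f x = f j\<close> in all other cases.\<close>

lemma orbit_or_invariant_if_increases:
  assumes s: "\<sigma> \<in> hyperoctahedral N" and x: "x \<in> signed_points N" and j: "j \<in> signed_points N"
    and inc: "fix_dim N (refl_swap x j \<circ> \<sigma>) = fix_dim N \<sigma> + 1"
  shows "j \<in> orbit \<sigma> x \<or> - x \<in> orbit \<sigma> x \<and> - j \<in> orbit \<sigma> j"
proof -
  have eq: "f x = f j" if "f \<in> fixed_functions N \<sigma>" for f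
    using fixed_subset_if_fix_dim_increases[OF s x j inc] that fixed_refl_iff[OF x j] fixed_functions_subset by blast
  show ?thesis
  proof (cases "- x \<in> orbit \<sigma> x")
    case False
    have "(odd_indicator (orbit \<sigma> x) :: int \<Rightarrow> 3) x = odd_indicator (orbit \<sigma> x) j"
      by (rule eq[OF odd_indicator_orbit[OF s x False]])
    then show ?thesis using self_mem_orbit[OF s, of x] by (auto simp: odd_indicator_def split: if_splits)
  next
    case True
    have "- j \<in> orbit \<sigma> j"
    proof (rule ccontr)
      assume n: "- j \<notin> orbit \<sigma> j"
      then have f: "(odd_indicator (orbit \<sigma> j) :: int \<Rightarrow> 3) \<in> fixed_functions N \<sigma>"
        by (rule odd_indicator_orbit[OF s j])
      have "(odd_indicator (orbit \<sigma> j) :: int \<Rightarrow> 3) j = 0"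
        using eq[OF f] fixed_function_invariant_orbit[OF f True] by simp
      then show False using self_mem_orbit[OF s, of j] by (simp add: odd_indicator_def)
    qed
    with True show ?thesis by blast
  qed
qed

lemma cut_paired_orbit:
  assumes s: "\<sigma> \<in> hyperoctahedral N" and x: "x \<in> signed_points N" and n: "- x \<notin> orbit \<sigma> x"
    and i: "0 < i" "i < card (orbit \<sigma> x)"
  defines "j \<equiv> (\<sigma> ^^ i) x"
  shows "fix_dim N (refl_swap x j \<circ> \<sigma>) = fix_dim N \<sigma> + 1"
    and "card (orbit (refl_swap x j \<circ> \<sigma>) x) = i" and "- x \<notin> orbit (refl_swap x j \<circ> \<sigma>) x"
proof -
  obtain q where fr: "first_return \<sigma> x q"
    by (rule orbit_period_exists[OF s])
  then have q: "(\<sigma> ^^ a) x \<noteq> x" if "0 < a" "a < q" for a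
    using that by (simp add: first_return_def)
  note op = orbit_period[OF s fr]
  have iq: "i < q" using i op(3) by simp
  have j: "j \<in> signed_points N"
    unfolding j_def using hyp_mem_iff[OF hyp_pow[OF s]] x by simp
  have ij: "(\<sigma> ^^ i) x = j" by (simp add: j_def)
  have jo: "j \<in> orbit \<sigma> x" unfolding j_def by (rule funpow_mem_orbit[OF s])
  have nj: "- j \<notin> orbit \<sigma> x"
  proof
    assume "- j \<in> orbit \<sigma> x"
    then have "inversion_invariant (orbit \<sigma> j)"
      using orbit_eq_if_mem[OF s jo] inversion_invariant_orbit_iff[OF s, of j] by simp
    then show False using orbit_eq_if_mem[OF s jo] inversion_invariant_orbit_iff[OF s, of x] n by simp
  qed
  have av: "(\<sigma> ^^ a) x \<notin> {x, - x, j, - j}" if "0 < a" "a < i" for a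
    using q[of a] inj_onD[OF op(2), of a i] funpow_mem_orbit[OF s, of a x] n nj that iq by (auto simp: j_def)
  have nx: "\<forall>a<i. (\<sigma> ^^ a) x \<noteq> - x" using funpow_mem_orbit[OF s, of _ x] n by (metis)
  have av': "\<forall>a. 0 < a \<longrightarrow> a < i \<longrightarrow> (\<sigma> ^^ a) x \<notin> {x, - x, j, - j}" using av by blast
  note cut = cut_orbit[OF s x j i(1) ij av' nx]
  show "card (orbit (refl_swap x j \<circ> \<sigma>) x) = i" "- x \<notin> orbit (refl_swap x j \<circ> \<sigma>) x"
    using cut(2,3) by auto
  have "j \<notin> orbit (refl_swap x j \<circ> \<sigma>) x"
  proof
    assume "j \<in> orbit (refl_swap x j \<circ> \<sigma>) x"
    then obtain a where a: "a < i" "(\<sigma> ^^ a) x = (\<sigma> ^^ i) x" unfolding cut(1) ij by auto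
    then show False using inj_onD[OF op(2) a(2)] iq by simp
  qed
  then show "fix_dim N (refl_swap x j \<circ> \<sigma>) = fix_dim N \<sigma> + 1"
    by (intro increases_if_cut[OF s x j fixed_subset_refl_if_orbit[OF x j jo] cut(3)])
qed


text \<open>Cutting within the first half of an invariant orbit, or exactly at its antipode \<open>- x\<close>, splits off a paired
orbit containing \<open>x\<close>.\<close>

lemma cut_invariant_orbit_first_half:
  assumes s: "\<sigma> \<in> hyperoctahedral N" and x: "x \<in> signed_points N"
    and ht: "half_turn \<sigma> x h"
    and i: "0 < i" "i \<le> h"
  defines "j \<equiv> (\<sigma> ^^ i) x"
  shows "fix_dim N (refl_swap x j \<circ> \<sigma>) = fix_dim N \<sigma> + 1"
    and "card (orbit (refl_swap x j \<circ> \<sigma>) x) = i" and "- x \<notin> orbit (refl_swap x j \<circ> \<sigma>) x"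
proof -
  have nz: "x \<noteq> 0" by (rule hyp_nonzero[OF x])
  have h: "0 < h" "(\<sigma> ^^ h) x = - x"
    and min: "\<And>a. 0 < a \<Longrightarrow> a < h \<Longrightarrow> (\<sigma> ^^ a) x \<noteq> x \<and> (\<sigma> ^^ a) x \<noteq> - x"
    using ht by (auto simp: half_turn_def)
  note hp = orbit_half_period[OF s nz ht]
  note inj = orbit_period(2)[OF s hp(2)]
  have j: "j \<in> signed_points N"
    unfolding j_def using hyp_mem_iff[OF hyp_pow[OF s]] x by simp
  have ij: "(\<sigma> ^^ i) x = j" by (simp add: j_def)
  have jo: "j \<in> orbit \<sigma> x" unfolding j_def by (rule funpow_mem_orbit[OF s])
  have nej: "(\<sigma> ^^ a) x \<noteq> j" if "a < i" for a
    using inj_onD[OF inj, of a i] that i h unfolding j_def by auto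
  have nenj: "(\<sigma> ^^ a) x \<noteq> - j" if "0 < a" "a < i" for a
  proof
    assume "(\<sigma> ^^ a) x = - j"
    then have "(\<sigma> ^^ (h + a)) x = (\<sigma> ^^ i) x" using hp(1)[of a] ij by simp
    then show False using inj_onD[OF inj, of "h + a" i] that i h by simp
  qed
  have av: "(\<sigma> ^^ a) x \<notin> {x, - x, j, - j}" if "0 < a" "a < i" for a
    using min[of a] nej[of a] nenj[of a] that i by simp
  have "(\<sigma> ^^ a) x \<noteq> - x" if "a < i" for a
    using min[of a] that i nz by (cases "a = 0") auto
  then have nx: "\<forall>a<i. (\<sigma> ^^ a) x \<noteq> - x" by blast
  have av': "\<forall>a. 0 < a \<longrightarrow> a < i \<longrightarrow> (\<sigma> ^^ a) x \<notin> {x, - x, j, - j}" using av by blast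
  note cut = cut_orbit[OF s x j i(1) ij av' nx]
  show "card (orbit (refl_swap x j \<circ> \<sigma>) x) = i" "- x \<notin> orbit (refl_swap x j \<circ> \<sigma>) x"
    using cut(2,3) by auto
  have "j \<notin> orbit (refl_swap x j \<circ> \<sigma>) x" unfolding cut(1) using nej by auto
  then show "fix_dim N (refl_swap x j \<circ> \<sigma>) = fix_dim N \<sigma> + 1"
    by (intro increases_if_cut[OF s x j fixed_subset_refl_if_orbit[OF x j jo] cut(3)])
qed

text \<open>The invariant of the insertion tree: if the newest point \<open>x\<close> lies in an invariant orbit, then the inner circle
\<open>{z, - z}\<close> has not been joined to any other point, and it is the only other place where an invariant orbit may
occur.\<close>

definition zero_confined :: "nat \<Rightarrow> int \<Rightarrow> (int \<Rightarrow> int) \<Rightarrow> int \<Rightarrow> bool" where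
  "zero_confined N z \<sigma> x \<longleftrightarrow> (- x \<in> orbit \<sigma> x \<longrightarrow> (\<sigma> z = z \<or> \<sigma> z = - z) \<and>
     (\<forall>y\<in>signed_points N. - y \<in> orbit \<sigma> y \<longrightarrow> y \<in> orbit \<sigma> x \<union> {z, - z}))"

lemma invariant_orbit_antimono:
  assumes s: "\<sigma> \<in> hyperoctahedral N" and y: "y \<in> signed_points N"
    and sub: "fixed_functions N \<sigma> \<subseteq> fixed_functions N \<tau>" and inv: "- y \<in> orbit \<tau> y"
  shows "- y \<in> orbit \<sigma> y"
proof (rule ccontr)
  assume "- y \<notin> orbit \<sigma> y"
  then have "(odd_indicator (orbit \<sigma> y) :: int \<Rightarrow> 3) \<in> fixed_functions N \<tau>"
    using odd_indicator_orbit[OF s y] sub by blast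
  then have "(odd_indicator (orbit \<sigma> y) :: int \<Rightarrow> 3) y = 0" by (rule fixed_function_invariant_orbit[OF _ inv])
  then show False using self_mem_orbit[OF s, of y] by (simp add: odd_indicator_def)
qed

lemma invariant_orbit_cong:
  assumes s: "\<sigma> \<in> hyperoctahedral N" and "z \<in> orbit \<sigma> y"
  shows "- z \<in> orbit \<sigma> z \<longleftrightarrow> - y \<in> orbit \<sigma> y"
  using orbit_eq_if_mem[OF assms] inversion_invariant_orbit_iff[OF s, of z] inversion_invariant_orbit_iff[OF s, of y]
  by simp

lemma invariant_orbit_uminus:
  assumes s: "\<sigma> \<in> hyperoctahedral N"
  shows "y \<in> orbit \<sigma> (- y) \<longleftrightarrow> - y \<in> orbit \<sigma> y"
  by (metis orbit_eq_iff[OF s])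

lemma pole_notin_orbit:
  assumes s: "\<sigma> \<in> hyperoctahedral N" and z: "\<sigma> z = z \<or> \<sigma> z = - z" and x: "x \<noteq> z" "x \<noteq> - z"
  shows "z \<notin> orbit \<sigma> x" "- z \<notin> orbit \<sigma> x"
proof -
  have pow: "(\<sigma> ^^ a) z = z \<or> (\<sigma> ^^ a) z = - z" for a
    using z hyp_odd[OF s] by (induction a) auto
  have "x \<notin> orbit \<sigma> z" "x \<notin> orbit \<sigma> (- z)"
    using pow x funpow_uminus[OF s, of _ z] unfolding orbit_powers[OF s] by (auto, (metis minus_minus)+)
  then show "z \<notin> orbit \<sigma> x" "- z \<notin> orbit \<sigma> x"
    using orbit_eq_if_mem[OF s, of _ x] self_mem_orbit[OF s, of x] by metis+
qed

text \<open>Cutting in the second half leaves \<open>x\<close> in a shorter invariant orbit, since the path from \<open>x\<close> reaches \<open>- x\<close>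
after \<open>i\<close> steps; the points passed in the remaining steps of the half turn form a paired orbit.\<close>

lemma cut_invariant_orbit_second_half:
  assumes s: "\<sigma> \<in> hyperoctahedral N" and x: "x \<in> signed_points N"
    and ht: "half_turn \<sigma> x h"
    and i: "0 < i" "i < h"
  defines "j \<equiv> (\<sigma> ^^ (h + i)) x"
  shows "fix_dim N (refl_swap x j \<circ> \<sigma>) = fix_dim N \<sigma> + 1"
    and "card (orbit (refl_swap x j \<circ> \<sigma>) x) = 2 * i" and "- x \<in> orbit (refl_swap x j \<circ> \<sigma>) x"
    and "zero_confined N z \<sigma> x \<Longrightarrow> x \<noteq> z \<Longrightarrow> x \<noteq> - z \<Longrightarrow>
           zero_confined N z (refl_swap x j \<circ> \<sigma>) x \<and> (refl_swap x j \<circ> \<sigma>) z = \<sigma> z"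
proof -
  let ?t = "refl_swap x j \<circ> \<sigma>"
  define P where "P a = (\<sigma> ^^ a) x" for a
  have PSuc: "P (Suc a) = \<sigma> (P a)" for a by (simp add: P_def)
  have nz: "x \<noteq> 0" by (rule hyp_nonzero[OF x])
  have h: "0 < h" "(\<sigma> ^^ h) x = - x"
    and min: "\<And>a. 0 < a \<Longrightarrow> a < h \<Longrightarrow> (\<sigma> ^^ a) x \<noteq> x \<and> (\<sigma> ^^ a) x \<noteq> - x"
    using ht by (auto simp: half_turn_def)
  note hp = orbit_half_period[OF s nz ht]
  have shift: "P (h + a) = - P a" for a using hp(1) by (simp add: P_def)
  note op = orbit_period[OF s hp(2)]
  have inj: "P a = P b \<longleftrightarrow> a = b" if "a < 2 * h" "b < 2 * h" for a b
    using inj_onD[OF op(2), of a b] that by (auto simp: P_def)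
  have PS: "P a \<in> signed_points N" for a
    unfolding P_def using hyp_mem_iff[OF hyp_pow[OF s]] x by simp
  have Ph: "P h = - x" "P 0 = x" using h by (simp_all add: P_def)
  \<comment> \<open>\<open>j\<close> is the antipode of \<open>P i\<close>, so the reflection sends \<open>P i\<close> to \<open>- x\<close> and \<open>- x\<close> to \<open>P i\<close>.\<close>
  have jP: "j = P (h + i)" "j = - P i" using shift[of i] by (simp_all add: j_def P_def)
  have j: "j \<in> signed_points N" using PS jP by simp
  have jnz: "j \<noteq> 0" by (rule hyp_nonzero[OF j])
  have jo: "j \<in> orbit \<sigma> x" unfolding j_def by (rule funpow_mem_orbit[OF s])
  have t: "?t \<in> hyperoctahedral N" using hyp_comp refl_swap_hyp s x j by blast
  have other: "refl_swap x j (P a) = P a" if "a < h" "a \<noteq> 0" "a \<noteq> i" for a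
  proof (rule refl_swap_other)
    have "P a \<noteq> P 0" "P a \<noteq> P h" "P a \<noteq> P (h + i)" "P a \<noteq> P i" using that i by (simp_all add: inj)
    then show "P a \<notin> {x, - x, j, - j}" using Ph jP by simp
  qed
  have agree: "(?t ^^ a) x = P a" if "a \<le> i - 1" for a
    unfolding P_def
  proof (rule funpow_agree[OF _ that])
    fix b assume "b < i - 1"
    then show "?t ((\<sigma> ^^ b) x) = (\<sigma> ^^ Suc b) x" using other[of "Suc b"] i by (simp add: P_def)
  qed
  have "(?t ^^ i) x = ?t ((?t ^^ (i - 1)) x)" using i(1) by (cases i) auto
  also have "\<dots> = refl_swap x j (P i)" using i(1) agree[of "i - 1"] by (cases i) (auto simp: P_def)
  also have "\<dots> = - x"
    using jP(2) refl_swap_odd[OF nz jnz, of j] refl_swap_right[OF nz jnz] by (metis minus_minus)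
  finally have half: "(?t ^^ i) x = - x" .
  have min': "(?t ^^ a) x \<noteq> x \<and> (?t ^^ a) x \<noteq> - x" if "0 < a" "a < i" for a
    using agree[of a] min[of a] that i by (simp add: P_def)
  have "half_turn ?t x i" using i half min' by (simp add: half_turn_def)
  note hp' = orbit_half_period[OF t nz this]
  show "card (orbit ?t x) = 2 * i" and tinv: "- x \<in> orbit ?t x" using hp'(3,4) by auto
  \<comment> \<open>The other half of the old half turn, from \<open>P i\<close> to \<open>P (h - 1)\<close>, now closes up.\<close>
  let ?y = "P i"
  have powP: "(\<sigma> ^^ b) ?y = P (b + i)" for b by (simp add: P_def funpow_add)
  have agree2: "(?t ^^ b) ?y = P (b + i)" if "b \<le> h - i - 1" for b
  proof -
    have "(?t ^^ b) ?y = (\<sigma> ^^ b) ?y"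
    proof (rule funpow_agree[OF _ that])
      fix c assume c: "c < h - i - 1"
      have "?t ((\<sigma> ^^ c) ?y) = refl_swap x j (P (Suc (c + i)))" by (simp add: powP PSuc)
      also have "\<dots> = P (Suc (c + i))" using c i by (intro other) auto
      finally show "?t ((\<sigma> ^^ c) ?y) = (\<sigma> ^^ Suc c) ?y" by (simp add: powP PSuc)
    qed
    then show ?thesis by (simp only: powP)
  qed
  have "(?t ^^ (h - i)) ?y = ?t ((?t ^^ (h - i - 1)) ?y)" using i(2) by (cases "h - i") auto
  also have "\<dots> = ?t (P (h - 1))" using agree2[of "h - i - 1"] i by simp
  also have "\<dots> = refl_swap x j (P h)" using PSuc[of "h - 1"] i by simp
  also have "\<dots> = ?y" using jP Ph refl_swap_odd[OF nz jnz, of x] by simp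
  finally have per2: "(?t ^^ (h - i)) ?y = ?y" .
  have min2: "(?t ^^ b) ?y \<noteq> ?y" if "0 < b" "b < h - i" for b
    using agree2[of b] that i by (simp add: inj)
  have fr2: "first_return ?t ?y (h - i)" using i per2 min2 by (simp add: first_return_def)
  have o2: "orbit ?t ?y = (\<lambda>b. P (b + i)) ` {..<h - i}"
    unfolding orbit_period(1)[OF t fr2] by (rule image_cong) (use agree2 in auto)
  have ny: "- ?y \<notin> orbit ?t ?y"
  proof
    assume "- ?y \<in> orbit ?t ?y"
    then obtain b where "b < h - i" "P (h + i) = P (b + i)" unfolding o2 shift by auto
    then show False using inj[of "h + i" "b + i"] i by simp
  qed
  have sub: "fixed_functions N \<sigma> \<subseteq> fixed_functions N (refl_swap x j)"
    by (rule fixed_subset_refl_if_orbit[OF x j jo])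
  let ?g = "odd_indicator (orbit ?t ?y) :: int \<Rightarrow> 3"
  have g: "?g \<in> fixed_functions N ?t" by (rule odd_indicator_orbit[OF t PS ny])
  have "- j = ?y" using jP(2) by simp
  then have "j \<notin> orbit ?t ?y" "- j \<in> orbit ?t ?y"
    using ny self_mem_orbit[OF t, of ?y] by (metis minus_minus)+
  then have "?g j = - 1" by (simp add: odd_indicator_def)
  moreover have "?g x = 0" by (rule fixed_function_invariant_orbit[OF g tinv])
  ultimately have "?g x \<noteq> ?g j" by simp
  then show "fix_dim N ?t = fix_dim N \<sigma> + 1" by (rule fix_dim_increasesI[OF s x j sub g])
  assume conf: "zero_confined N z \<sigma> x" and xz: "x \<noteq> z" "x \<noteq> - z"
  then have sz: "\<sigma> z = z \<or> \<sigma> z = - z" and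
    cover: "\<And>y. y \<in> signed_points N \<Longrightarrow> - y \<in> orbit \<sigma> y \<Longrightarrow> y \<in> orbit \<sigma> x \<union> {z, - z}"
    using hp(3) by (auto simp: zero_confined_def)
  have "j \<noteq> z" "j \<noteq> - z" using pole_notin_orbit[OF s sz xz] jo by auto
  then have "refl_swap x j z = z" "refl_swap x j (- z) = - z"
    using xz by (auto intro!: refl_swap_other)
  then have tz: "?t z = \<sigma> z" using sz by auto
  have mono: "fixed_functions N \<sigma> \<subseteq> fixed_functions N ?t"
    using sub fixed_functions_refl_comp[OF x j, of \<sigma>] by blast
  have "y \<in> orbit ?t x \<union> {z, - z}" if y: "y \<in> signed_points N" "- y \<in> orbit ?t y" for y
  proof (cases "y \<in> orbit \<sigma> x")
    case False
    then show ?thesis using cover[OF y(1)] invariant_orbit_antimono[OF s y(1) mono y(2)] by blast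
  next
    case True
    then obtain a where a: "a < 2 * h" "y = P a" unfolding op(1) P_def by auto
    have no: "v \<notin> orbit ?t ?y" if "- v \<in> orbit ?t v" for v
      using invariant_orbit_cong[OF t, of v ?y] that ny by blast
    \<comment> \<open>The four arcs of the old orbit: the first and third make up the new invariant orbit, the others a pair.\<close>
    consider "a < i" | "i \<le> a" "a < h" | "h \<le> a" "a - h < i" | "h \<le> a" "i \<le> a - h" by linarith
    then show ?thesis
    proof cases
      case 1
      then show ?thesis using agree[of a] funpow_mem_orbit[OF t, of a x] a by simp
    next
      case 2
      then have "y = P ((a - i) + i)" "a - i < h - i" using a by simp_all
      then have "y \<in> orbit ?t ?y" unfolding o2 by blast
      then show ?thesis using no y by blast
    next
      case 3
      then have "y = - P (a - h)" using shift[of "a - h"] a by simp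
      also have "P (a - h) = (?t ^^ (a - h)) x" using agree[of "a - h"] 3 by simp
      also have "- (?t ^^ (a - h)) x = (?t ^^ (i + (a - h))) x" using hp'(1) by simp
      finally show ?thesis using funpow_mem_orbit[OF t, of "i + (a - h)" x] by simp
    next
      case 4
      then have "- y = P (a - h)" using shift[of "a - h"] a by simp
      also have "\<dots> = P ((a - h - i) + i)" using 4 by simp
      finally have "- y = P ((a - h - i) + i)" .
      moreover have "a - h - i \<in> {..<h - i}" using 4 a i by auto
      ultimately have "- y \<in> orbit ?t ?y" unfolding o2 by (rule image_eqI)
      moreover have "- (- y) \<in> orbit ?t (- y)" using y(2) invariant_orbit_uminus[OF t, of y] by simp
      ultimately show ?thesis using no by blast
    qed
  qed
  then show "zero_confined N z ?t x \<and> ?t z = \<sigma> z"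
    using tz sz tinv by (auto simp: zero_confined_def)
qed

text \<open>Exchanging \<open>x\<close> with a point of the other invariant orbit turns the two invariant orbits into one pair: the half
turn from \<open>x\<close> ends in \<open>- j\<close> instead of \<open>- x\<close>, and one more step leads back to \<open>x\<close>.\<close>

lemma merge_invariant_orbits:
  assumes s: "\<sigma> \<in> hyperoctahedral N" and x: "x \<in> signed_points N"
    and ht: "half_turn \<sigma> x h"
    and j: "j \<in> signed_points N" "\<sigma> j = - j" "x \<noteq> j" "x \<noteq> - j"
  shows "fix_dim N (refl_swap x j \<circ> \<sigma>) = fix_dim N \<sigma> + 1"
    and "card (orbit (refl_swap x j \<circ> \<sigma>) x) = Suc h" and "- x \<notin> orbit (refl_swap x j \<circ> \<sigma>) x"
proof -
  let ?t = "refl_swap x j \<circ> \<sigma>"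
  have nz: "x \<noteq> 0" "j \<noteq> 0" using hyp_nonzero x j by auto
  have h: "0 < h" "(\<sigma> ^^ h) x = - x"
    and min: "\<And>a. 0 < a \<Longrightarrow> a < h \<Longrightarrow> (\<sigma> ^^ a) x \<noteq> x \<and> (\<sigma> ^^ a) x \<noteq> - x"
    using ht by (auto simp: half_turn_def)
  note hp = orbit_half_period[OF s nz(1) ht]
  have t: "?t \<in> hyperoctahedral N" using hyp_comp refl_swap_hyp s x j by blast
  have sj: "\<sigma> j = j \<or> \<sigma> j = - j" using j by simp
  have nj: "(\<sigma> ^^ a) x \<noteq> j \<and> (\<sigma> ^^ a) x \<noteq> - j" for a
    using pole_notin_orbit[OF s sj j(3,4)] funpow_mem_orbit[OF s, of a x] by auto
  have agree: "(?t ^^ a) x = (\<sigma> ^^ a) x" if "a \<le> h - 1" for a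
  proof (rule funpow_agree[OF _ that])
    fix b assume "b < h - 1"
    then have "(\<sigma> ^^ Suc b) x \<notin> {x, - x, j, - j}" using min[of "Suc b"] nj[of "Suc b"] by simp
    then show "?t ((\<sigma> ^^ b) x) = (\<sigma> ^^ Suc b) x" using refl_swap_other by simp
  qed
  have "(?t ^^ h) x = ?t ((?t ^^ (h - 1)) x)" using h(1) by (cases h) auto
  also have "\<dots> = refl_swap x j (- x)" using h agree[of "h - 1"] by (cases h) auto
  also have "\<dots> = - j" using refl_swap_odd[OF nz, of x] by simp
  finally have th: "(?t ^^ h) x = - j" .
  have per: "(?t ^^ Suc h) x = x"
    using th j hyp_odd[OF s, of j] by (simp add: refl_swap_right nz)
  have mn: "(?t ^^ a) x \<noteq> x \<and> (?t ^^ a) x \<noteq> - x \<and> (?t ^^ a) x \<noteq> j" if "0 < a" "a < Suc h" for a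
  proof (cases "a = h")
    case True then show ?thesis using th j nz by auto
  next
    case False then show ?thesis using agree[of a] min[of a] nj[of a] that by auto
  qed
  then have "first_return ?t x (Suc h)" using per by (simp add: first_return_def)
  note op = orbit_period[OF t this]
  show "card (orbit ?t x) = Suc h" by (rule op(3))
  have "(?t ^^ a) x \<noteq> - x \<and> (?t ^^ a) x \<noteq> j" if "a < Suc h" for a
    using mn[of a] that nz j by (cases "a = 0") auto
  then have no: "- x \<notin> orbit ?t x" "j \<notin> orbit ?t x" unfolding op(1) image_iff by (metis lessThan_iff)+
  then show "- x \<notin> orbit ?t x" by blast
  have "- j \<in> orbit \<sigma> j" using orbit.base[of \<sigma> j] j by simp
  then have "fixed_functions N \<sigma> \<subseteq> fixed_functions N (refl_swap x j)"
    by (intro fixed_subset_refl_if_invariant x j hp(3))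
  then show "fix_dim N ?t = fix_dim N \<sigma> + 1" by (rule increases_if_cut[OF s x j(1) _ no])
qed


text \<open>Composing with the exchange of a fixed point \<open>w\<close> with \<open>x\<close> inserts \<open>w\<close> directly after \<open>x\<close>. No further
invariant orbit appears, because a function invariant before the insertion becomes invariant after it once its
value at \<open>w\<close> is adjusted.\<close>

lemma insert_point:
  assumes s: "\<sigma> \<in> hyperoctahedral N" and x: "x \<in> signed_points N" and w: "w \<in> signed_points N"
    and fx: "\<sigma> w = w" and ne: "w \<noteq> x" "w \<noteq> - x"
  defines "\<rho> \<equiv> \<sigma> \<circ> refl_swap w x"
  shows "- x \<notin> orbit \<sigma> x \<Longrightarrow> - w \<notin> orbit \<rho> w \<and> card (orbit \<rho> w) = Suc (card (orbit \<sigma> x))"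
    and "- x \<in> orbit \<sigma> x \<Longrightarrow> - w \<in> orbit \<rho> w \<and> card (orbit \<rho> w) = card (orbit \<sigma> x) + 2"
    and "zero_confined N z \<sigma> x \<Longrightarrow> z \<notin> {x, - x, w, - w} \<Longrightarrow> zero_confined N z \<rho> w \<and> \<rho> z = \<sigma> z"
proof -
  have nz: "x \<noteq> 0" "w \<noteq> 0" using hyp_nonzero x w by auto
  have t: "\<rho> \<in> hyperoctahedral N" unfolding \<rho>_def using hyp_comp refl_swap_hyp s x w by blast
  have rw: "\<rho> w = \<sigma> x" by (simp add: \<rho>_def)
  have rx: "\<rho> x = w" using fx by (simp add: \<rho>_def refl_swap_right nz)
  have ro: "\<rho> y = \<sigma> y" if "y \<notin> {x, - x, w, - w}" for y
    using that by (simp add: \<rho>_def refl_swap_def)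
  have fw: "\<sigma> w = w \<or> \<sigma> w = - w" using fx by simp
  have nw: "(\<sigma> ^^ a) x \<noteq> w" "(\<sigma> ^^ a) x \<noteq> - w" for a
    using pole_notin_orbit[OF s fw, of x] ne funpow_mem_orbit[OF s, of a x] by (auto simp: minus_equation_iff)
  have follow: "(\<rho> ^^ Suc a) w = (\<sigma> ^^ Suc a) x"
    if "\<And>b. 0 < b \<Longrightarrow> b \<le> a \<Longrightarrow> (\<sigma> ^^ b) x \<noteq> x \<and> (\<sigma> ^^ b) x \<noteq> - x" for a
    using that
  proof (induction a)
    case 0
    show ?case using rw by simp
  next
    case (Suc a)
    have "(\<rho> ^^ Suc a) w = (\<sigma> ^^ Suc a) x" using Suc.IH Suc.prems by simp
    moreover have "\<rho> ((\<sigma> ^^ Suc a) x) = \<sigma> ((\<sigma> ^^ Suc a) x)"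
      using Suc.prems[of "Suc a"] nw[of "Suc a"] by (intro ro) simp
    ultimately show ?case by simp
  qed
  show "- w \<notin> orbit \<rho> w \<and> card (orbit \<rho> w) = Suc (card (orbit \<sigma> x))" if n: "- x \<notin> orbit \<sigma> x"
  proof -
    obtain q where fr: "first_return \<sigma> x q" by (rule orbit_period_exists[OF s])
    have q: "0 < q" "(\<sigma> ^^ q) x = x" and min: "\<And>a. 0 < a \<Longrightarrow> a < q \<Longrightarrow> (\<sigma> ^^ a) x \<noteq> x"
      using fr by (auto simp: first_return_def)
    have nx: "(\<sigma> ^^ a) x \<noteq> - x" for a using funpow_mem_orbit[OF s, of a x] n by auto
    have fo: "(\<rho> ^^ a) w = (\<sigma> ^^ a) x" if a: "0 < a" "a \<le> q" for a
    proof -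
      have "(\<rho> ^^ Suc (a - 1)) w = (\<sigma> ^^ Suc (a - 1)) x"
        by (rule follow) (use min nx a in auto)
      then show ?thesis using a by simp
    qed
    have per: "(\<rho> ^^ Suc q) w = w" using fo[of q] q rx by simp
    have "(\<rho> ^^ a) w \<noteq> w" if "0 < a" "a < Suc q" for a
      using fo[of a] nw[of a] that by simp
    then have "first_return \<rho> w (Suc q)" using per by (simp add: first_return_def)
    note op = orbit_period[OF t this]
    have "(\<rho> ^^ a) w \<noteq> - w" if "a < Suc q" for a
      using fo[of a] nw[of a] nz that by (cases "a = 0") auto
    then have "- w \<notin> orbit \<rho> w" unfolding op(1) image_iff by (metis lessThan_iff)
    then show ?thesis using op(3) orbit_period(3)[OF s fr] by simp
  qed
  have inv: "- w \<in> orbit \<rho> w \<and> card (orbit \<rho> w) = card (orbit \<sigma> x) + 2 \<and> orbit \<sigma> x \<subseteq> orbit \<rho> w"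
    if i: "- x \<in> orbit \<sigma> x"
  proof -
    obtain h where ht: "half_turn \<sigma> x h" by (rule orbit_half_period_exists[OF s nz(1) i])
    have h: "0 < h" "(\<sigma> ^^ h) x = - x"
      and min: "\<And>a. 0 < a \<Longrightarrow> a < h \<Longrightarrow> (\<sigma> ^^ a) x \<noteq> x \<and> (\<sigma> ^^ a) x \<noteq> - x"
      using ht by (auto simp: half_turn_def)
    note hp = orbit_half_period[OF s nz(1) ht]
    have fo: "(\<rho> ^^ a) w = (\<sigma> ^^ a) x" if a: "0 < a" "a \<le> h" for a
    proof -
      have "(\<rho> ^^ Suc (a - 1)) w = (\<sigma> ^^ Suc (a - 1)) x"
        by (rule follow) (use min a in auto)
      then show ?thesis using a by simp
    qed
    have "\<rho> (- x) = - w" using hyp_odd[OF t, of x] rx by simp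
    then have per: "(\<rho> ^^ Suc h) w = - w" using fo[of h] h by simp
    have "(\<rho> ^^ a) w \<noteq> w \<and> (\<rho> ^^ a) w \<noteq> - w" if "0 < a" "a < Suc h" for a
      using fo[of a] nw[of a] that by simp
    then have "half_turn \<rho> w (Suc h)" using per by (simp add: half_turn_def)
    note hp' = orbit_half_period[OF t nz(2) this]
    have mem: "(\<sigma> ^^ a) x \<in> orbit \<rho> w" if "0 < a" "a \<le> h" for a
      using fo[of a] funpow_mem_orbit[OF t, of a w] that by simp
    have "inversion_invariant (orbit \<rho> w)" using inversion_invariant_orbit_iff[OF t] hp'(3) by blast
    then have neg: "- y \<in> orbit \<rho> w" if "y \<in> orbit \<rho> w" for y
      using that unfolding inversion_invariant_def by blast
    have "(\<sigma> ^^ a) x \<in> orbit \<rho> w" if a: "a < 2 * h" for a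
    proof -
      consider "a = 0" | "0 < a" "a \<le> h" | b where "a = h + b" "0 < b" "b \<le> h"
        using a by (metis add_diff_inverse_nat linorder_le_less_linear less_imp_le mult_2 nat_add_left_cancel_less neq0_conv zero_less_diff)
      then show ?thesis
      proof cases
        case 1 then show ?thesis using neg[OF mem[of h]] h by simp
      next
        case 2 then show ?thesis using mem by blast
      next
        case 3 then show ?thesis using neg[OF mem[of b]] hp(1)[of b] by simp
      qed
    qed
    then have "orbit \<sigma> x \<subseteq> orbit \<rho> w" unfolding orbit_period(1)[OF s hp(2)] by blast
    then show ?thesis using hp'(3,4) hp(4) by simp
  qed
  then show "- w \<in> orbit \<rho> w \<and> card (orbit \<rho> w) = card (orbit \<sigma> x) + 2" if "- x \<in> orbit \<sigma> x"
    using that by blast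
  assume conf: "zero_confined N z \<sigma> x" and zo: "z \<notin> {x, - x, w, - w}"
  have rz: "\<rho> z = \<sigma> z" using zo by (rule ro)
  have "zero_confined N z \<rho> w"
    unfolding zero_confined_def
  proof (intro impI conjI ballI)
    assume wi: "- w \<in> orbit \<rho> w"
    have feq: "fixed_functions N \<rho> = fixed_functions N \<sigma> \<inter> fixed_functions N (refl_swap w x)"
      unfolding \<rho>_def by (rule fixed_functions_comp_refl[OF s w x fx])
    have dw: "(odd_indicator {w} :: int \<Rightarrow> 3) \<in> fixed_functions N \<sigma>"
      by (rule odd_indicator_fixed_point[OF s w fx])
    have lift: "\<exists>g\<in>fixed_functions N \<rho>. \<forall>y. y \<noteq> w \<longrightarrow> y \<noteq> - w \<longrightarrow> g y = f y"
      if f: "f \<in> fixed_functions N \<sigma>" for f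
    proof
      \<comment> \<open>The value at \<open>w\<close> is changed from \<open>f w\<close> to \<open>f x\<close>.\<close>
      let ?g = "\<lambda>y. f y + (f x - f w) * odd_indicator {w} y"
      have "?g \<in> fixed_functions N \<sigma>"
        using f dw by (simp add: fixed_functions_def odd_functions_def algebra_simps)
      moreover have "?g w = ?g x" using ne by (simp add: odd_indicator_singleton minus_equation_iff)
      ultimately show "?g \<in> fixed_functions N \<rho>"
        unfolding feq using fixed_refl_iff[OF w x] fixed_functions_subset by blast
      show "\<forall>y. y \<noteq> w \<longrightarrow> y \<noteq> - w \<longrightarrow> ?g y = f y" by (simp add: odd_indicator_singleton)
    qed
    have down: "- y \<in> orbit \<sigma> y" if y: "y \<in> signed_points N" "- y \<in> orbit \<rho> y" "y \<noteq> w" "y \<noteq> - w" for y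
    proof (rule ccontr)
      assume "- y \<notin> orbit \<sigma> y"
      then have "(odd_indicator (orbit \<sigma> y) :: int \<Rightarrow> 3) \<in> fixed_functions N \<sigma>" by (rule odd_indicator_orbit[OF s y(1)])
      from lift[OF this] obtain g :: "int \<Rightarrow> 3" where
        g: "g \<in> fixed_functions N \<rho>" "g y = odd_indicator (orbit \<sigma> y) y" using y by blast
      have "g y = 0" by (rule fixed_function_invariant_orbit[OF g(1) y(2)])
      then show False using g(2) self_mem_orbit[OF s, of y] by (simp add: odd_indicator_def)
    qed
    have xi: "- x \<in> orbit \<sigma> x"
    proof (rule down[OF x])
      have "w \<in> orbit \<rho> x" using orbit.base[of \<rho> x] rx by simp
      then show "- x \<in> orbit \<rho> x" using invariant_orbit_cong[OF t] wi by blast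
    qed (use ne in auto)
    from conf xi show "\<rho> z = z \<or> \<rho> z = - z" using rz by (simp add: zero_confined_def)
    fix y assume y: "y \<in> signed_points N" "- y \<in> orbit \<rho> y"
    show "y \<in> orbit \<rho> w \<union> {z, - z}"
    proof (cases "y = w \<or> y = - w")
      case True
      then show ?thesis using wi self_mem_orbit[OF t, of w] by auto
    next
      case False
      then have "- y \<in> orbit \<sigma> y" using down y by blast
      then have "y \<in> orbit \<sigma> x \<union> {z, - z}" using conf xi y(1) by (auto simp: zero_confined_def)
      then show ?thesis using inv[OF xi] by blast
    qed
  qed
  then show "zero_confined N z \<rho> w \<and> \<rho> z = \<sigma> z" using rz by blast
qed

section \<open>The children of a node of the insertion tree\<close>

text \<open>The possible choices at a node, encoded by the image \<open>j\<close> of the new point \<open>x\<close>; the choice \<open>j = x\<close> leaves the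
permutation unchanged.\<close>

definition lowering :: "nat \<Rightarrow> (int \<Rightarrow> int) \<Rightarrow> int \<Rightarrow> int set" where
  "lowering N \<sigma> x = {j \<in> signed_points N. j = x \<or> fix_dim N (refl_swap x j \<circ> \<sigma>) = fix_dim N \<sigma> + 1}"

text \<open>The number of descendants in terms of the complement \<open>\<sigma>\<close> of a node with newest point \<open>x\<close> and inner circle
\<open>{z, - z}\<close>.\<close>

definition node_count :: "int \<Rightarrow> (int \<Rightarrow> int) \<Rightarrow> int \<Rightarrow> nat \<Rightarrow> int \<Rightarrow> int" where
  "node_count z \<sigma> x d k = (if - x \<in> orbit \<sigma> x
     then zero_count (card (orbit \<sigma> x) div 2) d k
          + (if \<sigma> z = - z then 2 * merge_count (card (orbit \<sigma> x) div 2) d k else 0)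
     else paired_count (card (orbit \<sigma> x)) d k)"

text \<open>As \<open>node_count\<close>, but for the complement with the next point \<open>x\<close> already inserted and not yet used. The
insertion has enlarged the orbit by one point, or by the pair \<open>x\<close>, \<open>- x\<close>, which the subtraction compensates.\<close>

definition fresh_count :: "int \<Rightarrow> (int \<Rightarrow> int) \<Rightarrow> int \<Rightarrow> nat \<Rightarrow> int \<Rightarrow> int" where
  "fresh_count z \<sigma> x d k = (if - x \<in> orbit \<sigma> x
     then zero_count (card (orbit \<sigma> x) div 2 - 1) d k
          + (if \<sigma> z = - z then 2 * merge_count (card (orbit \<sigma> x) div 2 - 1) d k else 0)
     else paired_count (card (orbit \<sigma> x) - 1) d k)"

lemma lowering_subset: "lowering N \<sigma> x \<subseteq> signed_points N"
  by (auto simp: lowering_def)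

lemma lowering_cases:
  assumes s: "\<sigma> \<in> hyperoctahedral N" and x: "x \<in> signed_points N" and j: "j \<in> lowering N \<sigma> x"
  shows "j \<in> orbit \<sigma> x \<or> - x \<in> orbit \<sigma> x \<and> - j \<in> orbit \<sigma> j"
  using orbit_or_invariant_if_increases[OF s x, of j] self_mem_orbit[OF s, of x] j by (auto simp: lowering_def)

lemma lowering_paired:
  assumes s: "\<sigma> \<in> hyperoctahedral N" and x: "x \<in> signed_points N" and n: "- x \<notin> orbit \<sigma> x"
  shows "lowering N \<sigma> x = orbit \<sigma> x"
proof
  show "lowering N \<sigma> x \<subseteq> orbit \<sigma> x" using lowering_cases[OF s x] n by blast
  show "orbit \<sigma> x \<subseteq> lowering N \<sigma> x"
  proof
    fix j assume j: "j \<in> orbit \<sigma> x"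
    obtain q where fr: "first_return \<sigma> x q" by (rule orbit_period_exists[OF s])
    note op = orbit_period[OF s fr]
    from j obtain i where i: "i < q" "j = (\<sigma> ^^ i) x" unfolding op(1) by blast
    then show "j \<in> lowering N \<sigma> x"
      using cut_paired_orbit(1)[OF s x n, of i] op(3) j orbit_subset_signed_points[OF s x]
      by (cases "i = 0") (auto simp: lowering_def x)
  qed
qed

lemma fixed_point_orbit_singleton:
  assumes s: "\<sigma> \<in> hyperoctahedral N" and "\<sigma> y = y"
  shows "y \<in> orbit \<sigma> x \<Longrightarrow> x = y" and "y \<noteq> 0 \<Longrightarrow> - y \<notin> orbit \<sigma> y"
proof -
  have o: "orbit \<sigma> y = {y}" using assms(2) by (simp add: orbit_eq_singleton_iff)
  show "x = y" if "y \<in> orbit \<sigma> x"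
    using orbit_eq_if_mem[OF s that] o self_mem_orbit[OF s, of x] by blast
  show "- y \<notin> orbit \<sigma> y" if "y \<noteq> 0" using o that by simp
qed

lemma lowering_invariant:
  assumes s: "\<sigma> \<in> hyperoctahedral N" and x: "x \<in> signed_points N" and i: "- x \<in> orbit \<sigma> x"
    and conf: "zero_confined N z \<sigma> x" and z: "z \<in> signed_points N" "x \<noteq> z" "x \<noteq> - z"
  shows "lowering N \<sigma> x = orbit \<sigma> x \<union> (if \<sigma> z = - z then {z, - z} else {})"
proof
  have sz: "\<sigma> z = z \<or> \<sigma> z = - z" using conf i by (simp add: zero_confined_def)
  have nz: "x \<noteq> 0" "z \<noteq> 0" using hyp_nonzero x z by auto
  obtain h where ht: "half_turn \<sigma> x h" by (rule orbit_half_period_exists[OF s nz(1) i])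
  note hp = orbit_half_period[OF s nz(1) ht]
  note op = orbit_period[OF s hp(2)]
  show "lowering N \<sigma> x \<subseteq> orbit \<sigma> x \<union> (if \<sigma> z = - z then {z, - z} else {})"
  proof
    fix j assume j: "j \<in> lowering N \<sigma> x"
    show "j \<in> orbit \<sigma> x \<union> (if \<sigma> z = - z then {z, - z} else {})"
    proof (cases "j \<in> orbit \<sigma> x")
      case False
      then have ji: "- j \<in> orbit \<sigma> j" using lowering_cases[OF s x j] by blast
      then have jz: "j \<in> {z, - z}" using conf i j False by (auto simp: zero_confined_def lowering_def)
      have "\<sigma> z \<noteq> z"
      proof
        assume "\<sigma> z = z"
        then have "\<sigma> j = j" using jz hyp_odd[OF s] by auto
        then show False using fixed_point_orbit_singleton(2)[OF s, of j] ji jz nz by auto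
      qed
      then show ?thesis using sz jz by auto
    qed simp
  qed
  show "orbit \<sigma> x \<union> (if \<sigma> z = - z then {z, - z} else {}) \<subseteq> lowering N \<sigma> x"
  proof
    fix j assume j: "j \<in> orbit \<sigma> x \<union> (if \<sigma> z = - z then {z, - z} else {})"
    show "j \<in> lowering N \<sigma> x"
    proof (cases "j \<in> orbit \<sigma> x")
      case True
      then obtain a where a: "a < 2 * h" "j = (\<sigma> ^^ a) x" unfolding op(1) by blast
      have jS: "j \<in> signed_points N" using True orbit_subset_signed_points[OF s x] by blast
      consider "a = 0" | "0 < a" "a \<le> h" | "0 < a - h" "a - h < h" "a = h + (a - h)" using a by linarith
      then show ?thesis
      proof cases
        case 1 then show ?thesis using a x by (simp add: lowering_def)
      next
        case 2 then show ?thesis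
          using cut_invariant_orbit_first_half(1)[OF s x ht 2] a(2) jS by (simp add: lowering_def)
      next
        case 3 then show ?thesis
          using cut_invariant_orbit_second_half(1)[OF s x ht 3(1,2)] a(2) jS by (simp add: lowering_def)
      qed
    next
      case False
      then have jz: "j = z \<or> j = - z" "\<sigma> z = - z" using j by (auto split: if_splits)
      then have sj: "j \<in> signed_points N" "\<sigma> j = - j" "x \<noteq> j" "x \<noteq> - j"
        using z hyp_odd[OF s] by auto
      then show ?thesis using merge_invariant_orbits(1)[OF s x ht sj] by (simp add: lowering_def)
    qed
  qed
qed

lemma sum_lessThan_add:
  fixes f :: "nat \<Rightarrow> int" shows "(\<Sum>a<m + n. f a) = (\<Sum>a<m. f a) + (\<Sum>b<n. f (m + b))"
  by (induction n) simp_all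

text \<open>The recurrences for the closed forms are exactly the statement that a node has as many descendants as its
children have together. Apart from \<open>j = x\<close>, running through the orbit from \<open>x\<close> on lists the children by
increasing size of the new orbit, separately in each half of an invariant orbit.\<close>

lemma children_count:
  assumes s: "\<sigma> \<in> hyperoctahedral N" and x: "x \<in> signed_points N"
    and conf: "zero_confined N z \<sigma> x" and z: "z \<in> signed_points N" "x \<noteq> z" "x \<noteq> - z"
  shows "(\<Sum>j\<in>lowering N \<sigma> x. node_count z (refl_swap x j \<circ> \<sigma>) x d (k - of_bool (j \<noteq> x)))
       = fresh_count z \<sigma> x (Suc d) k"
proof (cases "- x \<in> orbit \<sigma> x")
  case False
  obtain q where fr: "first_return \<sigma> x q" by (rule orbit_period_exists[OF s])
  note op = orbit_period[OF s fr]
  let ?f = "\<lambda>j. node_count z (refl_swap x j \<circ> \<sigma>) x d (k - of_bool (j \<noteq> x))"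
  have q0: "0 < q" using fr by (simp add: first_return_def)
  then obtain p where p: "q = Suc p" by (cases q) auto
  have f0: "?f x = paired_count (Suc p) d k"
    using False op(3) p by (simp add: node_count_def)
  have fi: "?f ((\<sigma> ^^ i) x) = paired_count i d (k - 1)" if i: "0 < i" "i < q" for i
  proof -
    have "(\<sigma> ^^ i) x \<noteq> x" using fr i by (simp add: first_return_def)
    then show ?thesis
      using cut_paired_orbit(2,3)[OF s x False i(1)] i op(3) by (simp add: node_count_def)
  qed
  have "(\<Sum>j\<in>lowering N \<sigma> x. ?f j) = (\<Sum>a<q. ?f ((\<sigma> ^^ a) x))"
    unfolding lowering_paired[OF s x False] op(1) sum.reindex[OF op(2)] by simp
  also have "\<dots> = ?f x + (\<Sum>a<p. ?f ((\<sigma> ^^ Suc a) x))"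
    unfolding p sum.lessThan_Suc_shift by simp
  also have "(\<Sum>a<p. ?f ((\<sigma> ^^ Suc a) x)) = (\<Sum>a<p. paired_count (Suc a) d (k - 1))"
    by (rule sum.cong[OF refl], rule fi) (simp_all add: p)
  also have "\<dots> = (\<Sum>i=1..p. paired_count i d (k - 1))"
    by (simp add: sum.atLeast1_atMost_eq)
  finally have total: "(\<Sum>j\<in>lowering N \<sigma> x. ?f j) = ?f x + (\<Sum>i=1..p. paired_count i d (k - 1))" .
  have fc: "fresh_count z \<sigma> x (Suc d) k = paired_count p (Suc d) k"
    using False op(3) p by (simp add: fresh_count_def)
  show ?thesis unfolding total f0 fc by (rule paired_count_Suc[symmetric])
next
  case True
  have nz: "x \<noteq> 0" "z \<noteq> 0" using hyp_nonzero x z by auto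
  obtain h where ht: "half_turn \<sigma> x h" by (rule orbit_half_period_exists[OF s nz(1) True])
  note hp = orbit_half_period[OF s nz(1) ht]
  note op = orbit_period[OF s hp(2)]
  have sz: "\<sigma> z = z \<or> \<sigma> z = - z" using conf True by (simp add: zero_confined_def)
  let ?f = "\<lambda>j. node_count z (refl_swap x j \<circ> \<sigma>) x d (k - of_bool (j \<noteq> x))"
  let ?m = "\<lambda>c. (if \<sigma> z = - z then 2 * c else (0::int))"
  obtain p where p: "h = Suc p" using ht by (cases h) (auto simp: half_turn_def)
  have f0: "?f x = zero_count h d k + ?m (merge_count h d k)"
    using True hp(4) by (simp add: node_count_def)
  have ne: "(\<sigma> ^^ i) x \<noteq> x" if "0 < i" "i < 2 * h" for i
    using hp(2) that by (simp add: first_return_def)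
  have f1: "?f ((\<sigma> ^^ i) x) = paired_count i d (k - 1)" if i: "0 < i" "i \<le> h" for i
    using cut_invariant_orbit_first_half(2,3)[OF s x ht i] ne[of i] i by (simp add: node_count_def)
  have f2: "?f ((\<sigma> ^^ (h + i)) x) = zero_count i d (k - 1) + ?m (merge_count i d (k - 1))"
    if i: "0 < i" "i < h" for i
    using cut_invariant_orbit_second_half(2,3)[OF s x ht i] ne[of "h + i"] i
      cut_invariant_orbit_second_half(4)[OF s x ht i conf z(2,3)]
    by (simp add: node_count_def)
  have f3: "?f j = paired_count (Suc h) d (k - 1)" if "j \<in> {z, - z}" "\<sigma> z = - z" for j
  proof -
    have sj: "j \<in> signed_points N" "\<sigma> j = - j" "x \<noteq> j" "x \<noteq> - j"
      using that z hyp_odd[OF s] by auto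
    then show ?thesis using merge_invariant_orbits(2,3)[OF s x ht sj] by (simp add: node_count_def)
  qed
  have zo: "{z, - z} \<inter> orbit \<sigma> x = {}" using pole_notin_orbit[OF s sz z(2,3)] by auto
  have "(\<Sum>j\<in>orbit \<sigma> x. ?f j) = (\<Sum>a<2 * h. ?f ((\<sigma> ^^ a) x))"
    unfolding op(1) sum.reindex[OF op(2)] by simp
  also have "\<dots> = (\<Sum>a<h. ?f ((\<sigma> ^^ a) x)) + (\<Sum>b<h. ?f ((\<sigma> ^^ (h + b)) x))"
    unfolding mult_2 by (rule sum_lessThan_add)
  also have "(\<Sum>a<h. ?f ((\<sigma> ^^ a) x)) = ?f x + (\<Sum>a<p. ?f ((\<sigma> ^^ Suc a) x))"
    unfolding p sum.lessThan_Suc_shift by simp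
  also have "(\<Sum>a<p. ?f ((\<sigma> ^^ Suc a) x)) = (\<Sum>a<p. paired_count (Suc a) d (k - 1))"
    by (rule sum.cong[OF refl], rule f1) (simp_all add: p)
  also have "(\<Sum>b<h. ?f ((\<sigma> ^^ (h + b)) x)) = ?f ((\<sigma> ^^ h) x) + (\<Sum>a<p. ?f ((\<sigma> ^^ (h + Suc a)) x))"
    unfolding p sum.lessThan_Suc_shift by simp
  also have "?f ((\<sigma> ^^ h) x) = paired_count h d (k - 1)"
    using f1[of h] p by simp
  also have "(\<Sum>a<p. ?f ((\<sigma> ^^ (h + Suc a)) x)) = (\<Sum>a<p. zero_count (Suc a) d (k - 1) + ?m (merge_count (Suc a) d (k - 1)))"
    by (rule sum.cong[OF refl], rule f2) (simp_all add: p)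
  finally have orb: "(\<Sum>j\<in>orbit \<sigma> x. ?f j) = ?f x
     + (\<Sum>a<p. paired_count (Suc a) d (k - 1)) + (paired_count h d (k - 1)
     + (\<Sum>a<p. zero_count (Suc a) d (k - 1) + ?m (merge_count (Suc a) d (k - 1))))" .
  have "(\<Sum>j\<in>lowering N \<sigma> x. ?f j) = (\<Sum>j\<in>orbit \<sigma> x. ?f j) + (\<Sum>j\<in>(if \<sigma> z = - z then {z, - z} else {}). ?f j)"
    unfolding lowering_invariant[OF s x True conf z]
    using zo by (intro sum.union_disjoint) (auto intro: finite_orbit self_mem_orbit[OF s] split: if_splits)
  also have "(\<Sum>j\<in>(if \<sigma> z = - z then {z, - z} else {}). ?f j) = ?m (paired_count (Suc h) d (k - 1))"
  proof (cases "\<sigma> z = - z")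
    case True
    then have "?f z = paired_count (Suc h) d (k - 1)" "?f (- z) = paired_count (Suc h) d (k - 1)"
      using f3 by blast+
    moreover have "(\<Sum>j\<in>{z, - z}. ?f j) = ?f z + ?f (- z)" using nz by simp
    ultimately show ?thesis using True by simp
  qed simp
  finally have total: "(\<Sum>j\<in>lowering N \<sigma> x. ?f j) = (\<Sum>j\<in>orbit \<sigma> x. ?f j) + ?m (paired_count (Suc h) d (k - 1))" .
  have fc: "fresh_count z \<sigma> x (Suc d) k = zero_count p (Suc d) k + ?m (merge_count p (Suc d) k)"
    using True hp(4) p by (simp add: fresh_count_def)
  show ?thesis
    unfolding total orb f0 fc zero_count_Suc merge_count_Suc p
    by (simp add: sum.atLeast1_atMost_eq sum.distrib algebra_simps sum_distrib_left)
qed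

lemma child_confined:
  assumes s: "\<sigma> \<in> hyperoctahedral N" and x: "x \<in> signed_points N"
    and conf: "zero_confined N z \<sigma> x" and z: "z \<in> signed_points N" "x \<noteq> z" "x \<noteq> - z"
    and j: "j \<in> lowering N \<sigma> x"
  shows "zero_confined N z (refl_swap x j \<circ> \<sigma>) x"
proof (cases "- x \<in> orbit \<sigma> x")
  case False
  obtain q where fr: "first_return \<sigma> x q" by (rule orbit_period_exists[OF s])
  note op = orbit_period[OF s fr]
  from j obtain i where i: "i < q" "j = (\<sigma> ^^ i) x" unfolding lowering_paired[OF s x False] op(1) by blast
  show ?thesis
    using cut_paired_orbit(3)[OF s x False, of i] op(3) i conf by (cases "i = 0") (auto simp: zero_confined_def)
next
  case True
  have nz: "x \<noteq> 0" "z \<noteq> 0" using hyp_nonzero x z by auto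
  obtain h where ht: "half_turn \<sigma> x h" by (rule orbit_half_period_exists[OF s nz(1) True])
  note hp = orbit_half_period[OF s nz(1) ht]
  note op = orbit_period[OF s hp(2)]
  show ?thesis
  proof (cases "j \<in> orbit \<sigma> x")
    case True
    then obtain a where a: "a < 2 * h" "j = (\<sigma> ^^ a) x" unfolding op(1) by blast
    consider "a = 0" | "0 < a" "a \<le> h" | "0 < a - h" "a - h < h" "a = h + (a - h)" using a by linarith
    then show ?thesis
    proof cases
      case 1 then show ?thesis using a conf by simp
    next
      case 2 then show ?thesis
        using cut_invariant_orbit_first_half(3)[OF s x ht 2] a(2) by (simp add: zero_confined_def)
    next
      case 3 then show ?thesis
        using cut_invariant_orbit_second_half(4)[OF s x ht 3(1,2) conf z(2,3)] a(2) by simp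
    qed
  next
    case False
    then have jz: "j = z \<or> j = - z" "\<sigma> z = - z"
      using j unfolding lowering_invariant[OF s x True conf z] by (auto split: if_splits)
    then have sj: "j \<in> signed_points N" "\<sigma> j = - j" "x \<noteq> j" "x \<noteq> - j"
      using z hyp_odd[OF s] by auto
    then show ?thesis using merge_invariant_orbits(3)[OF s x ht sj] by (simp add: zero_confined_def)
  qed
qed

lemma fresh_count_insert:
  assumes s: "\<sigma> \<in> hyperoctahedral N" and x: "x \<in> signed_points N" and w: "w \<in> signed_points N"
    and fx: "\<sigma> w = w" and ne: "w \<noteq> x" "w \<noteq> - x" and z: "z \<notin> {x, - x, w, - w}"
    and conf: "zero_confined N z \<sigma> x"
  shows "fresh_count z (\<sigma> \<circ> refl_swap w x) w d k = node_count z \<sigma> x d k"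
    and "zero_confined N z (\<sigma> \<circ> refl_swap w x) w"
  using insert_point[OF s x w fx ne] insert_point(3)[OF s x w fx ne conf z]
  by (cases "- x \<in> orbit \<sigma> x"; simp add: fresh_count_def node_count_def)+

section \<open>Growing the outer circle\<close>

text \<open>The two-cycle permutation whose outer circle is restricted to \<open>\<plusminus>1, \<dots>, \<plusminus>m\<close>. The point \<open>m + 1\<close> is inserted after
\<open>m\<close>; the first point is inserted by the sign change \<open>(1, -1)\<close>.\<close>

fun annulus_cycle :: "nat \<Rightarrow> nat \<Rightarrow> int \<Rightarrow> int" where
  "annulus_cycle n 0 = refl_swap (int n) (- int n)"
| "annulus_cycle n (Suc m) = annulus_cycle n m \<circ> refl_swap (int (Suc m)) (if m = 0 then - 1 else int m)"

text \<open>The elements below \<open>annulus_cycle n m\<close>, with lengths expressed by fixed dimensions. The support condition makes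
them elements of the smaller group.\<close>

definition partial_interval :: "nat \<Rightarrow> nat \<Rightarrow> (int \<Rightarrow> int) set" where
  "partial_interval n m = {\<tau> \<in> hyperoctahedral n.
     (\<forall>y. int m < \<bar>y\<bar> \<longrightarrow> \<bar>y\<bar> < int n \<longrightarrow> \<tau> y = y) \<and>
     fix_dim n \<tau> + fix_dim n (inv \<tau> \<circ> annulus_cycle n m) = n + fix_dim n (annulus_cycle n m)}"

lemma annulus_cycle_props:
  assumes "m < n"
  shows "annulus_cycle n m \<in> hyperoctahedral n \<and> (\<forall>y. int m < \<bar>y\<bar> \<longrightarrow> \<bar>y\<bar> < int n \<longrightarrow> annulus_cycle n m y = y)"
  using assms
proof (induction m)
  case 0
  have "annulus_cycle n 0 \<in> hyperoctahedral n"
    using 0 by (simp, intro refl_swap_hyp) (auto simp: mem_signed_points)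
  moreover have "annulus_cycle n 0 y = y" if "\<bar>y\<bar> < int n" for y
    unfolding annulus_cycle.simps by (rule refl_swap_other) (use that in auto)
  ultimately show ?case by blast
next
  case (Suc m)
  let ?r = "refl_swap (int (Suc m)) (if m = 0 then - 1 else int m)"
  have IH: "annulus_cycle n m \<in> hyperoctahedral n"
    "\<And>y. int m < \<bar>y\<bar> \<Longrightarrow> \<bar>y\<bar> < int n \<Longrightarrow> annulus_cycle n m y = y"
    using Suc by simp_all
  have "?r \<in> hyperoctahedral n"
    using Suc.prems by (intro refl_swap_hyp) (auto simp: mem_signed_points)
  then have "annulus_cycle n (Suc m) \<in> hyperoctahedral n"
    unfolding annulus_cycle.simps by (rule hyp_comp[OF IH(1)])
  moreover have "annulus_cycle n (Suc m) y = y" if "int (Suc m) < \<bar>y\<bar>" "\<bar>y\<bar> < int n" for y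
  proof -
    have "?r y = y" by (rule refl_swap_other) (use that in auto)
    then show ?thesis using IH(2)[of y] that by simp
  qed
  ultimately show ?case by blast
qed

lemma annulus_cycle_hyp: "m < n \<Longrightarrow> annulus_cycle n m \<in> hyperoctahedral n"
  and annulus_cycle_fix: "m < n \<Longrightarrow> int m < \<bar>y\<bar> \<Longrightarrow> \<bar>y\<bar> < int n \<Longrightarrow> annulus_cycle n m y = y"
  using annulus_cycle_props[of m n] by simp_all

lemma partial_interval_hyp: "\<tau> \<in> partial_interval n m \<Longrightarrow> \<tau> \<in> hyperoctahedral n"
  by (simp add: partial_interval_def)

lemma finite_hyperoctahedral: "finite (hyperoctahedral N)"
proof (rule finite_subset)
  show "hyperoctahedral N \<subseteq> {p. p permutes signed_points N}" using hyp_permutes by blast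
  show "finite {p. p permutes signed_points N}" by (rule finite_permutations) simp
qed

lemma finite_partial_interval [simp]: "finite (partial_interval n m)"
  by (rule finite_subset[OF _ finite_hyperoctahedral[of n]]) (use partial_interval_hyp in blast)

text \<open>The Kreweras complement, taken one level ahead: the reflections that lower it lead to the children of \<open>\<tau>\<close>.\<close>

definition fresh_complement :: "nat \<Rightarrow> nat \<Rightarrow> (int \<Rightarrow> int) \<Rightarrow> int \<Rightarrow> int" where
  "fresh_complement n m \<tau> = inv \<tau> \<circ> annulus_cycle n (Suc m)"

lemma fresh_complement_facts:
  assumes m: "Suc m < n" and t: "\<tau> \<in> hyperoctahedral n"
    and fx: "\<tau> (int (Suc m)) = int (Suc m)"
  shows "fresh_complement n m \<tau> \<in> hyperoctahedral n"
    and "fresh_complement n m \<tau> = (inv \<tau> \<circ> annulus_cycle n m) \<circ> refl_swap (int (Suc m)) (if m = 0 then - 1 else int m)"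
    and "(inv \<tau> \<circ> annulus_cycle n m) (int (Suc m)) = int (Suc m)"
    and "fix_dim n (inv \<tau> \<circ> annulus_cycle n m) = fix_dim n (fresh_complement n m \<tau>) + 1"
proof -
  let ?w = "int (Suc m)" and ?y = "if m = 0 then - 1 else int m"
  have S: "?w \<in> signed_points n" "?y \<in> signed_points n" "?w \<noteq> ?y" using m by (auto simp: mem_signed_points)
  show "fresh_complement n m \<tau> \<in> hyperoctahedral n"
    unfolding fresh_complement_def by (intro hyp_comp hyp_inv t annulus_cycle_hyp m)
  show eq: "fresh_complement n m \<tau> = (inv \<tau> \<circ> annulus_cycle n m) \<circ> refl_swap ?w ?y"
    unfolding fresh_complement_def annulus_cycle.simps comp_assoc ..
  have h: "inv \<tau> \<circ> annulus_cycle n m \<in> hyperoctahedral n"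
    using m by (intro hyp_comp hyp_inv t annulus_cycle_hyp) simp
  have "inv \<tau> ?w = ?w" using hyp_inv_comp(1)[OF t, of ?w] fx by simp
  then show fw: "(inv \<tau> \<circ> annulus_cycle n m) ?w = ?w"
    using annulus_cycle_fix[of m n ?w] m by simp
  show "fix_dim n (inv \<tau> \<circ> annulus_cycle n m) = fix_dim n (fresh_complement n m \<tau>) + 1"
    unfolding eq by (rule fix_dim_comp_refl[OF h S(1,2) fw S(3)])
qed

lemma fix_dim_annulus_cycle: "m < n \<Longrightarrow> fix_dim n (annulus_cycle n m) + Suc m = n"
proof (induction m)
  case 0
  have "fix_dim n id = fix_dim n (id \<circ> refl_swap (int n) (- int n)) + 1"
    using 0 by (intro fix_dim_comp_refl hyp_id) (auto simp: mem_signed_points)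
  then show ?case by (simp add: fix_dim_id)
next
  case (Suc m)
  have "fix_dim n (inv id \<circ> annulus_cycle n m) = fix_dim n (fresh_complement n m id) + 1"
    by (rule fresh_complement_facts(4)[OF Suc.prems hyp_id]) simp
  moreover have "inv id \<circ> annulus_cycle n m = annulus_cycle n m"
    and "fresh_complement n m id = annulus_cycle n (Suc m)"
    by (simp_all only: fresh_complement_def inv_id id_comp)
  ultimately have "fix_dim n (annulus_cycle n m) = fix_dim n (annulus_cycle n (Suc m)) + 1"
    by (simp only:)
  moreover have "fix_dim n (annulus_cycle n m) + Suc m = n"
    by (rule Suc.IH) (use Suc.prems in simp)
  ultimately show ?case by linarith
qed

lemma partial_interval_fixes:
  "\<tau> \<in> partial_interval n m \<Longrightarrow> int m < \<bar>y\<bar> \<Longrightarrow> \<bar>y\<bar> < int n \<Longrightarrow> \<tau> y = y"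
  by (simp add: partial_interval_def)

lemma partial_interval_fresh_iff:
  assumes m: "Suc m < n" and t: "\<tau> \<in> hyperoctahedral n"
    and sup: "\<And>y. int m < \<bar>y\<bar> \<Longrightarrow> \<bar>y\<bar> < int n \<Longrightarrow> \<tau> y = y"
  shows "\<tau> \<in> partial_interval n m \<longleftrightarrow>
     fix_dim n \<tau> + fix_dim n (fresh_complement n m \<tau>) = n + fix_dim n (annulus_cycle n (Suc m))"
proof -
  have "\<tau> (int (Suc m)) = int (Suc m)" using m by (intro sup) auto
  note fc = fresh_complement_facts(4)[OF m t this]
  show ?thesis
    using fc fix_dim_annulus_cycle[of m n] fix_dim_annulus_cycle[of "Suc m" n] m t sup
    by (auto simp: partial_interval_def)
qed

text \<open>Points that are still to be inserted are fixed by the complement, and a reflection exchanging the new point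
with one of them would increase the length.\<close>

lemma annulus_moved_points:
  assumes m: "Suc m < n" and t: "\<tau> \<in> partial_interval n m"
    and j: "j \<in> lowering n (fresh_complement n m \<tau>) (int (Suc m))"
  shows "\<not> (int (Suc m) < \<bar>j\<bar> \<and> \<bar>j\<bar> < int n)"
proof
  assume jb: "int (Suc m) < \<bar>j\<bar> \<and> \<bar>j\<bar> < int n"
  let ?s = "fresh_complement n m \<tau>" and ?x = "int (Suc m)"
  have th: "\<tau> \<in> hyperoctahedral n" by (rule partial_interval_hyp[OF t])
  have "\<tau> ?x = ?x" using m by (intro partial_interval_fixes[OF t]) auto
  note s = fresh_complement_facts(1)[OF m th this]
  have x: "?x \<in> signed_points n" using m by (simp add: mem_signed_points)
  have "\<tau> j = j" using jb by (intro partial_interval_fixes[OF t]) auto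
  then have "inv \<tau> j = j" using hyp_inv_comp(1)[OF th, of j] by simp
  then have sj: "?s j = j"
    using annulus_cycle_fix[of "Suc m" n j] m jb by (simp add: fresh_complement_def)
  have "j \<notin> orbit ?s ?x" using fixed_point_orbit_singleton(1)[OF s sj, of ?x] jb by auto
  moreover have "- j \<notin> orbit ?s j"
  proof (rule fixed_point_orbit_singleton(2)[OF s sj])
    show "j \<noteq> 0" using jb by auto
  qed
  ultimately show False using lowering_cases[OF s x j] by blast
qed

lemma inv_comp_refl:
  assumes t: "\<tau> \<in> hyperoctahedral n" and "x \<noteq> 0" "j \<noteq> 0"
  shows "inv (\<tau> \<circ> refl_swap x j) \<circ> \<gamma> = refl_swap x j \<circ> (inv \<tau> \<circ> \<gamma>)"
proof -
  have "bij (refl_swap x j)" using assms(2,3) by (intro involuntory_imp_bij) (simp add: refl_swap_invol)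
  then have "inv (\<tau> \<circ> refl_swap x j) = refl_swap x j \<circ> inv \<tau>"
    by (simp only: o_inv_distrib[OF hyp_bij[OF t]] refl_swap_inv[OF assms(2,3)])
  then show ?thesis by (simp add: comp_assoc)
qed

text \<open>The coset decomposition of the larger group by the stabilizer of the new point \<open>x\<close>: \<open>j\<close> is the preimage
of \<open>x\<close>. Multiplying by a nontrivial reflection costs exactly one unit of length on the left factor, so
subadditivity forces the parent to be in the smaller interval and the reflection to lower its complement.\<close>

lemma partial_interval_step:
  assumes m: "Suc m < n"
  shows "bij_betw (\<lambda>(\<tau>, j). \<tau> \<circ> refl_swap (int (Suc m)) j)
     (SIGMA \<tau>:partial_interval n m. lowering n (fresh_complement n m \<tau>) (int (Suc m)))
     (partial_interval n (Suc m))"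
    (is "bij_betw ?F ?A ?B")
proof (rule bij_betw_byWitness[where f' = "\<lambda>\<tau>. (\<tau> \<circ> refl_swap (int (Suc m)) (inv \<tau> (int (Suc m))), inv \<tau> (int (Suc m)))"])
  let ?x = "int (Suc m)"
  let ?G = "\<lambda>\<tau>. (\<tau> \<circ> refl_swap ?x (inv \<tau> ?x), inv \<tau> ?x)"
  have x: "?x \<in> signed_points n" using m by (simp add: mem_signed_points)
  have xn: "?x \<noteq> 0" by simp
  have fwd: "inv (\<tau> \<circ> refl_swap ?x j) ?x = j" if "\<tau> \<in> hyperoctahedral n" "\<tau> ?x = ?x" "j \<in> signed_points n" for \<tau> j
  proof -
    have "(\<tau> \<circ> refl_swap ?x j) j = ?x" using that hyp_nonzero[OF that(3)] by (simp add: refl_swap_right)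
    then show ?thesis using hyp_inv_comp(1)[OF hyp_comp[OF that(1) refl_swap_hyp[OF x that(3)]], of j] by simp
  qed
  have cancel: "\<tau> \<circ> refl_swap ?x j \<circ> refl_swap ?x j = \<tau>" if "j \<in> signed_points n" for \<tau> :: "int \<Rightarrow> int" and j
    using hyp_nonzero[OF that] by (simp add: fun_eq_iff refl_swap_invol)
  have A: "\<tau> \<in> hyperoctahedral n" "\<tau> ?x = ?x" "j \<in> signed_points n" if "(\<tau>, j) \<in> ?A" for \<tau> j
  proof -
    have t: "\<tau> \<in> partial_interval n m" and j: "j \<in> lowering n (fresh_complement n m \<tau>) ?x"
      using that by auto
    show "\<tau> \<in> hyperoctahedral n" by (rule partial_interval_hyp[OF t])
    show "\<tau> ?x = ?x" using m by (intro partial_interval_fixes[OF t]) auto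
    show "j \<in> signed_points n" using lowering_subset j by blast
  qed
  show "\<forall>a\<in>?A. ?G (?F a) = a"
  proof
    fix a assume a: "a \<in> ?A"
    obtain \<tau> j where tj: "a = (\<tau>, j)" by (cases a)
    note A' = A[OF a[unfolded tj]]
    show "?G (?F a) = a" unfolding tj prod.case fwd[OF A'] cancel[OF A'(3)] ..
  qed
  have Bj: "inv \<tau> ?x \<in> signed_points n" if "\<tau> \<in> ?B" for \<tau>
    using hyp_mem_iff[OF hyp_inv[OF partial_interval_hyp[OF that]]] x by simp
  show "\<forall>b\<in>?B. ?F (?G b) = b"
    using cancel[OF Bj] by simp
  show "?F ` ?A \<subseteq> ?B"
  proof (rule image_subsetI)
    fix a assume a: "a \<in> ?A"
    obtain \<tau> j where tj: "a = (\<tau>, j)" by (cases a)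
    have t: "\<tau> \<in> partial_interval n m" and j: "j \<in> lowering n (fresh_complement n m \<tau>) ?x"
      using a tj by auto
    note A' = A[OF a[unfolded tj]]
    have jn: "j \<noteq> 0" using hyp_nonzero A' by blast
    have th: "\<tau> \<circ> refl_swap ?x j \<in> hyperoctahedral n" by (rule hyp_comp[OF A'(1) refl_swap_hyp[OF x A'(3)]])
    have comp: "inv (\<tau> \<circ> refl_swap ?x j) \<circ> annulus_cycle n (Suc m) = refl_swap ?x j \<circ> fresh_complement n m \<tau>"
      unfolding fresh_complement_def by (rule inv_comp_refl[OF A'(1) xn jn])
    have sum: "fix_dim n \<tau> + fix_dim n (fresh_complement n m \<tau>) = n + fix_dim n (annulus_cycle n (Suc m))"
      using partial_interval_fresh_iff[OF m A'(1)] partial_interval_fixes[OF t] t by blast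
    have "fix_dim n (\<tau> \<circ> refl_swap ?x j) + fix_dim n (refl_swap ?x j \<circ> fresh_complement n m \<tau>)
        = n + fix_dim n (annulus_cycle n (Suc m))"
    proof (cases "j = ?x")
      case True then show ?thesis using sum by simp
    next
      case False
      then show ?thesis
        using fix_dim_comp_refl[OF A'(1) x A'(3) A'(2)] j sum by (simp add: lowering_def)
    qed
    moreover have "(\<tau> \<circ> refl_swap ?x j) y = y" if y: "int (Suc m) < \<bar>y\<bar>" "\<bar>y\<bar> < int n" for y
    proof -
      have "refl_swap ?x j y = y" using annulus_moved_points[OF m t j] y by (intro refl_swap_other) auto
      then show ?thesis using partial_interval_fixes[OF t, of y] y by simp
    qed
    ultimately show "?F a \<in> ?B" using th comp by (simp add: tj partial_interval_def)
  qed
  show "?G ` ?B \<subseteq> ?A"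
  proof (rule image_subsetI)
    fix \<tau> assume t: "\<tau> \<in> ?B"
    define j where "j = inv \<tau> ?x"
    define \<tau>' where "\<tau>' = \<tau> \<circ> refl_swap ?x j"
    have th: "\<tau> \<in> hyperoctahedral n" by (rule partial_interval_hyp[OF t])
    have j: "j \<in> signed_points n" unfolding j_def by (rule Bj[OF t])
    have jn: "j \<noteq> 0" by (rule hyp_nonzero[OF j])
    have tj: "\<tau> j = ?x" unfolding j_def using hyp_inv_comp(2)[OF th] .
    have t': "\<tau>' \<in> hyperoctahedral n" unfolding \<tau>'_def by (rule hyp_comp[OF th refl_swap_hyp[OF x j]])
    have tx: "\<tau>' ?x = ?x" by (simp add: \<tau>'_def tj)
    have split: "\<tau> = \<tau>' \<circ> refl_swap ?x j" unfolding \<tau>'_def cancel[OF j] ..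
    have jout: "\<not> (int (Suc m) < \<bar>j\<bar> \<and> \<bar>j\<bar> < int n)"
      using partial_interval_fixes[OF t, of j] tj by auto
    have supp: "\<tau>' y = y" if y: "int m < \<bar>y\<bar>" "\<bar>y\<bar> < int n" for y
    proof (cases "\<bar>y\<bar> = ?x")
      case True
      then have "y = ?x \<or> y = - ?x" by linarith
      then show ?thesis using tx hyp_odd[OF t', of ?x] by auto
    next
      case False
      then have yb: "int (Suc m) < \<bar>y\<bar>" using y by simp
      then have "refl_swap ?x j y = y" using jout y by (intro refl_swap_other) auto
      then show ?thesis using partial_interval_fixes[OF t yb y(2)] by (simp add: \<tau>'_def)
    qed
    let ?s = "fresh_complement n m \<tau>'"
    note fc = fresh_complement_facts[OF m t' tx]
    have comp: "inv \<tau> \<circ> annulus_cycle n (Suc m) = refl_swap ?x j \<circ> ?s"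
      unfolding split fresh_complement_def by (rule inv_comp_refl[OF t' xn jn])
    have sum: "fix_dim n \<tau> + fix_dim n (refl_swap ?x j \<circ> ?s) = n + fix_dim n (annulus_cycle n (Suc m))"
      using t unfolding comp[symmetric] by (simp add: partial_interval_def)
    have "\<tau>' \<circ> ?s = annulus_cycle n (Suc m)"
      using hyp_inv_comp(2)[OF t'] by (simp add: fresh_complement_def fun_eq_iff)
    then have tri: "fix_dim n \<tau>' + fix_dim n ?s \<le> n + fix_dim n (annulus_cycle n (Suc m))"
      using fix_dim_comp[OF t' fc(1)] by simp
    have "j \<in> lowering n ?s ?x \<and> fix_dim n \<tau>' + fix_dim n ?s = n + fix_dim n (annulus_cycle n (Suc m))"
    proof (cases "j = ?x")
      case True
      then show ?thesis using sum x split by (simp add: lowering_def)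
    next
      case False
      then have "fix_dim n \<tau>' = fix_dim n \<tau> + 1"
        using fix_dim_comp_refl[OF t' x j tx] unfolding split[symmetric] by simp
      then show ?thesis
        using sum tri fix_dim_refl_comp_le[OF fc(1) x j] j by (simp add: lowering_def)
    qed
    then have "j \<in> lowering n ?s ?x" "\<tau>' \<in> partial_interval n m"
      using partial_interval_fresh_iff[OF m t' supp] by auto
    then show "?G \<tau> \<in> ?A"
      unfolding j_def[symmetric] \<tau>'_def[symmetric] by blast
  qed
qed

section \<open>Counting by descent through the insertion tree\<close>

lemma partial_interval_0:
  assumes n: "n \<ge> 2"
  shows "partial_interval n 0 = {id, refl_swap (int n) (- int n)}"
proof -
  let ?r = "refl_swap (int n) (- int n)"
  have nS: "int n \<in> signed_points n" "- int n \<in> signed_points n" using n by (auto simp: mem_signed_points)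
  have nz: "int n \<noteq> 0" "- int n \<noteq> 0" using n by auto
  have rh: "?r \<in> hyperoctahedral n" by (rule refl_swap_hyp[OF nS])
  have rr: "inv ?r \<circ> ?r = id" by (rule ext) (simp only: refl_swap_inv[OF nz] o_apply id_apply refl_swap_invol[OF nz])
  have "\<tau> = id \<or> \<tau> = ?r" if t: "\<tau> \<in> partial_interval n 0" for \<tau>
  proof -
    have th: "\<tau> \<in> hyperoctahedral n" by (rule partial_interval_hyp[OF t])
    have fx: "\<tau> y = y" if "y \<notin> {int n, - int n}" for y
    proof (cases "y \<in> signed_points n")
      case True
      then show ?thesis using that by (intro partial_interval_fixes[OF t]) (auto simp: mem_signed_points)
    next
      case False
      then show ?thesis by (rule hyp_outside[OF th])
    qed
    have "\<tau> (int n) \<in> {int n, - int n}"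
    proof (rule ccontr)
      assume a: "\<tau> (int n) \<notin> {int n, - int n}"
      then have "\<tau> (\<tau> (int n)) = \<tau> (int n)" by (rule fx)
      then have "\<tau> (int n) = int n" by (simp only: hyp_inj[OF th])
      with a show False by simp
    qed
    then consider "\<tau> (int n) = int n" | "\<tau> (int n) = - int n" by blast
    then show ?thesis
    proof cases
      case 1
      then have "\<tau> (- int n) = - int n" using hyp_odd[OF th] by simp
      with 1 have "\<tau> y = id y" for y using fx[of y] by (cases "y \<in> {int n, - int n}") auto
      then show ?thesis by blast
    next
      case 2
      then have "\<tau> (- int n) = int n" using hyp_odd[OF th] by simp
      with 2 have "\<tau> y = ?r y" for y using fx[of y] by (cases "y \<in> {int n, - int n}") (auto simp: refl_swap_def)
      then show ?thesis by blast
    qed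
  qed
  moreover have "id \<in> partial_interval n 0"
    by (simp add: partial_interval_def hyp_id fix_dim_id)
  moreover have "?r y = y" if "\<bar>y\<bar> < int n" for y using that by (intro refl_swap_other) auto
  then have "?r \<in> partial_interval n 0"
    by (simp add: partial_interval_def rh rr fix_dim_id)
  ultimately show ?thesis by blast
qed

lemma root_fresh:
  assumes s: "\<sigma> \<in> hyperoctahedral n" and n: "n \<ge> 2" and s1: "\<sigma> 1 = - 1"
    and sn: "\<sigma> (int n) = int n \<or> \<sigma> (int n) = - int n"
    and fx: "\<And>y. 1 < \<bar>y\<bar> \<Longrightarrow> \<bar>y\<bar> < int n \<Longrightarrow> \<sigma> y = y"
  shows "zero_confined n (int n) \<sigma> 1"
    and "fresh_count (int n) \<sigma> 1 d k
       = zero_count 0 d k + (if \<sigma> (int n) = - int n then 2 * merge_count 0 d k else 0)"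
proof -
  have "half_turn \<sigma> 1 1" using s1 by (simp add: half_turn_def)
  note hp = orbit_half_period[OF s one_neq_zero this]
  show "fresh_count (int n) \<sigma> 1 d k
       = zero_count 0 d k + (if \<sigma> (int n) = - int n then 2 * merge_count 0 d k else 0)"
    using hp(3,4) by (simp add: fresh_count_def)
  have "y \<in> orbit \<sigma> 1 \<union> {int n, - int n}" if y: "y \<in> signed_points n" "- y \<in> orbit \<sigma> y" for y
  proof (cases "1 < \<bar>y\<bar> \<and> \<bar>y\<bar> < int n")
    case True
    then have "\<sigma> y = y" using fx by blast
    then show ?thesis using fixed_point_orbit_singleton(2)[OF s _ hyp_nonzero[OF y(1)]] y(2) by blast
  next
    case False
    then have "y = 1 \<or> y = - 1 \<or> y = int n \<or> y = - int n" using y(1) by (auto simp: mem_signed_points)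
    then show ?thesis using hp(3) self_mem_orbit[OF s, of 1] by auto
  qed
  then show "zero_confined n (int n) \<sigma> 1" using sn by (simp add: zero_confined_def)
qed

lemma fresh_complement_root:
  assumes n: "n \<ge> 2" and t: "\<tau> \<in> partial_interval n 0"
  shows "zero_confined n (int n) (fresh_complement n 0 \<tau>) 1"
    and "fresh_count (int n) (fresh_complement n 0 \<tau>) 1 d k
       = zero_count 0 d k + (if \<tau> = id then 2 * merge_count 0 d k else 0)"
proof -
  let ?r = "refl_swap (int n) (- int n)" and ?s = "fresh_complement n 0 \<tau>"
  have nz: "int n \<noteq> 0" "- int n \<noteq> 0" using n by auto
  have th: "\<tau> \<in> hyperoctahedral n" by (rule partial_interval_hyp[OF t])
  have m: "Suc 0 < n" using n by simp
  have "\<tau> (int (Suc 0)) = int (Suc 0)" using m by (intro partial_interval_fixes[OF t]) auto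
  note sh = fresh_complement_facts(1)[OF m th this]
  have rid: "?r \<noteq> id" using n by (auto simp: fun_eq_iff refl_swap_def intro!: exI[of _ "int n"])
  have ap: "?s y = inv \<tau> (?r (refl_swap 1 (- 1) y))" for y by (simp add: fresh_complement_def)
  have r1: "?r 1 = 1" "?r (- 1) = - 1" using n by (auto simp: refl_swap_def)
  have rn: "?r (int n) = - int n" "?r (- int n) = int n" using n by (auto simp: refl_swap_def)
  have r1n: "refl_swap 1 (- 1) (int n) = int n" "refl_swap 1 (- 1) (1::int) = - 1" using n by (auto simp: refl_swap_def)
  have ro: "?r y = y" "refl_swap 1 (- 1) y = y" if "1 < \<bar>y\<bar>" "\<bar>y\<bar> < int n" for y
    using that by (auto simp: refl_swap_def)
  have "?s 1 = - 1 \<and> ?s (int n) = (if \<tau> = id then - int n else int n) \<and>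
    (\<forall>y. 1 < \<bar>y\<bar> \<longrightarrow> \<bar>y\<bar> < int n \<longrightarrow> ?s y = y)"
  proof (cases "\<tau> = id")
    case True
    then show ?thesis unfolding ap using r1 rn r1n ro by simp
  next
    case False
    then have "\<tau> = ?r" using t partial_interval_0[OF n] by blast
    then have "inv \<tau> = ?r" using refl_swap_inv[OF nz] by simp
    then show ?thesis unfolding ap using r1 rn r1n ro False by simp
  qed
  note sf = this
  have s1: "?s 1 = - 1" using sf by blast
  have sn: "?s (int n) = int n \<or> ?s (int n) = - int n" using sf by auto
  have fx: "?s y = y" if "1 < \<bar>y\<bar>" "\<bar>y\<bar> < int n" for y using sf that by blast
  show "zero_confined n (int n) ?s 1" by (rule root_fresh(1)[OF sh n s1 sn fx])
  have "(?s (int n) = - int n) = (\<tau> = id)" using sf n by auto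
  moreover have "fresh_count (int n) ?s 1 d k
       = zero_count 0 d k + (if ?s (int n) = - int n then 2 * merge_count 0 d k else 0)"
    by (rule root_fresh(2)[OF sh n s1 sn fx])
  ultimately show "fresh_count (int n) ?s 1 d k
       = zero_count 0 d k + (if \<tau> = id then 2 * merge_count 0 d k else 0)" by (simp only:)
qed

definition kreweras :: "nat \<Rightarrow> nat \<Rightarrow> (int \<Rightarrow> int) \<Rightarrow> int \<Rightarrow> int" where
  "kreweras n m \<tau> = inv \<tau> \<circ> annulus_cycle n m"

lemma node_child:
  assumes t: "\<tau> \<in> hyperoctahedral n" and j: "j \<noteq> 0"
  shows "kreweras n (Suc m) (\<tau> \<circ> refl_swap (int (Suc m)) j) = refl_swap (int (Suc m)) j \<circ> fresh_complement n m \<tau>"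
  unfolding kreweras_def fresh_complement_def by (rule inv_comp_refl[OF t _ j]) simp

lemma partial_interval_step_facts:
  assumes m: "Suc m < n" and t: "\<tau> \<in> partial_interval n m"
  shows "\<tau> \<in> hyperoctahedral n" "\<tau> (int (Suc m)) = int (Suc m)"
    "int (Suc m) \<in> signed_points n" "int n \<in> signed_points n" "int (Suc m) \<noteq> int n" "int (Suc m) \<noteq> - int n"
    "fresh_complement n m \<tau> \<in> hyperoctahedral n"
proof -
  show th: "\<tau> \<in> hyperoctahedral n" by (rule partial_interval_hyp[OF t])
  show fx: "\<tau> (int (Suc m)) = int (Suc m)" using m by (intro partial_interval_fixes[OF t]) auto
  show "fresh_complement n m \<tau> \<in> hyperoctahedral n" by (rule fresh_complement_facts(1)[OF m th fx])
qed (use m in \<open>auto simp: mem_signed_points\<close>)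

lemma partial_interval_SucE:
  assumes m: "Suc m < n" and t: "\<tau> \<in> partial_interval n (Suc m)"
  obtains \<tau>' j where "\<tau>' \<in> partial_interval n m" "j \<in> lowering n (fresh_complement n m \<tau>') (int (Suc m))"
    "\<tau> = \<tau>' \<circ> refl_swap (int (Suc m)) j"
proof -
  have "\<tau> \<in> (\<lambda>(\<tau>, j). \<tau> \<circ> refl_swap (int (Suc m)) j) `
     (SIGMA \<tau>:partial_interval n m. lowering n (fresh_complement n m \<tau>) (int (Suc m)))"
    using partial_interval_step[OF m] t by (simp only: bij_betw_def)
  then show thesis using that by auto
qed

lemma node_confined_if_fresh_confined:
  assumes m: "Suc m < n"
    and IH: "\<And>\<tau>. \<tau> \<in> partial_interval n m \<Longrightarrow> zero_confined n (int n) (fresh_complement n m \<tau>) (int (Suc m))"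
    and t: "\<tau> \<in> partial_interval n (Suc m)"
  shows "zero_confined n (int n) (kreweras n (Suc m) \<tau>) (int (Suc m))"
proof -
  obtain \<tau>' j where t': "\<tau>' \<in> partial_interval n m" and j: "j \<in> lowering n (fresh_complement n m \<tau>') (int (Suc m))"
    and eq: "\<tau> = \<tau>' \<circ> refl_swap (int (Suc m)) j"
    by (rule partial_interval_SucE[OF m t])
  note f = partial_interval_step_facts[OF m t']
  have jn: "j \<noteq> 0" using j lowering_subset hyp_nonzero by blast
  show ?thesis
    unfolding eq node_child[OF f(1) jn]
    by (rule child_confined[OF f(7,3) IH[OF t'] f(4-6) j])
qed

lemma fresh_from_node:
  assumes m: "Suc (Suc m) < n" and t: "\<tau> \<in> partial_interval n (Suc m)"
    and conf: "zero_confined n (int n) (kreweras n (Suc m) \<tau>) (int (Suc m))"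
  shows "zero_confined n (int n) (fresh_complement n (Suc m) \<tau>) (int (Suc (Suc m)))"
    and "fresh_count (int n) (fresh_complement n (Suc m) \<tau>) (int (Suc (Suc m))) d k
       = node_count (int n) (kreweras n (Suc m) \<tau>) (int (Suc m)) d k"
proof -
  note f = partial_interval_step_facts[OF m t]
  have x: "int (Suc m) \<in> signed_points n" using m by (simp add: mem_signed_points)
  have nh: "kreweras n (Suc m) \<tau> \<in> hyperoctahedral n"
    unfolding kreweras_def using m by (intro hyp_comp hyp_inv f(1) annulus_cycle_hyp) simp
  note ff = fresh_complement_facts[OF m f(1,2)]
  have eq: "fresh_complement n (Suc m) \<tau> = kreweras n (Suc m) \<tau> \<circ> refl_swap (int (Suc (Suc m))) (int (Suc m))"
    using ff(2) unfolding kreweras_def by simp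
  have fx: "kreweras n (Suc m) \<tau> (int (Suc (Suc m))) = int (Suc (Suc m))"
    using ff(3) unfolding kreweras_def .
  have ne: "int (Suc (Suc m)) \<noteq> int (Suc m)" "int (Suc (Suc m)) \<noteq> - int (Suc m)"
    "int n \<notin> {int (Suc m), - int (Suc m), int (Suc (Suc m)), - int (Suc (Suc m))}" using m by auto
  note fi = fresh_count_insert[OF nh x f(3) fx ne conf]
  show "zero_confined n (int n) (fresh_complement n (Suc m) \<tau>) (int (Suc (Suc m)))"
    unfolding eq by (rule fi(2))
  show "fresh_count (int n) (fresh_complement n (Suc m) \<tau>) (int (Suc (Suc m))) d k
       = node_count (int n) (kreweras n (Suc m) \<tau>) (int (Suc m)) d k"
    unfolding eq by (rule fi(1))
qed

lemma fresh_confined: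
  assumes "Suc m < n" "\<tau> \<in> partial_interval n m"
  shows "zero_confined n (int n) (fresh_complement n m \<tau>) (int (Suc m))"
  using assms
proof (induction m arbitrary: \<tau>)
  case 0
  then show ?case using fresh_complement_root(1)[of n \<tau>] by simp
next
  case (Suc m)
  have m: "Suc m < n" using Suc.prems by simp
  show ?case
    by (rule fresh_from_node(1)[OF Suc.prems node_confined_if_fresh_confined[OF m Suc.IH[OF m] Suc.prems(2)]])
qed

lemma node_confined:
  assumes "Suc m < n" "\<tau> \<in> partial_interval n (Suc m)"
  shows "zero_confined n (int n) (kreweras n (Suc m) \<tau>) (int (Suc m))"
  by (rule node_confined_if_fresh_confined[OF assms(1) fresh_confined[OF assms(1)] assms(2)])

definition refl_rank :: "nat \<Rightarrow> (int \<Rightarrow> int) \<Rightarrow> int" where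
  "refl_rank n \<tau> = int n - int (fix_dim n \<tau>)"

lemma refl_rank_child:
  assumes m: "Suc m < n" and t: "\<tau> \<in> partial_interval n m"
    and j: "j \<in> signed_points n"
  shows "refl_rank n (\<tau> \<circ> refl_swap (int (Suc m)) j) = refl_rank n \<tau> + of_bool (j \<noteq> int (Suc m))"
proof (cases "j = int (Suc m)")
  case False
  note f = partial_interval_step_facts[OF m t]
  have "fix_dim n \<tau> = fix_dim n (\<tau> \<circ> refl_swap (int (Suc m)) j) + 1"
    by (rule fix_dim_comp_refl[OF f(1,3) j f(2)]) (use False in simp)
  then show ?thesis using False by (simp add: refl_rank_def)
qed simp

definition node_sum :: "nat \<Rightarrow> nat \<Rightarrow> nat \<Rightarrow> int \<Rightarrow> int" where
  "node_sum n m d k = (\<Sum>\<tau>\<in>partial_interval n m. node_count (int n) (kreweras n m \<tau>) (int m) d (k - refl_rank n \<tau>))"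

definition fresh_sum :: "nat \<Rightarrow> nat \<Rightarrow> nat \<Rightarrow> int \<Rightarrow> int" where
  "fresh_sum n m d k = (\<Sum>\<tau>\<in>partial_interval n m.
     fresh_count (int n) (fresh_complement n m \<tau>) (int (Suc m)) d (k - refl_rank n \<tau>))"

lemma node_sum_eq_fresh_sum:
  assumes m: "Suc m < n"
  shows "node_sum n (Suc m) d k = fresh_sum n m (Suc d) k"
proof -
  let ?x = "int (Suc m)"
  let ?L = "\<lambda>\<tau>. lowering n (fresh_complement n m \<tau>) ?x"
  let ?h = "\<lambda>\<tau>. node_count (int n) (kreweras n (Suc m) \<tau>) ?x d (k - refl_rank n \<tau>)"
  have finL: "finite (?L \<tau>)" for \<tau> by (rule finite_subset[OF lowering_subset]) simp
  have "node_sum n (Suc m) d k = (\<Sum>(\<tau>, j)\<in>(SIGMA \<tau>:partial_interval n m. ?L \<tau>). ?h (\<tau> \<circ> refl_swap ?x j))"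
    unfolding node_sum_def sum.reindex_bij_betw[OF partial_interval_step[OF m], symmetric]
    by (rule sum.cong[OF refl]) (simp only: case_prod_unfold)
  also have "\<dots> = (\<Sum>\<tau>\<in>partial_interval n m. \<Sum>j\<in>?L \<tau>. ?h (\<tau> \<circ> refl_swap ?x j))"
    by (rule sum.Sigma[symmetric]) (use finL in auto)
  also have "\<dots> = fresh_sum n m (Suc d) k"
    unfolding fresh_sum_def
  proof (rule sum.cong[OF refl])
    fix \<tau> assume t: "\<tau> \<in> partial_interval n m"
    note f = partial_interval_step_facts[OF m t]
    let ?s = "fresh_complement n m \<tau>"
    have "(\<Sum>j\<in>?L \<tau>. ?h (\<tau> \<circ> refl_swap ?x j))
        = (\<Sum>j\<in>?L \<tau>. node_count (int n) (refl_swap ?x j \<circ> ?s) ?x d ((k - refl_rank n \<tau>) - of_bool (j \<noteq> ?x)))"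
    proof (rule sum.cong[OF refl])
      fix j assume "j \<in> ?L \<tau>"
      then have j: "j \<in> signed_points n" using lowering_subset by blast
      have "k - refl_rank n (\<tau> \<circ> refl_swap ?x j) = (k - refl_rank n \<tau>) - of_bool (j \<noteq> ?x)"
        unfolding refl_rank_child[OF m t j] by simp
      then show "?h (\<tau> \<circ> refl_swap ?x j) = node_count (int n) (refl_swap ?x j \<circ> ?s) ?x d ((k - refl_rank n \<tau>) - of_bool (j \<noteq> ?x))"
        by (simp only: node_child[OF f(1) hyp_nonzero[OF j]])
    qed
    also have "\<dots> = fresh_count (int n) ?s ?x (Suc d) (k - refl_rank n \<tau>)"
      by (rule children_count[OF f(7,3) fresh_confined[OF m t] f(4-6)])
    finally show "(\<Sum>j\<in>?L \<tau>. ?h (\<tau> \<circ> refl_swap ?x j)) = fresh_count (int n) ?s ?x (Suc d) (k - refl_rank n \<tau>)" .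
  qed
  finally show ?thesis .
qed

lemma fresh_sum_eq_node_sum:
  assumes m: "Suc (Suc m) < n"
  shows "fresh_sum n (Suc m) d k = node_sum n (Suc m) d k"
  unfolding fresh_sum_def node_sum_def
proof (rule sum.cong[OF refl])
  fix \<tau> assume t: "\<tau> \<in> partial_interval n (Suc m)"
  show "fresh_count (int n) (fresh_complement n (Suc m) \<tau>) (int (Suc (Suc m))) d (k - refl_rank n \<tau>)
      = node_count (int n) (kreweras n (Suc m) \<tau>) (int (Suc m)) d (k - refl_rank n \<tau>)"
    by (rule fresh_from_node(2)[OF m t node_confined[OF _ t]]) (use m in simp)
qed

text \<open>Counting the descendants on a fixed level gives the same total from every level above it.\<close>

lemma node_sum_root:
  assumes "Suc m < n"
  shows "node_sum n (Suc m) d k = fresh_sum n 0 (d + Suc m) k"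
  using assms
proof (induction m arbitrary: d)
  case 0
  then show ?case using node_sum_eq_fresh_sum[of 0 n d k] by simp
next
  case (Suc m)
  have "node_sum n (Suc (Suc m)) d k = fresh_sum n (Suc m) (Suc d) k"
    by (rule node_sum_eq_fresh_sum[OF Suc.prems])
  also have "\<dots> = node_sum n (Suc m) (Suc d) k" by (rule fresh_sum_eq_node_sum[OF Suc.prems])
  also have "\<dots> = fresh_sum n 0 (Suc d + Suc m) k" by (rule Suc.IH) (use Suc.prems in simp)
  finally show ?case by simp
qed

lemma fresh_sum_root:
  assumes n: "n \<ge> 2"
  shows "fresh_sum n 0 (n - 1) k = ibinom n k ^ 2"
proof -
  let ?r = "refl_swap (int n) (- int n)"
  have rid: "id \<noteq> ?r"
  proof
    assume "id = ?r"
    then have "id (int n) = ?r (int n)" by (rule fun_cong)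
    then show False using n by simp
  qed
  have nS: "int n \<in> signed_points n" "- int n \<in> signed_points n" "int n \<noteq> - int n"
    using n by (auto simp: mem_signed_points)
  have "fix_dim n id = fix_dim n (id \<circ> ?r) + 1"
    by (rule fix_dim_comp_refl[OF hyp_id nS(1,2) _ nS(3)]) simp
  then have rk: "refl_rank n id = 0" "refl_rank n ?r = 1"
    by (simp_all add: refl_rank_def fix_dim_id)
  have mem: "id \<in> partial_interval n 0" "?r \<in> partial_interval n 0" using partial_interval_0[OF n] by auto
  let ?h = "\<lambda>\<tau>. fresh_count (int n) (fresh_complement n 0 \<tau>) 1 (n - 1) (k - refl_rank n \<tau>)"
  have "fresh_sum n 0 (n - 1) k = (\<Sum>\<tau>\<in>{id, ?r}. ?h \<tau>)"
    unfolding fresh_sum_def partial_interval_0[OF n] by simp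
  also have "\<dots> = ?h id + ?h ?r" using rid by simp
  also have "?h id = zero_count 0 (n - 1) k + 2 * merge_count 0 (n - 1) k"
    using fresh_complement_root(2)[OF n mem(1), of "n - 1" k] rk by simp
  also have "?h ?r = zero_count 0 (n - 1) (k - 1)"
    using fresh_complement_root(2)[OF n mem(2), of "n - 1" "k - 1"] rk rid by simp
  finally show ?thesis using root_count[of "n - 1" k] n by simp
qed

lemma node_count_0: "node_count z \<sigma> x 0 k = (if k = 0 then 1 else 0)"
  by (simp add: node_count_def zero_count_0 paired_count_0 merge_count_0)

text \<open>On the last level no descendants remain, so the sum over the nodes counts those of rank \<open>k\<close>.\<close>

theorem card_partial_interval_rank:
  assumes n: "n \<ge> 2"
  shows "card {\<tau> \<in> partial_interval n (n - 1). fix_dim n \<tau> + k = n} = (n choose k) ^ 2"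
proof -
  let ?X = "partial_interval n (n - 1)"
  have nm: "n - 1 = Suc (n - 2)" "Suc (n - 2) < n" using n by auto
  have "node_sum n (n - 1) 0 (int k) = (\<Sum>\<tau>\<in>?X. if fix_dim n \<tau> + k = n then 1 else 0)"
    unfolding node_sum_def node_count_0 refl_rank_def by (rule sum.cong[OF refl]) auto
  also have "\<dots> = int (card {\<tau> \<in> ?X. fix_dim n \<tau> + k = n})"
    by (simp add: sum.If_cases Int_def)
  finally have "int (card {\<tau> \<in> ?X. fix_dim n \<tau> + k = n}) = node_sum n (Suc (n - 2)) 0 (int k)"
    using nm(1) by simp
  also have "\<dots> = fresh_sum n 0 (0 + Suc (n - 2)) (int k)" by (rule node_sum_root[OF nm(2)])
  also have "0 + Suc (n - 2) = n - 1" using n by simp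
  also have "fresh_sum n 0 (n - 1) (int k) = ibinom n (int k) ^ 2" by (rule fresh_sum_root[OF n])
  also have "\<dots> = int ((n choose k) ^ 2)" by (simp add: ibinom_def)
  finally show ?thesis by (simp only: of_nat_eq_iff)
qed

section \<open>The two-cycle permutation\<close>

definition outer_cycle :: "nat \<Rightarrow> int \<Rightarrow> int" where
  "outer_cycle m y = (if 0 < y \<and> y < int m then y + 1 else if y < 0 \<and> - int m < y then y - 1
     else if m > 0 \<and> y = int m then - 1 else if m > 0 \<and> y = - int m then 1 else y)"

lemma cycle_of_list_outer:
  "cycle_of_list ([1..int m] @ map uminus [1..int m]) = outer_cycle m"
proof
  fix y
  let ?c = "[1..int m] @ map uminus [1..int m]"
  have len: "length ?c = 2 * m" by simp
  have dist: "cycle ?c" by (auto simp: distinct_map inj_on_def)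
  have rot: "map (cycle_of_list ?c) ?c = rotate1 ?c"
    using cyclic_rotation[OF dist, of 1] by simp
  have step: "cycle_of_list ?c (?c ! i) = ?c ! (Suc i mod (2 * m))" if "i < 2 * m" for i
  proof -
    have "cycle_of_list ?c (?c ! i) = map (cycle_of_list ?c) ?c ! i" using that len by (simp only: nth_map)
    also have "\<dots> = ?c ! (Suc i mod (2 * m))" unfolding rot using that len by (simp only: nth_rotate1)
    finally show ?thesis .
  qed
  have nth1: "?c ! i = 1 + int i" if "i < m" for i using that by (simp add: nth_append)
  have nth2: "?c ! (m + i) = - (1 + int i)" if "i < m" for i using that by (simp add: nth_append)
  consider "0 < y" "y < int m" | "0 < m" "y = int m" | "y < 0" "- int m < y" | "0 < m" "y = - int m"
    | "y = 0 \<or> int m < \<bar>y\<bar>" by linarith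
  then show "cycle_of_list ?c y = outer_cycle m y"
  proof cases
    case 1
    define i where "i = nat (y - 1)"
    have i: "Suc i < m" "y = 1 + int i" using 1 by (auto simp: i_def)
    then have "cycle_of_list ?c y = ?c ! (Suc i)" using step[of i] nth1[of i] by simp
    then show ?thesis using nth1[of "Suc i"] i 1 by (simp add: outer_cycle_def)
  next
    case 2
    then have "cycle_of_list ?c y = ?c ! m" using step[of "m - 1"] nth1[of "m - 1"] by simp
    then show ?thesis using nth2[of 0] 2 by (simp add: outer_cycle_def)
  next
    case 3
    define i where "i = nat (- y - 1)"
    have i: "Suc i < m" "y = - (1 + int i)" using 3 by (auto simp: i_def)
    then have "cycle_of_list ?c y = ?c ! (m + Suc i)" using step[of "m + i"] nth2[of i] by simp
    then show ?thesis using nth2[of "Suc i"] i 3 by (simp add: outer_cycle_def)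
  next
    case 4
    have e: "Suc (m + (m - 1)) = 2 * m" using 4 by simp
    have "y = ?c ! (m + (m - 1))" using nth2[of "m - 1"] 4 by simp
    then have "cycle_of_list ?c y = ?c ! (Suc (m + (m - 1)) mod (2 * m))" using step[of "m + (m - 1)"] 4 by simp
    also have "Suc (m + (m - 1)) mod (2 * m) = 0" unfolding e by simp
    finally show ?thesis using nth1[of 0] 4 by (simp add: outer_cycle_def)
  next
    case 5
    then have "y \<notin> set ?c" by auto
    then have "cycle_of_list ?c y = y" by (rule id_outside_supp)
    moreover have "outer_cycle m y = y" using 5 by (auto simp: outer_cycle_def)
    ultimately show ?thesis by simp
  qed
qed

lemma outer_cycle_Suc:
  "outer_cycle m (refl_swap (int (Suc m)) (if m = 0 then - 1 else int m) y) = outer_cycle (Suc m) y"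
proof (cases "m = 0")
  case True
  then show ?thesis by (auto simp: refl_swap_def outer_cycle_def)
next
  case False
  consider "y = int (Suc m)" | "y = - int (Suc m)" | "y = int m" | "y = - int m" | "\<bar>y\<bar> \<noteq> int (Suc m)" "\<bar>y\<bar> \<noteq> int m"
    by linarith
  then show ?thesis
  proof cases
    case 5
    then have "refl_swap (int (Suc m)) (int m) y = y" by (intro refl_swap_other) auto
    then show ?thesis using 5 False by (auto simp: outer_cycle_def)
  qed (use False in \<open>auto simp: refl_swap_def outer_cycle_def\<close>)
qed

lemma annulus_cycle_outer:
  assumes "m < n"
  shows "annulus_cycle n m y = (if \<bar>y\<bar> = int n then - y else outer_cycle m y)"
  using assms
proof (induction m arbitrary: y)
  case 0
  then show ?case by (auto simp: refl_swap_def outer_cycle_def)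
next
  case (Suc m)
  let ?r = "refl_swap (int (Suc m)) (if m = 0 then - 1 else int m)"
  have step: "annulus_cycle n (Suc m) y = (if \<bar>?r y\<bar> = int n then - ?r y else outer_cycle m (?r y))"
    using Suc by simp
  show ?case
  proof (cases "\<bar>y\<bar> = int n")
    case True
    then have "?r y = y" using Suc.prems by (intro refl_swap_other) auto
    then show ?thesis unfolding step using True by simp
  next
    case False
    then have "\<bar>?r y\<bar> \<noteq> int n" using Suc.prems by (auto simp: refl_swap_def)
    then show ?thesis unfolding step outer_cycle_Suc using False by simp
  qed
qed

lemma B_gamma_eq:
  assumes n: "n \<ge> 2"
  shows "B_gamma (n - 1) 1 = annulus_cycle n (n - 1)"
proof
  fix y
  have one: "[int (n - 1) + 1..int (n - 1 + 1)] = [int n]" using n by simp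
  have "B_gamma (n - 1) 1 y = outer_cycle (n - 1) (transpose (int n) (- int n) y)"
    unfolding B_gamma_def cycle_of_list_outer one by simp
  also have "\<dots> = (if \<bar>y\<bar> = int n then - y else outer_cycle (n - 1) y)"
    using n by (auto simp: transpose_def outer_cycle_def)
  also have "\<dots> = annulus_cycle n (n - 1) y" using n by (simp add: annulus_cycle_outer)
  finally show "B_gamma (n - 1) 1 y = annulus_cycle n (n - 1) y" .
qed

lemma S_nc_B_eq:
  assumes n: "n \<ge> 2"
  shows "S_nc_B (n - 1) 1 = partial_interval n (n - 1)"
proof -
  have g: "annulus_cycle n (n - 1) \<in> hyperoctahedral n" using n by (intro annulus_cycle_hyp) simp
  have N: "n - 1 + 1 = n" using n by simp
  have "B_le n \<tau> (annulus_cycle n (n - 1)) \<longleftrightarrow> fix_dim n \<tau> + fix_dim n (inv \<tau> \<circ> annulus_cycle n (n - 1))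
      = n + fix_dim n (annulus_cycle n (n - 1))" if t: "\<tau> \<in> hyperoctahedral n" for \<tau>
    unfolding B_le_def
    using B_length_eq[OF t] B_length_eq[OF g] B_length_eq[OF hyp_comp[OF hyp_inv[OF t] g]] by linarith
  moreover have "\<not> (int (n - 1) < \<bar>y\<bar> \<and> \<bar>y\<bar> < int n)" for y using n by auto
  ultimately show ?thesis
    unfolding S_nc_B_def N B_gamma_eq[OF n] partial_interval_def by blast
qed

section \<open>An element below the two-cycle permutation is determined by its merged partition\<close>

text \<open>The value at \<open>x\<close> which a function must have in order to be fixed by the reflection exchanging \<open>x\<close> and \<open>j\<close>. For
\<open>j = - x\<close> that value is 0, since \<open>f x = - f x\<close>; the value \<open>f j\<close> would depend on \<open>f x\<close> itself.\<close>

definition pinned :: "int \<Rightarrow> int \<Rightarrow> (int \<Rightarrow> 3) \<Rightarrow> 3" where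
  "pinned x j f = (if j = - x then 0 else f j)"

lemma pinned_eq_if_fixed_refl:
  assumes x: "x \<in> signed_points N" and j: "j \<in> signed_points N" and V: "f \<in> odd_functions N"
  shows "f \<in> fixed_functions N (refl_swap x j) \<longleftrightarrow> f x = pinned x j f"
proof (cases "j = - x")
  case True
  have odd: "f (- x) = - f x" using V by (simp add: odd_functions_def)
  have "f x = - f x \<longleftrightarrow> f x = 0"
  proof
    assume "f x = - f x"
    then have "f x + f x = 0" by (metis add.right_inverse)
    then show "f x = 0" by (rule Z3_double_eq_0)
  qed simp
  then show ?thesis using fixed_refl_iff[OF x j V] True odd by (simp add: pinned_def)
next
  case False
  then show ?thesis using fixed_refl_iff[OF x j V] by (simp add: pinned_def)
qed

definition repin :: "int \<Rightarrow> 3 \<Rightarrow> (int \<Rightarrow> 3) \<Rightarrow> int \<Rightarrow> 3" where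
  "repin x c f = f(x := c, - x := - c)"

lemma repin_fixed:
  assumes t: "\<tau> \<in> hyperoctahedral N" and x: "x \<in> signed_points N" and fx: "\<tau> x = x"
    and f: "f \<in> fixed_functions N \<tau>"
  shows "repin x c f \<in> fixed_functions N \<tau>"
proof -
  have nz: "x \<noteq> 0" by (rule hyp_nonzero[OF x])
  have fmx: "\<tau> (- x) = - x" using hyp_odd[OF t, of x] fx by simp
  have iff: "\<tau> y = x \<longleftrightarrow> y = x" "\<tau> y = - x \<longleftrightarrow> y = - x" for y
    using hyp_inj[OF t, of y x] hyp_inj[OF t, of y "- x"] fx fmx by auto
  have ff: "f (\<tau> y) = f y" "f (- y) = - f y" "y \<notin> signed_points N \<Longrightarrow> f y = 0" for y
    using f by (auto simp: fixed_functions_def odd_functions_def)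
  have "repin x c f (- y) = - repin x c f y" for y
    using ff(2)[of y] nz by (auto simp: repin_def)
  moreover have "repin x c f y = 0" if "y \<notin> signed_points N" for y
    using ff(3)[OF that] x that by (auto simp: repin_def)
  moreover have "repin x c f (\<tau> y) = repin x c f y" for y
    using ff(1)[of y] iff[of y] by (simp add: repin_def)
  ultimately show ?thesis by (simp add: fixed_functions_def odd_functions_def)
qed

lemma repin_same: "repin x c f x = c" if "x \<noteq> 0"
  using that by (simp add: repin_def)

lemma pinned_repin: "x \<noteq> 0 \<Longrightarrow> j \<noteq> x \<Longrightarrow> pinned x j (repin x c f) = pinned x j f"
  by (simp add: pinned_def repin_def)

text \<open>The right-hand side depends only on the space of \<open>\<tau> r\<close>: deleting the point \<open>x\<close> from its orbit frees the value
at \<open>x\<close> and changes nothing else.\<close>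

lemma fixed_functions_deleted_point:
  assumes t: "\<tau> \<in> hyperoctahedral N" and x: "x \<in> signed_points N" and j: "j \<in> signed_points N"
    and fx: "\<tau> x = x"
  shows "fixed_functions N \<tau> = {repin x c f | c f. f \<in> fixed_functions N (\<tau> \<circ> refl_swap x j)}"
proof
  have nz: "x \<noteq> 0" by (rule hyp_nonzero[OF x])
  note eq = fixed_functions_comp_refl[OF t x j fx]
  show "{repin x c f | c f. f \<in> fixed_functions N (\<tau> \<circ> refl_swap x j)} \<subseteq> fixed_functions N \<tau>"
    using repin_fixed[OF t x fx] eq by blast
  show "fixed_functions N \<tau> \<subseteq> {repin x c f | c f. f \<in> fixed_functions N (\<tau> \<circ> refl_swap x j)}"
  proof
    fix f assume f: "f \<in> fixed_functions N \<tau>"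
    have odd: "f (- x) = - f x" using f by (simp add: fixed_functions_def odd_functions_def)
    have restore: "repin x (f x) (repin x c f) = f" for c using odd nz by (auto simp: repin_def)
    show "f \<in> {repin x c f | c f. f \<in> fixed_functions N (\<tau> \<circ> refl_swap x j)}"
    proof (cases "j = x")
      case True
      then have "repin x (f x) f = f" "f \<in> fixed_functions N (\<tau> \<circ> refl_swap x j)"
        using f odd by (auto simp: repin_def)
      then have "f = repin x (f x) f \<and> f \<in> fixed_functions N (\<tau> \<circ> refl_swap x j)" by simp
      then show ?thesis by blast
    next
      case False
      let ?g = "repin x (pinned x j f) f"
      have g: "?g \<in> fixed_functions N \<tau>" by (rule repin_fixed[OF t x fx f])
      then have "?g \<in> odd_functions N" using fixed_functions_subset by blast
      then have "?g \<in> fixed_functions N (refl_swap x j)"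
        using pinned_eq_if_fixed_refl[OF x j] repin_same[OF nz] pinned_repin[OF nz False] by simp
      then have "?g \<in> fixed_functions N (\<tau> \<circ> refl_swap x j)" using g eq by blast
      moreover have "f = repin x (f x) ?g" using restore by simp
      ultimately show ?thesis by blast
    qed
  qed
qed

text \<open>Tested on the indicators of \<open>i\<close> and of \<open>j\<close>.\<close>

lemma pinned_determines:
  assumes x: "x \<in> signed_points N" and i: "i \<in> signed_points N" "i \<noteq> x" and j: "j \<in> signed_points N" "j \<noteq> x"
    and eq: "\<And>f. f \<in> odd_functions N \<Longrightarrow> pinned x i f = pinned x j f"
  shows "i = j"
proof -
  have nz: "x \<noteq> 0" "i \<noteq> 0" "j \<noteq> 0" using hyp_nonzero x i j by auto
  have *: "b = a" if a: "a \<in> signed_points N" "a \<noteq> - x"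
    and ab: "pinned x a (odd_indicator {a}) = pinned x b (odd_indicator {a})" for a b
  proof (rule ccontr)
    assume "b \<noteq> a"
    then have "pinned x b (odd_indicator {a}) \<noteq> 1"
      by (simp add: pinned_def odd_indicator_singleton)
    moreover have "pinned x a (odd_indicator {a}) = 1"
      using a by (simp add: pinned_def odd_indicator_singleton)
    ultimately show False using ab by simp
  qed
  show ?thesis
  proof (cases "i = - x")
    case False
    show ?thesis by (rule *[OF i(1) False eq[OF odd_indicator_mem[OF i(1)]], symmetric])
  next
    case True
    show ?thesis
    proof (rule ccontr)
      assume "i \<noteq> j"
      then have "j \<noteq> - x" using True by simp
      then have "i = j" by (rule *[OF j(1) _ eq[OF odd_indicator_mem[OF j(1)], symmetric]])
      with \<open>i \<noteq> j\<close> show False ..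
    qed
  qed
qed

text \<open>Two lowering reflections with the same effect on the space of \<open>\<tau>\<close> impose the same condition there, and on the
space of \<open>\<sigma>\<close> both conditions hold anyway. The two spaces span all odd functions, so the conditions coincide.\<close>

lemma lowering_unique:
  assumes t: "\<tau> \<in> hyperoctahedral N" and s: "\<sigma> \<in> hyperoctahedral N"
    and x: "x \<in> signed_points N" and fx: "\<tau> x = x"
    and dims: "fix_dim N \<tau> + fix_dim N \<sigma> = N + fix_dim N (\<tau> \<circ> \<sigma>)"
    and i: "i \<in> lowering N \<sigma> x" and j: "j \<in> lowering N \<sigma> x"
    and eq: "fixed_functions N (\<tau> \<circ> refl_swap x i) = fixed_functions N (\<tau> \<circ> refl_swap x j)"
  shows "i = j"
proof -
  have iS: "i \<in> signed_points N" and jS: "j \<in> signed_points N" using i j lowering_subset by blast+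
  have nz: "x \<noteq> 0" by (rule hyp_nonzero[OF x])
  have tsub: "fixed_functions N \<tau> \<subseteq> odd_functions N" by (rule fixed_functions_subset)
  have free: "b = x" if "b \<in> signed_points N" "fixed_functions N (\<tau> \<circ> refl_swap x b) = fixed_functions N \<tau>" for b
  proof -
    have "(odd_indicator {x} :: int \<Rightarrow> 3) \<in> fixed_functions N (refl_swap x b)"
      using odd_indicator_fixed_point[OF t x fx] fixed_functions_comp_refl[OF t x that(1) fx] that(2) by blast
    then have "(odd_indicator {x} :: int \<Rightarrow> 3) x = odd_indicator {x} b"
      using fixed_refl_iff[OF x that(1) odd_indicator_mem[OF x]] by blast
    then show ?thesis by (simp add: odd_indicator_singleton split: if_splits)
  qed
  show ?thesis
  proof (cases "i = x \<or> j = x")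
    case True
    have "\<tau> \<circ> refl_swap x x = \<tau>" by simp
    then have "i = x \<and> j = x" using True eq free[OF iS] free[OF jS] by metis
    then show ?thesis by simp
  next
    case False
    then have ne: "i \<noteq> x" "j \<noteq> x" by auto
    have on_t: "pinned x i f = pinned x j f" if f: "f \<in> fixed_functions N \<tau>" for f
    proof -
      let ?g = "repin x (pinned x i f) f"
      have g: "?g \<in> fixed_functions N \<tau>" by (rule repin_fixed[OF t x fx f])
      then have V: "?g \<in> odd_functions N" using tsub by blast
      have "?g \<in> fixed_functions N (refl_swap x i)"
        unfolding pinned_eq_if_fixed_refl[OF x iS V] repin_same[OF nz] pinned_repin[OF nz ne(1)] ..
      then have "?g \<in> fixed_functions N (refl_swap x j)"
        using g eq fixed_functions_comp_refl[OF t x iS fx] fixed_functions_comp_refl[OF t x jS fx] by blast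
      then show ?thesis
        unfolding pinned_eq_if_fixed_refl[OF x jS V] repin_same[OF nz] pinned_repin[OF nz ne(2)] .
    qed
    have on_s: "f x = pinned x a f" if f: "f \<in> fixed_functions N \<sigma>" and a: "a \<in> lowering N \<sigma> x" "a \<noteq> x" for f a
    proof -
      have aS: "a \<in> signed_points N" using a lowering_subset by blast
      have "fixed_functions N \<sigma> \<subseteq> fixed_functions N (refl_swap x a)"
        by (rule fixed_subset_if_fix_dim_increases[OF s x aS]) (use a in \<open>simp add: lowering_def\<close>)
      then have "f \<in> fixed_functions N (refl_swap x a)" using f by blast
      moreover have "f \<in> odd_functions N" using f fixed_functions_subset by blast
      ultimately show ?thesis using pinned_eq_if_fixed_refl[OF x aS] by blast
    qed
    have "pinned x i f = pinned x j f" if f: "f \<in> odd_functions N" for f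
    proof -
      obtain a b where ab: "a \<in> fixed_functions N \<tau>" "b \<in> fixed_functions N \<sigma>" "f = a - b"
        using odd_functions_eq_fixed_sum[OF t s dims f] by blast
      have lin: "pinned x c f = pinned x c a - pinned x c b" for c
        unfolding ab(3) by (simp add: pinned_def)
      show ?thesis
        unfolding lin using on_t[OF ab(1)] on_s[OF ab(2) i ne(1)] on_s[OF ab(2) j ne(2)] by simp
    qed
    then show ?thesis by (intro pinned_determines[OF x iS ne(1) jS ne(2)])
  qed
qed

text \<open>An element below the two-cycle permutation is determined by its space of invariant functions; this is the
combinatorial form of a theorem of Brady and Watt for orthogonal groups.\<close>

theorem inj_on_fixed_functions:
  assumes "n \<ge> 2" "m < n"
  shows "inj_on (fixed_functions n) (partial_interval n m)"
  using assms(2)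
proof (induction m)
  case 0
  let ?r = "refl_swap (int n) (- int n)"
  have nS: "int n \<in> signed_points n" "- int n \<in> signed_points n" "int n \<noteq> - int n"
    using 0 by (auto simp: mem_signed_points)
  have rh: "?r \<in> hyperoctahedral n" by (rule refl_swap_hyp[OF nS(1,2)])
  have "fix_dim n id = fix_dim n (id \<circ> ?r) + 1"
    by (rule fix_dim_comp_refl[OF hyp_id nS(1,2) _ nS(3)]) simp
  then have "fix_dim n id \<noteq> fix_dim n ?r" by simp
  moreover have "fix_dim n id \<le> fix_dim n ?r" if "fixed_functions n id = fixed_functions n ?r"
    by (rule fix_dim_mono[OF hyp_id rh]) (use that in simp)
  moreover have "fix_dim n ?r \<le> fix_dim n id" if "fixed_functions n id = fixed_functions n ?r"
    by (rule fix_dim_mono[OF rh hyp_id]) (use that in simp)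
  ultimately have "fixed_functions n id \<noteq> fixed_functions n ?r" by linarith
  then show ?case unfolding partial_interval_0[OF assms(1)] inj_on_def by auto
next
  case (Suc m)
  have m: "Suc m < n" by (rule Suc.prems)
  have IH: "inj_on (fixed_functions n) (partial_interval n m)" using Suc by simp
  let ?x = "int (Suc m)"
  show ?case
  proof (rule inj_onI)
    fix \<tau>1 \<tau>2 assume t12: "\<tau>1 \<in> partial_interval n (Suc m)" "\<tau>2 \<in> partial_interval n (Suc m)"
      and eq: "fixed_functions n \<tau>1 = fixed_functions n \<tau>2"
    obtain \<tau> i where t: "\<tau> \<in> partial_interval n m" and i: "i \<in> lowering n (fresh_complement n m \<tau>) ?x"
      and t1: "\<tau>1 = \<tau> \<circ> refl_swap ?x i" by (rule partial_interval_SucE[OF m t12(1)])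
    obtain \<tau>' j where t': "\<tau>' \<in> partial_interval n m" and j: "j \<in> lowering n (fresh_complement n m \<tau>') ?x"
      and t2: "\<tau>2 = \<tau>' \<circ> refl_swap ?x j" by (rule partial_interval_SucE[OF m t12(2)])
    note f = partial_interval_step_facts[OF m t] and f' = partial_interval_step_facts[OF m t']
    have iS: "i \<in> signed_points n" and jS: "j \<in> signed_points n" using i j lowering_subset by blast+
    have "fixed_functions n \<tau> = fixed_functions n \<tau>'"
      unfolding fixed_functions_deleted_point[OF f(1,3) iS f(2)] fixed_functions_deleted_point[OF f'(1,3) jS f'(2)]
      using eq t1 t2 by simp
    then have same: "\<tau>' = \<tau>" using inj_onD[OF IH _ t t'] by simp
    have "\<tau> \<circ> fresh_complement n m \<tau> = annulus_cycle n (Suc m)"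
      unfolding fresh_complement_def by (rule ext) (simp only: o_apply hyp_inv_comp(2)[OF f(1)])
    moreover have "fix_dim n \<tau> + fix_dim n (fresh_complement n m \<tau>) = n + fix_dim n (annulus_cycle n (Suc m))"
      using partial_interval_fresh_iff[OF m f(1)] partial_interval_fixes[OF t] t by blast
    ultimately have dims: "fix_dim n \<tau> + fix_dim n (fresh_complement n m \<tau>) = n + fix_dim n (\<tau> \<circ> fresh_complement n m \<tau>)"
      by (simp only:)
    have "i = j"
      by (rule lowering_unique[OF f(1) f(7) f(3) f(2) dims i])
         (use j eq t1 t2 same in simp_all)
    then show "\<tau>1 = \<tau>2" using t1 t2 same by simp
  qed
qed

section \<open>Merged orbit partitions\<close>

text \<open>Merging the invariant orbits does not affect the invariant functions, which vanish on all of them.\<close>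

lemma merged_orbit_partition_facts:
  assumes t: "\<tau> \<in> hyperoctahedral N"
  shows "{A \<in> merged_orbit_partition N \<tau>. \<not> inversion_invariant A} = paired_orbits N \<tau>"
    and "fixed_functions N \<tau> = {f \<in> odd_functions N. \<forall>B\<in>merged_orbit_partition N \<tau>. \<forall>u\<in>B. \<forall>v\<in>B. f u = f v}"
proof -
  define Z where "Z = {A \<in> orbit_partition N \<tau>. inversion_invariant A}"
  have M: "merged_orbit_partition N \<tau> = (orbit_partition N \<tau> - Z) \<union> (if Z = {} then {} else {\<Union>Z})"
    unfolding merged_orbit_partition_def Z_def Let_def ..
  have UZ: "inversion_invariant (\<Union>Z)"
    unfolding inversion_invariant_def image_Union by (auto simp: Z_def inversion_invariant_def)
  have "{A \<in> merged_orbit_partition N \<tau>. \<not> inversion_invariant A}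
      = {A \<in> orbit_partition N \<tau> - Z. \<not> inversion_invariant A}"
    unfolding M using UZ by (cases "Z = {}") auto
  also have "\<dots> = paired_orbits N \<tau>" by (auto simp: paired_orbits_def Z_def)
  finally show "{A \<in> merged_orbit_partition N \<tau>. \<not> inversion_invariant A} = paired_orbits N \<tau>" .
  have zero: "f u = 0" if f: "f \<in> fixed_functions N \<tau>" and u: "u \<in> \<Union>Z" for f u
  proof -
    obtain y where y: "u \<in> orbit \<tau> y" "inversion_invariant (orbit \<tau> y)"
      using u by (auto simp: Z_def orbit_partition_def)
    then have "- u \<in> orbit \<tau> u"
      using invariant_orbit_cong[OF t y(1)] inversion_invariant_orbit_iff[OF t] by blast
    then show ?thesis by (rule fixed_function_invariant_orbit[OF f])
  qed
  show "fixed_functions N \<tau> = {f \<in> odd_functions N. \<forall>B\<in>merged_orbit_partition N \<tau>. \<forall>u\<in>B. \<forall>v\<in>B. f u = f v}"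
  proof (intro set_eqI iffI)
    fix f assume f: "f \<in> fixed_functions N \<tau>"
    have "f u = f v" if B: "B \<in> merged_orbit_partition N \<tau>" "u \<in> B" "v \<in> B" for B u v
    proof (cases "B = \<Union>Z")
      case True
      then show ?thesis using zero[OF f] B by simp
    next
      case False
      then obtain y where "B = orbit \<tau> y" using B(1) unfolding M by (auto simp: orbit_partition_def split: if_splits)
      then show ?thesis using fixed_function_orbit[OF f] B by simp
    qed
    then show "f \<in> {f \<in> odd_functions N. \<forall>B\<in>merged_orbit_partition N \<tau>. \<forall>u\<in>B. \<forall>v\<in>B. f u = f v}"
      using f fixed_functions_subset by blast
  next
    fix f assume "f \<in> {f \<in> odd_functions N. \<forall>B\<in>merged_orbit_partition N \<tau>. \<forall>u\<in>B. \<forall>v\<in>B. f u = f v}"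
    then have V: "f \<in> odd_functions N" and const: "\<And>B u v. B \<in> merged_orbit_partition N \<tau> \<Longrightarrow> u \<in> B \<Longrightarrow> v \<in> B \<Longrightarrow> f u = f v"
      by blast+
    have "f (\<tau> y) = f y" for y
    proof (cases "y \<in> signed_points N")
      case False
      then show ?thesis using hyp_outside[OF t] by simp
    next
      case True
      then have O: "orbit \<tau> y \<in> orbit_partition N \<tau>" by (simp add: orbit_partition_def)
      have y: "y \<in> orbit \<tau> y" "\<tau> y \<in> orbit \<tau> y" by (rule self_mem_orbit[OF t], rule orbit.base)
      show ?thesis
      proof (cases "orbit \<tau> y \<in> Z")
        case True
        then have "\<Union>Z \<in> merged_orbit_partition N \<tau>" unfolding M by auto
        moreover have "y \<in> \<Union>Z" "\<tau> y \<in> \<Union>Z" using y True by blast+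
        ultimately show ?thesis using const by blast
      next
        case False
        then have "orbit \<tau> y \<in> merged_orbit_partition N \<tau>" unfolding M using O by blast
        then show ?thesis using const y by blast
      qed
    qed
    then show "f \<in> fixed_functions N \<tau>" using V by (simp add: fixed_functions_def)
  qed
qed

theorem theorem3p2:
  fixes n :: nat
  assumes "n \<ge> 2"
  shows "card (NC_B (n - 1) 1) = (2 * n) choose n
       \<and> (\<forall>k\<le>n. card {\<pi> \<in> NC_B (n - 1) 1. NC_B_rank (n - 1) 1 \<pi> = real k} = (n choose k) ^ 2)"
proof -
  let ?X = "partial_interval n (n - 1)" and ?M = "merged_orbit_partition n"
  have N: "n - 1 + 1 = n" using assms by simp
  have NC: "NC_B (n - 1) 1 = ?M ` ?X"
    unfolding NC_B_def N S_nc_B_eq[OF assms] ..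
  have inj: "inj_on ?M ?X"
  proof (rule inj_onI)
    fix \<sigma> \<tau> assume st: "\<sigma> \<in> ?X" "\<tau> \<in> ?X" and eq: "?M \<sigma> = ?M \<tau>"
    have "fixed_functions n \<sigma> = fixed_functions n \<tau>"
      unfolding merged_orbit_partition_facts(2)[OF partial_interval_hyp[OF st(1)]]
        merged_orbit_partition_facts(2)[OF partial_interval_hyp[OF st(2)]] eq ..
    then show "\<sigma> = \<tau>" using inj_onD[OF inj_on_fixed_functions[OF assms, of "n - 1"] _ st] assms by simp
  qed
  have rank: "NC_B_rank (n - 1) 1 (?M \<tau>) = real n - real (fix_dim n \<tau>)" if "\<tau> \<in> ?X" for \<tau>
    using merged_orbit_partition_facts(1)[OF partial_interval_hyp[OF that]]
      card_paired_orbits[OF partial_interval_hyp[OF that]]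
    unfolding NC_B_rank_def N by simp
  have level: "card {\<pi> \<in> NC_B (n - 1) 1. NC_B_rank (n - 1) 1 \<pi> = real k} = (n choose k) ^ 2" for k
  proof -
    have "{\<pi> \<in> NC_B (n - 1) 1. NC_B_rank (n - 1) 1 \<pi> = real k} = ?M ` {\<tau> \<in> ?X. NC_B_rank (n - 1) 1 (?M \<tau>) = real k}"
      unfolding NC by blast
    also have "{\<tau> \<in> ?X. NC_B_rank (n - 1) 1 (?M \<tau>) = real k} = {\<tau> \<in> ?X. fix_dim n \<tau> + k = n}"
      using rank by (auto simp: of_nat_diff)
    also have "card (?M ` \<dots>) = card {\<tau> \<in> ?X. fix_dim n \<tau> + k = n}"
      by (rule card_image) (rule inj_on_subset[OF inj], blast)
    finally show ?thesis using card_partial_interval_rank[OF assms] by simp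
  qed
  have "card (NC_B (n - 1) 1) = card ?X" unfolding NC by (rule card_image[OF inj])
  also have "?X = (\<Union>k\<in>{..n}. {\<tau> \<in> ?X. fix_dim n \<tau> + k = n})"
  proof (intro equalityI subsetI)
    fix \<tau> assume t: "\<tau> \<in> ?X"
    then have "fix_dim n \<tau> + (n - fix_dim n \<tau>) = n" using fix_dim_le[OF partial_interval_hyp[OF t]] by simp
    then show "\<tau> \<in> (\<Union>k\<in>{..n}. {\<tau> \<in> ?X. fix_dim n \<tau> + k = n})"
      using t by (intro UN_I[of "n - fix_dim n \<tau>"]) auto
  qed blast
  also have "card \<dots> = (\<Sum>k\<le>n. card {\<tau> \<in> ?X. fix_dim n \<tau> + k = n})"
    by (rule card_UN_disjoint) auto
  also have "\<dots> = (\<Sum>k\<le>n. (n choose k) ^ 2)"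
    by (simp only: card_partial_interval_rank[OF assms])
  also have "\<dots> = (2 * n) choose n" by (rule choose_square_sum)
  finally show ?thesis using level by blast
qed

end
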